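(* Let $M \in {\mathbb M}$ be a string, let $L := \sup\{x \in [0,\infty) : M(x) < \infty\}$ and $M(\infty-) := \lim_{x\to\infty,\, x<\infty} M(x) \in [0,\infty]$. Then $M \in {\mathbb M}^-$ if and only if at least one of the following two conditions holds: (i) $M(\infty-) < \infty$ and, for every $\varepsilon > 0$, $\displaystyle \lim_{x \rightarrow \infty} x \left [ M(\infty-) - M(x) \right ]^{1+\varepsilon} = 0$; (ii) $L < \infty$ and, for every $\varepsilon > 0$, $\displaystyle \lim_{x \rightarrow L-} M(x) \left [ L-x \right ]^{1+\varepsilon} = 0$.
   Context: ${\mathbb M}$ is the set of functions $M : [0,\infty] \to [0,\infty]$ that are non-decreasing, right-continuous and satisfy $M(\infty)=\infty$; elements of ${\mathbb M}$ are called strings. By convention $M(0-)=0$, so that $dM$ is a Stieltjes measure that includes an atom of mass $M(0)$ at $0$. Put $L := \sup\{x\in[0,\infty) : M(x)<\infty\}$ (with $\sup\emptyset = 0$; if $L=0$ the limit as $x\to L-$ in (ii) is vacuous). Characteristic function. For $z<0$ let $\varphi(\cdot,z)$ and $\psi(\cdot,z)$ be the solutions on $[0,L)$ of the string equation $y''+zM'y=0$ with $\varphi(0,z)=1$, $\varphi'(0-,z)=0$ and $\psi(0,z)=0$, $\psi'(0-,z)=1$; i.e. $$ \varphi(x,z) = 1 - z\int_{[0,x]} (x-t)\varphi(t,z)\,dM(t), \qquad \psi(x,z) = x - z\int_{[0,x]} (x-t)\psi(t,z)\,dM(t). $$ The characteristic function of $M$ is $W(z) := \lim_{x\to L-} \psi(x,z)/\varphi(x,z)$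 for $z<0$ (with $W\equiv 0$ if $L=0$), extended to ${\mathbb C}\setminus[0,\infty)$ by analytic continuation. ${\mathbb W}$ is the set of all functions of the form $$ W(z) = c + \int_{[0,\infty)} \frac{d\sigma(\lambda)}{\lambda-z}, \qquad z\in{\mathbb C}\setminus[0,\infty), $$ with $c\ge 0$ and $\sigma$ a right-continuous non-decreasing function supported in $[0,\infty)$ with $\int_{[0,\infty)} \frac{d\sigma(\lambda)}{1+\lambda}<\infty$; $\sigma$ is called the principal spectral function. The degenerate function $W\equiv\infty$ (corresponding to $M\equiv 0$ on $[0,\infty)$) is included. By a known theorem conjectured by Krein, $M\mapsto W$ is a bijection from ${\mathbb M}$ onto ${\mathbb W}$. For $W\in{\mathbb W}$ the dual is $W^\ast(z) := \frac{1}{-zW(z)}$, with $0$ and $\infty$ dual to each other; it is known that $W^\ast\in{\mathbb W}$ and that it is the characteristic function of the dual string $M^\ast$, the right-continuous inverse of $M$. Define $$ W^-(z) := \frac{1}{-z}\,W^\ast\!\left(\frac1z\right), $$ $$ {\mathbb W}^+ := \left\{ W\in{\mathbb W} : \int_{(0,\infty)} \lambda^n\,d\sigma(\lambda)<\infty \text{ for every } n=0,1,2,\ldots\right\}, \qquad {\mathbb W}^- := \{W^- : W\in{\mathbb W}^+\}. $$ ${\mathbb M}^-$ is the set of strings $M\in{\mathbb M}$ whose characteristic function belongs to ${\mathbb W}^-$. *)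

theory Defs
  imports "HOL-Complex_Analysis.Complex_Analysis" "HOL-Library.FuncSet"
begin

definition krein_strings :: "(ennreal \<Rightarrow> ennreal) set" where
  "krein_strings = {M. mono M \<and> (\<forall>x. continuous (at_right x) M) \<and> M \<infinity> = \<infinity>}"

definition string_length :: "(ennreal \<Rightarrow> ennreal) \<Rightarrow> ennreal" where
  "string_length M = Sup {x. x < \<infinity> \<and> M x < \<infinity>}"

definition string_total_mass :: "(ennreal \<Rightarrow> ennreal) \<Rightarrow> ennreal" where
  "string_total_mass M = Lim (at_left \<infinity>) M"

text \<open>
  For \<open>0 \<le> b < L\<close> this is the Stieltjes measure \<open>dM\<close> on \<open>[0,b]\<close> and zero elsewhere. Freezing \<open>M\<close>
  beyond \<open>b\<close> keeps the distribution function real valued, even if \<open>M\<close> blows up at \<open>L\<close>; setting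
  it to \<open>0\<close> on the negative axis produces the atom of mass \<open>M 0\<close> at \<open>0\<close>.
\<close>
definition dM :: "(ennreal \<Rightarrow> ennreal) \<Rightarrow> real \<Rightarrow> real measure" where
  "dM M b = interval_measure (\<lambda>t. if t < 0 then 0 else enn2real (M (ennreal (min t b))))"

text \<open>
  \<open>y'' + z M' y = 0\<close> on \<open>[0,L)\<close> with \<open>y(0) = a\<close>, \<open>y'(0-) = s\<close>, in integrated form.
  Integrability is required explicitly because the Bochner integral is \<open>0\<close> by convention otherwise.
\<close>
definition string_solution ::
    "(ennreal \<Rightarrow> ennreal) \<Rightarrow> real \<Rightarrow> real \<Rightarrow> real \<Rightarrow> (real \<Rightarrow> real) \<Rightarrow> bool" where
  "string_solution M z a s y \<longleftrightarrow>
     (\<forall>x\<ge>0. ennreal x < string_length M \<longrightarrow>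
        set_integrable (dM M x) {0..x} (\<lambda>t. (x - t) * y t) \<and>
        y x = a + s * x - z * (LINT t:{0..x}|dM M x. (x - t) * y t))"

text \<open>Solutions are unique on \<open>[0,L)\<close>; only their values there are used below.\<close>
definition string_phi :: "(ennreal \<Rightarrow> ennreal) \<Rightarrow> real \<Rightarrow> real \<Rightarrow> real" where
  "string_phi M z = (SOME y. string_solution M z 1 0 y)"

definition string_psi :: "(ennreal \<Rightarrow> ennreal) \<Rightarrow> real \<Rightarrow> real \<Rightarrow> real" where
  "string_psi M z = (SOME y. string_solution M z 0 1 y)"

definition slit_plane :: "complex set" where
  "slit_plane = - \<real>\<^sub>\<ge>\<^sub>0"

text \<open>
  Functions on the slit plane: either the constant \<open>\<infinity>\<close>, or a complex valued function, which we
  always take to be extensional (\<open>undefined\<close> off the slit plane) so that equality is equality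
  on the slit plane.
\<close>
datatype slit_fun = Infinite | Proper "complex \<Rightarrow> complex"

definition characteristic_function :: "(ennreal \<Rightarrow> ennreal) \<Rightarrow> slit_fun" where
  "characteristic_function M =
     (let L = string_length M;
          r = (\<lambda>z x. string_psi M z (enn2real x) / string_phi M z (enn2real x))
      in if L = 0 then Proper (\<lambda>z\<in>slit_plane. 0)
         else if \<forall>z<0. filterlim (r z) at_top (at_left L) then Infinite
         else Proper (THE W. W \<in> extensional slit_plane \<and> W holomorphic_on slit_plane \<and>
                (\<forall>z<0. ((\<lambda>x. complex_of_real (r z x)) \<longlongrightarrow> W (complex_of_real z)) (at_left L))))"

definition spectral_representation :: "slit_fun \<Rightarrow> real \<Rightarrow> (real \<Rightarrow> real) \<Rightarrow> bool" where
  "spectral_representation W c \<sigma> \<longleftrightarrow>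
     c \<ge> 0 \<and> mono \<sigma> \<and> (\<forall>x. continuous (at_right x) \<sigma>) \<and> (\<forall>x<0. \<sigma> x = 0) \<and>
     (\<integral>\<^sup>+u\<in>{0..}. ennreal (1 / (1 + u)) \<partial>interval_measure \<sigma>) < \<infinity> \<and>
     W = Proper (\<lambda>z\<in>slit_plane. complex_of_real c +
            (LINT u:{0..}|interval_measure \<sigma>. 1 / (complex_of_real u - z)))"

definition W_class :: "slit_fun set" where
  "W_class = insert Infinite {W. \<exists>c \<sigma>. spectral_representation W c \<sigma>}"

fun dual_fun :: "slit_fun \<Rightarrow> slit_fun" where
  "dual_fun Infinite = Proper (\<lambda>z\<in>slit_plane. 0)"
| "dual_fun (Proper W) =
     (if \<forall>z\<in>slit_plane. W z = 0 then Infinite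
      else Proper (\<lambda>z\<in>slit_plane. 1 / (- z * W z)))"

definition minus_transform :: "slit_fun \<Rightarrow> slit_fun" where
  "minus_transform W = (case dual_fun W of
       Infinite \<Rightarrow> Infinite
     | Proper V \<Rightarrow> Proper (\<lambda>z\<in>slit_plane. 1 / (- z) * V (1 / z)))"

text \<open>
  The function \<open>\<infinity>\<close> has no spectral function, so the moment condition is void for it and it belongs
  to \<open>W_plus\<close>. Thus \<open>W_minus\<close> contains \<open>0\<close>, the characteristic function of the string \<open>M \<equiv> \<infinity>\<close>.
\<close>
definition W_plus :: "slit_fun set" where
  "W_plus = {W \<in> W_class. W = Infinite \<or>
     (\<exists>c \<sigma>. spectral_representation W c \<sigma> \<and>
        (\<forall>n::nat. (\<integral>\<^sup>+u\<in>{0<..}. ennreal (u ^ n) \<partial>interval_measure \<sigma>) < \<infinity>))}"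

definition W_minus :: "slit_fun set" where
  "W_minus = minus_transform ` W_plus"

definition M_minus :: "(ennreal \<Rightarrow> ennreal) set" where
  "M_minus = {M \<in> krein_strings. characteristic_function M \<in> W_minus}"

end

theory Submission
  imports Defs "HOL-Probability.Probability"
begin

text \<open>
  Fix \<open>\<eta> > 0\<close>, put \<open>z = - \<eta>\<close> and cut the string off at a point \<open>x < L\<close>. The quotient
  \<open>V(x) = \<phi>(x,z) / \<psi>(x,z)\<close> of the two fundamental solutions is the Weyl coefficient of the piece
  \<open>[0,x]\<close> with a Dirichlet condition at \<open>x\<close>: the combination \<open>u = \<phi> - V(x) \<psi>\<close> vanishes at \<open>x\<close>. Written with
  the Green function of \<open>- d\<^sup>2/dt\<^sup>2\<close> on \<open>[0,x]\<close>, it solves \<open>u + \<eta> K u = e\<close>, where \<open>K\<close> is the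
  Green operator with respect to \<open>dM\<close> and \<open>e(t) = 1 - t/x\<close>, and evaluating the string equation at \<open>x\<close> gives
  \<open>V(x) = 1/x + \<eta> \<langle>e, (1 + \<eta> K)\<inverse> e\<rangle>\<close> in \<open>L\<^sup>2(dM)\<close> (\<open>u_eq\<close>, \<open>weyl_eq\<close>).

  The operator \<open>K\<close> is symmetric, positive and bounded. Hence the numbers \<open>\<langle>K\<^sup>i (1 - K)\<^sup>j e, e\<rangle>\<close>, for \<open>K\<close> scaled to
  norm at most one, are nonnegative, and the Hausdorff moment problem yields the spectral measure of \<open>e\<close>
  (\<open>green_spectral_measure\<close>). The moments of that measure are \<open>p\<^sub>n(x) = \<langle>K\<^sup>n e, e\<rangle>\<close>, and \<open>V(x)\<close> is a Stieltjes
  function of \<open>- 1/\<eta>\<close>. Mapping the half line \<open>\<lambda> \<ge> 0\<close> to the unit interval by \<open>t = 1/(1 + \<lambda>)\<close> puts the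
  spectral measures of all pieces on one compact interval. Since \<open>V(x)\<close> decreases in \<open>x\<close> (\<open>ratio_antitone\<close>), \<open>x\<close> may tend to
  \<open>L\<close>: the limit is again a Stieltjes function \<open>V\<close> (\<open>limit_measure\<close>), and the characteristic
  function of the string is \<open>1 / V(1/z)\<close>, which is exactly the transform used to define \<open>W_minus\<close>
  (\<open>characteristic_function_eq\<close>). Therefore \<open>M \<in> M_minus\<close> means that the spectral measure of \<open>V\<close> has finite
  moments of all orders.

  This is equivalent to boundedness in \<open>x\<close> of each \<open>p\<^sub>n(x)\<close> (\<open>M_minus_iff_moments_bounded\<close>). If the \<open>p\<^sub>n\<close> are bounded,
  lower semicontinuity passes the bounds to the limit. The converse rests on
  monotonicity: kernel, \<open>e\<close> and \<open>u\<close> all increase with \<open>x\<close>, so the resolvent moments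
  \<open>\<langle>K\<^sup>n e, (1 + \<eta> K)\<inverse> e\<rangle>\<close> stay below their limits, which are determined one after the other by comparing the
  expansions in powers of \<open>\<eta>\<close> of the two sides (\<open>moments_bounded_by_limit\<close>).

  It remains to see what bounded \<open>p\<^sub>n\<close> say about \<open>M\<close>. Restricting all integrals in \<open>p\<^sub>n(y)\<close> to \<open>]a,b]\<close> gives the lower
  bound \<open>(1 - b/y)\<^bsup>n+2\<^esup> a\<^sup>n (M(b) - M(a))\<^bsup>n+1\<^esup>\<close>, from which the decay conditions follow by choosing
  \<open>n\<close> with \<open>1/n < \<epsilon>\<close>. For the upper bounds let \<open>g(t) = L - t\<close> if \<open>L < \<infinity>\<close>, and \<open>g(t) = t\<close> otherwise. The Green function is at
  most \<open>min (g t) (g s) \<le> g(t)\<^sup>\<beta> g(s)\<^bsup>1-\<beta>\<^esup>\<close>; distributing the exponents evenly over the \<open>n + 1\<close> integrations in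
  \<open>p\<^sub>n\<close> leaves a constant times \<open>(\<integral> g\<^bsup>1\<plusminus>\<delta>\<^esup> dM)\<^bsup>n+1\<^esup>\<close> with \<open>\<delta> = 1/(n + 1)\<close>, and the decay conditions make this integral
  converge on dyadic intervals. A finite length leads to condition (ii), an infinite length to
  condition (i); for length \<open>0\<close> both sides of the equivalence are true.
\<close>

section \<open>Compactness and the Hausdorff moment problem on the unit interval\<close>

text \<open>
  Helly's selection theorem: measures carried by a compact set are automatically tight. Weak
  convergence only tests functions that are bounded and continuous on the whole line, so a function continuous on
  \<open>[0,1]\<close> is first extended by clamping its argument.
\<close>
lemma unit_interval_dist_convergent_subseq:
  fixes P :: "nat \<Rightarrow> real measure"
  assumes P: "\<And>n. real_distribution (P n)" and supp: "\<And>n. AE t in P n. t \<in> {0..1}"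
  obtains r Q where "strict_mono (r::nat\<Rightarrow>nat)" "real_distribution Q" "AE t in Q. t \<in> {0..1}"
    "\<And>h. h \<in> borel_measurable borel \<Longrightarrow> continuous_on {0..1} h \<Longrightarrow>
      (\<lambda>n. integral\<^sup>L (P (r n)) h) \<longlonglongrightarrow> integral\<^sup>L Q (h::real\<Rightarrow>real)"
proof -
  have tight: "tight P"
    unfolding tight_def
  proof (intro conjI allI impI)
    fix \<epsilon> :: real assume "\<epsilon> > 0"
    have "measure (P n) {-1<..1} = 1" for n
    proof -
      interpret real_distribution "P n" by (rule P)
      have "prob {-1<..1} = 1"
        by (rule prob_eq_1[THEN iffD2]) (use supp[of n] in \<open>auto elim!: eventually_mono\<close>)
      then show ?thesis by simp
    qed
    then show "\<exists>a b. a < b \<and> (\<forall>n. 1 - \<epsilon> < measure (P n) {a<..b})"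
      using \<open>\<epsilon> > 0\<close> by (intro exI[of _ "-1"] exI[of _ 1]) auto
  qed (rule P)
  from tight_imp_convergent_subsubsequence[OF tight strict_mono_id]
  obtain r Q where r: "strict_mono (r::nat\<Rightarrow>nat)" "real_distribution Q" "weak_conv_m (P \<circ> id \<circ> r) Q"
    by auto
  interpret Q: real_distribution Q by (rule r)
  define cl where "cl t = max 0 (min 1 t)" for t :: real
  have cl_range: "cl t \<in> {0..1}" for t by (auto simp: cl_def)
  have conv: "(\<lambda>n. integral\<^sup>L (P (r n)) h) \<longlonglongrightarrow> integral\<^sup>L Q h"
    if cont: "continuous_on UNIV h" and bdd: "\<And>t. \<bar>h t\<bar> \<le> B" for h :: "real \<Rightarrow> real" and B
    using weak_conv_imp_integral_bdd_continuous_conv[of "P \<circ> id \<circ> r" Q h B] P r cont bdd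
    by (auto simp: comp_def continuous_on_eq_continuous_at)
  have cont_cl: "continuous_on UNIV (\<lambda>t. h (cl t))" if "continuous_on {0..1} h" for h :: "real \<Rightarrow> real"
    by (intro continuous_on_compose2[OF that]) (auto simp: cl_def intro!: continuous_intros)
  have conv_cl: "(\<lambda>n. integral\<^sup>L (P (r n)) (\<lambda>t. h (cl t))) \<longlonglongrightarrow> integral\<^sup>L Q (\<lambda>t. h (cl t))"
    if h: "continuous_on {0..1} h" for h :: "real \<Rightarrow> real"
  proof -
    have "bounded (h ` {0..1})" by (intro compact_imp_bounded compact_continuous_image h) auto
    then obtain B where B: "\<And>t. t \<in> {0..1} \<Longrightarrow> \<bar>h t\<bar> \<le> B"
      unfolding bounded_iff by (metis imageI real_norm_def)
    show ?thesis by (rule conv[OF cont_cl[OF h], of B]) (use B cl_range in auto)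
  qed
  have suppQ: "AE t in Q. t \<in> {0..1}"
  proof -
    define d where "d t = min 1 \<bar>t - cl t\<bar>" for t
    have d_cont: "continuous_on UNIV d" unfolding d_def cl_def by (intro continuous_intros)
    have [measurable]: "d \<in> borel_measurable borel"
      using d_cont by (rule borel_measurable_continuous_onI)
    have d_bdd: "\<bar>d t\<bar> \<le> 1" for t by (auto simp: d_def)
    have "integral\<^sup>L (P n) d = 0" for n
    proof -
      interpret real_distribution "P n" by (rule P)
      have "integral\<^sup>L (P n) d = integral\<^sup>L (P n) (\<lambda>_. 0)"
        by (intro integral_cong_AE eventually_mono[OF supp[of n]]) (auto simp: d_def cl_def)
      then show ?thesis by simp
    qed
    with conv[OF d_cont d_bdd] have "integral\<^sup>L Q d = 0"
      by (simp add: LIMSEQ_const_iff)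
    moreover have "integrable Q d"
      by (rule Q.integrable_const_bound[of _ 1]) (use d_bdd in auto)
    ultimately have "AE t in Q. d t = 0"
      by (subst (asm) integral_nonneg_eq_0_iff_AE) (auto simp: d_def)
    then show ?thesis
    proof eventually_elim
      case (elim t)
      then have "t = cl t" unfolding d_def by linarith
      then show ?case using cl_range[of t] by simp
    qed
  qed
  have int_cl: "integral\<^sup>L N (\<lambda>t. h (cl t)) = integral\<^sup>L N h"
    if "continuous_on {0..1} h" "h \<in> borel_measurable borel" "real_distribution N" "AE t in N. t \<in> {0..1}"
    for h :: "real \<Rightarrow> real" and N
  proof -
    interpret real_distribution N by fact
    have "(\<lambda>t. h (cl t)) \<in> borel_measurable borel"
      using cont_cl[OF that(1)] by (rule borel_measurable_continuous_onI)
    then show ?thesis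
      using that(2) by (intro integral_cong_AE eventually_mono[OF that(4)]) (auto simp: cl_def)
  qed
  show thesis
  proof (rule that[OF r(1,2) suppQ])
    fix h :: "real \<Rightarrow> real"
    assume h: "h \<in> borel_measurable borel" "continuous_on {0..1} h"
    show "(\<lambda>n. integral\<^sup>L (P (r n)) h) \<longlonglongrightarrow> integral\<^sup>L Q h"
      using conv_cl[OF h(2)] int_cl[OF h(2,1) P supp] int_cl[OF h(2,1) r(2) suppQ] by simp
  qed
qed

text \<open>
  If \<open>b n = \<integral> t\<^sup>n dP\<close> then \<open>moment_diff b i j = \<integral> t\<^sup>i (1 - t)\<^sup>j dP\<close>; the recursion expresses the factor
  \<open>1 - t\<close> through the sequence \<open>b\<close> alone.
\<close>
fun moment_diff :: "(nat \<Rightarrow> real) \<Rightarrow> nat \<Rightarrow> nat \<Rightarrow> real" where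
  "moment_diff b i 0 = b i"
| "moment_diff b i (Suc j) = moment_diff b i j - moment_diff b (Suc i) j"

lemma binomial_sum_Suc:
  "(\<Sum>k\<le>Suc N. real (Suc N choose k) * g k) = (\<Sum>k\<le>N. real (N choose k) * (g k + g (Suc k)))"
proof -
  have 1: "(\<Sum>k\<le>Suc N. real (Suc N choose k) * g k)
      = g 0 + (\<Sum>k\<le>N. real (N choose k) * g (Suc k)) + (\<Sum>k\<le>N. real (N choose Suc k) * g (Suc k))"
    by (subst sum.atMost_Suc_shift) (simp add: algebra_simps sum.distrib)
  have 2: "g 0 + (\<Sum>k\<le>N. real (N choose Suc k) * g (Suc k)) = (\<Sum>k\<le>Suc N. real (N choose k) * g k)"
    by (subst sum.atMost_Suc_shift) simp
  have 3: "(\<Sum>k\<le>Suc N. real (N choose k) * g k) = (\<Sum>k\<le>N. real (N choose k) * g k)" by simp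
  have 4: "(\<Sum>k\<le>N. real (N choose k) * (g k + g (Suc k)))
      = (\<Sum>k\<le>N. real (N choose k) * g k) + (\<Sum>k\<le>N. real (N choose k) * g (Suc k))"
    by (simp only: distrib_left sum.distrib)
  show ?thesis using 1 2 3 4 by linarith
qed

text \<open>
  The discrete form of \<open>(t + (1 - t))\<^sup>N = 1\<close>, integrated against \<open>t\<^sup>i (1 - t)\<^sup>j\<close>.
\<close>
lemma moment_diff_binomial_sum:
  "(\<Sum>k\<le>N. real (N choose k) * moment_diff b (i + k) (j + (N - k))) = moment_diff b i j"
proof (induction N arbitrary: i j)
  case (Suc N)
  have "(\<Sum>k\<le>Suc N. real (Suc N choose k) * moment_diff b (i + k) (j + (Suc N - k)))
     = (\<Sum>k\<le>N. real (N choose k) * (moment_diff b (i + k) (j + (Suc N - k)) + moment_diff b (i + Suc k) (j + (Suc N - Suc k))))"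
    by (rule binomial_sum_Suc)
  also have "\<dots> = (\<Sum>k\<le>N. real (N choose k) * moment_diff b (i + k) (j + (N - k)))"
    by (intro sum.cong) (auto simp: Suc_diff_le)
  finally show ?case using Suc by simp
qed simp

text \<open>
  The weights \<open>(N choose k) * moment_diff b k (N - k)\<close> at the points \<open>k/N\<close> are the candidates for the measure with
  moments \<open>b\<close>: integrating a Bernstein polynomial against that measure would give precisely them. The index
  \<open>i\<close> makes the induction work, because each factor \<open>k/N\<close> that is absorbed raises it by one, up to an
  error that vanishes with \<open>N\<close>.
\<close>
lemma bernstein_moments_tendsto:
  assumes pos: "\<And>i j. moment_diff b i j \<ge> 0"
  shows "(\<lambda>N. \<Sum>k\<le>N. (real k / real N) ^ n * (real (N choose k) * moment_diff b (i + k) (N - k))) \<longlonglongrightarrow> b (i + n)"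
proof (induction n arbitrary: i)
  case 0
  show ?case using moment_diff_binomial_sum[of _ b i 0] by simp
next
  case (Suc n)
  define S where "S n i N = (\<Sum>k\<le>N. (real k / real N) ^ n * (real (N choose k) * moment_diff b (i + k) (N - k)))"
    for n i N
  define w where "w N k = real (N choose k) * moment_diff b (Suc i + k) (N - k)" for N k
  have w_nonneg: "w N k \<ge> 0" for N k using pos by (simp add: w_def)
  have w_sum: "(\<Sum>k\<le>N. w N k) = b (Suc i)" for N using moment_diff_binomial_sum[of N b "Suc i" 0] by (simp add: w_def)
  \<comment> \<open>Absorbing one factor \<open>k/N\<close> into the binomial coefficient shifts \<open>k\<close> by one.\<close>
  have shift: "S (Suc n) i (Suc N) = (\<Sum>k\<le>N. (real (Suc k) / real (Suc N)) ^ n * w N k)" for N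
  proof -
    have "S (Suc n) i (Suc N) = (\<Sum>k\<le>N. (real (Suc k) / real (Suc N)) ^ Suc n *
        (real (Suc N choose Suc k) * moment_diff b (i + Suc k) (Suc N - Suc k)))"
      unfolding S_def by (subst sum.atMost_Suc_shift) simp
    also have "\<dots> = (\<Sum>k\<le>N. (real (Suc k) / real (Suc N)) ^ n * w N k)"
    proof (intro sum.cong refl)
      fix k
      let ?q = "real (Suc k) / real (Suc N)" and ?c = "real (Suc N choose Suc k)" and ?m = "moment_diff b (i + Suc k) (Suc N - Suc k)"
      have "real (Suc k) * ?c = real (Suc N) * real (N choose k)"
        using Suc_times_binomial[of k N] by (metis of_nat_mult)
      then have q: "?q * ?c = real (N choose k)"
        by (simp add: field_simps del: binomial_Suc_Suc)
      have "?q ^ Suc n * (?c * ?m) = ?q ^ n * ((?q * ?c) * ?m)"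
        by (simp only: power_Suc mult_ac)
      then show "?q ^ Suc n * (?c * ?m) = ?q ^ n * w N k"
        unfolding q by (simp add: w_def)
    qed
    finally show ?thesis .
  qed
  have pow_diff: "\<bar>x ^ n - y ^ n\<bar> \<le> real n * \<bar>x - y\<bar>" if "x \<in> {0..1}" "y \<in> {0..1}" for x y :: real
    using norm_power_diff[of x y n] that by simp
  have close: "\<bar>S (Suc n) i (Suc N) - S n (Suc i) N\<bar> \<le> real n * b (Suc i) / real (Suc N)" for N
  proof (cases "N = 0")
    case False
    have "\<bar>S (Suc n) i (Suc N) - S n (Suc i) N\<bar>
        = \<bar>\<Sum>k\<le>N. ((real (Suc k) / real (Suc N)) ^ n - (real k / real N) ^ n) * w N k\<bar>"
      unfolding shift by (simp add: S_def w_def sum_subtractf left_diff_distrib)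
    also have "\<dots> \<le> (\<Sum>k\<le>N. real n / real (Suc N) * w N k)"
    proof (rule order_trans[OF sum_abs sum_mono])
      fix k assume k: "k \<in> {..N}"
      have "\<bar>real (Suc k) / real (Suc N) - real k / real N\<bar> \<le> 1 / real (Suc N)"
      proof -
        have "real (Suc k) / real (Suc N) - real k / real N = (real N - real k) / (real N * real (Suc N))"
          using False by (simp add: field_simps)
        moreover have "0 \<le> (real N - real k) / (real N * real (Suc N))" using k by simp
        moreover have "(real N - real k) / (real N * real (Suc N)) \<le> real N / (real N * real (Suc N))"
          by (intro divide_right_mono) auto
        ultimately show ?thesis using False by simp
      qed
      then have "\<bar>(real (Suc k) / real (Suc N)) ^ n - (real k / real N) ^ n\<bar> \<le> real n * (1 / real (Suc N))"
        using k False by (intro order_trans[OF pow_diff] mult_left_mono) auto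
      then show "\<bar>((real (Suc k) / real (Suc N)) ^ n - (real k / real N) ^ n) * w N k\<bar> \<le> real n / real (Suc N) * w N k"
        using w_nonneg[of N k] unfolding abs_mult by (intro mult_mono) auto
    qed
    also have "\<dots> = real n * b (Suc i) / real (Suc N)"
      by (simp only: sum_distrib_left[symmetric] w_sum) simp
    finally show ?thesis .
  next
    case True
    have b: "b (Suc i) \<ge> 0" using pos[of "Suc i" 0] by simp
    then have "b (Suc i) \<le> real n * b (Suc i)" if "n > 0"
      using that by (simp add: mult_le_cancel_right1)
    then show ?thesis using True using b unfolding shift by (cases n) (auto simp: S_def w_def)
  qed
  have "(\<lambda>N. S (Suc n) i (Suc N) - S n (Suc i) N) \<longlonglongrightarrow> 0"
  proof (rule Lim_null_comparison)
    show "(\<lambda>N. real n * b (Suc i) / real (Suc N)) \<longlonglongrightarrow> 0"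
      using LIMSEQ_Suc[OF lim_const_over_n] .
  qed (use close in \<open>auto simp: real_norm_def\<close>)
  from tendsto_add[OF this Suc.IH[of "Suc i", folded S_def]]
  have "(\<lambda>N. S (Suc n) i (Suc N)) \<longlonglongrightarrow> b (Suc i + n)"
    by simp
  then have "S (Suc n) i \<longlonglongrightarrow> b (Suc i + n)" by (subst filterlim_sequentially_Suc[symmetric])
  then have "(\<lambda>N. S (Suc n) i N) \<longlonglongrightarrow> b (i + Suc n)" by simp
  then show ?case unfolding S_def .
qed

text \<open>
  The measures with Bernstein weights have total mass \<open>b 0\<close> and live on \<open>[0,1]\<close>, so after normalization they have a
  limit point, whose moments are known from \<open>bernstein_moments_tendsto\<close>. The case \<open>b 0 = 0\<close>, in which all \<open>b n\<close> vanish,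
  needs an arbitrary probability measure.
\<close>
theorem hausdorff_moment:
  assumes pos: "\<And>i j. moment_diff b i j \<ge> 0"
  obtains P where "real_distribution P" "AE t in P. t \<in> {0..1}"
    "\<And>i j. moment_diff b i j = b 0 * (\<integral>t. t ^ i * (1 - t) ^ j \<partial>P)"
proof -
  have b_pos: "b n \<ge> 0" for n using pos[of n 0] by simp
  have b_dec: "b (Suc n) \<le> b n" for n using pos[of n 1] by simp
  have b_le: "b n \<le> b 0" for n by (induction n) (auto intro: order_trans[OF b_dec])
  have "\<exists>P. real_distribution P \<and> (AE t in P. t \<in> {0..1}) \<and> (\<forall>n. b n = b 0 * (\<integral>t. t ^ n \<partial>P))"
  proof (cases "b 0 = 0")
    case True
    then have "b n = 0" for n using b_pos[of n] b_le[of n] by simp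
    moreover have "real_distribution (return borel (0::real))"
      by (intro real_distribution.intro prob_space_return real_distribution_axioms.intro) auto
    ultimately show ?thesis using True by (intro exI[of _ "return borel 0"]) (auto simp: AE_return)
  next
    case False
    then have b0: "b 0 > 0" using b_pos[of 0] by simp
    define v where "v N k = real (N choose k) * moment_diff b k (N - k) / b 0" for N k
    have v_nonneg: "v N k \<ge> 0" for N k using pos b0 by (simp add: v_def)
    have v_sum: "(\<Sum>k\<le>N. v N k) = 1" for N
      using moment_diff_binomial_sum[of N b 0 0] b0 unfolding v_def by (simp flip: sum_divide_distrib)
    define C where "C N = density (count_space {..N}) (\<lambda>k. ennreal (v N k))" for N
    define Q where "Q N = distr (C N) borel (\<lambda>k. real k / real N)" for N
    have prob_C: "prob_space (C N)" for N
    proof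
      show "emeasure (C N) (space (C N)) = 1"
        using v_nonneg v_sum[of N]
        by (simp add: C_def emeasure_density nn_integral_count_space_finite sum_ennreal)
    qed
    have Q_int: "integral\<^sup>L (Q N) h = (\<Sum>k\<le>N. h (real k / real N) * v N k)" if "h \<in> borel_measurable borel" for N and h :: "real \<Rightarrow> real"
    proof -
      have "integral\<^sup>L (Q N) h = (\<integral>k. h (real k / real N) \<partial>C N)"
        unfolding Q_def by (rule integral_distr) (use that in \<open>auto simp: C_def\<close>)
      also have "\<dots> = (\<integral>k. v N k * h (real k / real N) \<partial>count_space {..N})"
        unfolding C_def using v_nonneg by (subst integral_density) auto
      finally show ?thesis by (simp add: lebesgue_integral_count_space_finite mult.commute)
    qed
    have Q_dist: "real_distribution (Q N)" for N
    proof -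
      have "prob_space (Q N)" unfolding Q_def
        by (rule prob_space.prob_space_distr[OF prob_C]) (simp add: C_def)
      then show ?thesis by (auto simp: real_distribution_def real_distribution_axioms_def Q_def)
    qed
    have Q_supp: "AE t in Q N. t \<in> {0..1}" for N
      unfolding Q_def by (subst AE_distr_iff) (auto simp: C_def AE_density AE_count_space divide_le_eq_1)
    from unit_interval_dist_convergent_subseq[of Q, OF Q_dist Q_supp]
    obtain r P where r: "strict_mono (r::nat\<Rightarrow>nat)" "real_distribution P" "AE t in P. t \<in> {0..1}"
      and conv: "\<And>h. h \<in> borel_measurable borel \<Longrightarrow> continuous_on {0..1} h \<Longrightarrow>
        (\<lambda>n. integral\<^sup>L (Q (r n)) h) \<longlonglongrightarrow> integral\<^sup>L P (h::real\<Rightarrow>real)"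
      by metis
    have "b n = b 0 * (\<integral>t. t ^ n \<partial>P)" for n
    proof -
      have *: "b 0 * integral\<^sup>L (Q N) (\<lambda>t. t ^ n) = (\<Sum>k\<le>N. (real k / real N) ^ n * (real (N choose k) * moment_diff b (0 + k) (N - k)))" for N
        using b0 by (subst Q_int) (auto simp: v_def sum_distrib_left intro!: sum.cong)
      have "(\<lambda>N. b 0 * integral\<^sup>L (Q N) (\<lambda>t. t ^ n)) \<longlonglongrightarrow> b n"
        unfolding * using bernstein_moments_tendsto[OF pos, where n=n and i=0] by simp
      then have "(\<lambda>N. b 0 * integral\<^sup>L (Q (r N)) (\<lambda>t. t ^ n)) \<longlonglongrightarrow> b n"
        using LIMSEQ_subseq_LIMSEQ[OF _ r(1)] by (auto simp: comp_def)
      moreover have "(\<lambda>N. b 0 * integral\<^sup>L (Q (r N)) (\<lambda>t. t ^ n)) \<longlonglongrightarrow> b 0 * (\<integral>t. t ^ n \<partial>P)"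
        by (intro tendsto_mult_left conv) (auto intro!: continuous_intros)
      ultimately show ?thesis by (rule LIMSEQ_unique)
    qed
    with r show ?thesis by blast
  qed
  then obtain P where P: "real_distribution P" and supp: "AE t in P. t \<in> {0..1}"
    and mom: "\<And>n. b n = b 0 * (\<integral>t. t ^ n \<partial>P)" by blast
  interpret real_distribution P by (rule P)
  have integ: "integrable P (\<lambda>t. t ^ i * (1 - t) ^ j)" for i j
    by (rule integrable_const_bound[of _ 1], rule eventually_mono[OF supp])
       (auto simp: abs_mult power_abs mult_le_one power_le_one)
  have "moment_diff b i j = b 0 * (\<integral>t. t ^ i * (1 - t) ^ j \<partial>P)" for i j
  proof (induction j arbitrary: i)
    case 0
    show ?case using mom[of i] by simp
  next
    case (Suc j)
    have eq: "t ^ i * (1 - t) ^ Suc j = t ^ i * (1 - t) ^ j - t ^ Suc i * (1 - t) ^ j" for t :: real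
      by (simp add: algebra_simps)
    show ?case unfolding eq using Suc[of i] Suc[of "Suc i"] integ[of i j] integ[of "Suc i" j]
      by (subst Bochner_Integration.integral_diff) (auto simp: algebra_simps)
  qed
  with P supp that show thesis by blast
qed

section \<open>The Green operator of a finite mass distribution\<close>

text \<open>
  The kernels below are bounded only on the intervals that carry the measures and grow outside, hence the
  integrand is cut off before Fubini's theorem applies.
\<close>
lemma fubini_bounded:
  fixes h :: "real \<Rightarrow> real \<Rightarrow> real"
  assumes "finite_measure M1" "finite_measure M2"
    and sets[measurable_cong, simp]: "sets M1 = sets borel" "sets M2 = sets borel"
    and [measurable]: "A1 \<in> sets borel" "A2 \<in> sets borel"
    and AE1: "AE x in M1. x \<in> A1" and AE2: "AE y in M2. y \<in> A2"
    and h[measurable]: "(\<lambda>(x, y). h x y) \<in> borel_measurable (borel \<Otimes>\<^sub>M borel)"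
    and bdd: "\<And>x y. x \<in> A1 \<Longrightarrow> y \<in> A2 \<Longrightarrow> \<bar>h x y\<bar> \<le> C"
  shows "(\<integral>x. (\<integral>y. h x y \<partial>M2) \<partial>M1) = (\<integral>y. (\<integral>x. h x y \<partial>M1) \<partial>M2)"
proof -
  interpret M1: finite_measure M1 by fact
  interpret M2: finite_measure M2 by fact
  interpret pair_sigma_finite M2 M1 ..
  interpret P: finite_measure "M2 \<Otimes>\<^sub>M M1" by (rule finite_measure_pair_measure) fact+
  have [measurable]: "(\<lambda>y. h x y) \<in> borel_measurable borel" "(\<lambda>x. h x y) \<in> borel_measurable borel" for x y
    by measurable
  define k where "k x y = indicator A1 x * indicator A2 y * h x y" for x y
  have k[measurable]: "(\<lambda>(x, y). k x y) \<in> borel_measurable (borel \<Otimes>\<^sub>M borel)"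
    unfolding k_def by measurable
  have k'[measurable]: "(\<lambda>(y, x). k x y) \<in> borel_measurable (borel \<Otimes>\<^sub>M borel)"
    using measurable_compose[OF measurable_pair_swap' k] by (simp add: case_prod_unfold)
  have m1: "(\<lambda>x. \<integral>y. h x y \<partial>M2) \<in> borel_measurable M1" "(\<lambda>x. \<integral>y. k x y \<partial>M2) \<in> borel_measurable M1"
    by (auto intro!: M2.borel_measurable_lebesgue_integral simp: measurable_cong_sets[OF sets_pair_measure_cong[OF sets(1) sets(2)] refl] h k)
  have h': "(\<lambda>(y, x). h x y) \<in> borel_measurable (borel \<Otimes>\<^sub>M borel)"
    using measurable_compose[OF measurable_pair_swap' h] by (simp add: case_prod_unfold)
  have m2: "(\<lambda>y. \<integral>x. h x y \<partial>M1) \<in> borel_measurable M2" "(\<lambda>y. \<integral>x. k x y \<partial>M1) \<in> borel_measurable M2"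
    by (auto intro!: M1.borel_measurable_lebesgue_integral simp: measurable_cong_sets[OF sets_pair_measure_cong[OF sets(2) sets(1)] refl] h' k')
  have "(\<integral>x. (\<integral>y. h x y \<partial>M2) \<partial>M1) = (\<integral>x. (\<integral>y. k x y \<partial>M2) \<partial>M1)"
    by (intro integral_cong_AE m1 eventually_mono[OF AE1] integral_cong_AE eventually_mono[OF AE2])
       (auto simp: k_def)
  also have "\<dots> = (\<integral>y. (\<integral>x. k x y \<partial>M1) \<partial>M2)"
  proof (rule Fubini_integral)
    have "\<bar>k x y\<bar> \<le> max 0 C" for x y
      using bdd[of x y] by (cases "x \<in> A1"; cases "y \<in> A2") (auto simp: k_def)
    then show "integrable (M2 \<Otimes>\<^sub>M M1) (\<lambda>(y, x). k x y)"
      by (intro P.integrable_const_bound[of _ "max 0 C"])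
         (auto simp: measurable_cong_sets[OF sets_pair_measure_cong[OF sets(2) sets(1)] refl] k')
  qed
  also have "\<dots> = (\<integral>y. (\<integral>x. h x y \<partial>M1) \<partial>M2)"
    by (intro integral_cong_AE m2 eventually_mono[OF AE2] integral_cong_AE eventually_mono[OF AE1])
       (auto simp: k_def)
  finally show ?thesis .
qed

text \<open>
  The Green function of \<open>- d\<^sup>2/dt\<^sup>2\<close> on \<open>[0,l]\<close> with Dirichlet conditions at both ends.
\<close>
definition green :: "real \<Rightarrow> real \<Rightarrow> real \<Rightarrow> real" where
  "green l t s = min t s * (1 - max t s / l)"

lemma green_commute: "green l t s = green l s t"
  by (simp add: green_def min.commute max.commute)

lemma green_measurable [measurable]: "(\<lambda>(t, s). green l t s) \<in> borel_measurable (borel \<Otimes>\<^sub>M borel)"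
  unfolding green_def by measurable

lemma green_measurable1 [measurable]: "green l t \<in> borel_measurable borel"
  unfolding green_def by measurable

lemma green_nonneg: "0 < l \<Longrightarrow> t \<in> {0..l} \<Longrightarrow> s \<in> {0..l} \<Longrightarrow> 0 \<le> green l t s"
  by (auto simp: green_def)

lemma green_le: "0 < l \<Longrightarrow> t \<in> {0..l} \<Longrightarrow> s \<in> {0..l} \<Longrightarrow> green l t s \<le> min t s"
  unfolding green_def using mult_left_le[of "1 - max t s / l" "min t s"] by auto

text \<open>
  The truncated string: a finite mass distribution on \<open>[0,l]\<close>, atoms at both ends included.
\<close>
locale interval_mass = finite_measure \<mu> for \<mu> :: "real measure" +
  fixes l :: real
  assumes sets_\<mu> [simp, measurable_cong]: "sets \<mu> = sets borel"
    and l_pos: "0 < l"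
    and supp: "AE t in \<mu>. t \<in> {0..l}"
begin

text \<open>
  Boundedness is required on \<open>[0,l]\<close> only, so that polynomials and the unbounded kernels qualify; since \<open>\<mu>\<close> does
  not charge the complement, this is enough for integrability.
\<close>
definition bdd_fun :: "(real \<Rightarrow> real) \<Rightarrow> bool" where
  "bdd_fun f \<longleftrightarrow> f \<in> borel_measurable borel \<and> (\<exists>C. \<forall>t\<in>{0..l}. \<bar>f t\<bar> \<le> C)"

lemma space_\<mu> [simp]: "space \<mu> = UNIV"
  using sets_eq_imp_space_eq[OF sets_\<mu>] by simp

lemma bdd_funI: "f \<in> borel_measurable borel \<Longrightarrow> (\<And>t. t \<in> {0..l} \<Longrightarrow> \<bar>f t\<bar> \<le> C) \<Longrightarrow> bdd_fun f"
  unfolding bdd_fun_def by blast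

lemma bdd_fun_measurable [measurable_dest]: "bdd_fun f \<Longrightarrow> f \<in> borel_measurable borel"
  unfolding bdd_fun_def by blast

lemma bdd_funE: assumes "bdd_fun f" obtains C where "C \<ge> 0" "\<And>t. t \<in> {0..l} \<Longrightarrow> \<bar>f t\<bar> \<le> C"
proof -
  from assms obtain C where "\<forall>t\<in>{0..l}. \<bar>f t\<bar> \<le> C" by (auto simp: bdd_fun_def)
  then show thesis using that[of "max 0 C"] by force
qed

lemma bdd_fun_const [intro!]: "bdd_fun (\<lambda>_. c)"
  by (rule bdd_funI[of _ "\<bar>c\<bar>"]) auto

lemma bdd_fun_ident [intro!]: "bdd_fun (\<lambda>t. t)"
  by (rule bdd_funI[of _ l]) auto

lemma bdd_fun_mult [intro]: assumes "bdd_fun f" "bdd_fun g" shows "bdd_fun (\<lambda>t. f t * g t)"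
proof -
  obtain A where A: "A \<ge> 0" "\<And>t. t \<in> {0..l} \<Longrightarrow> \<bar>f t\<bar> \<le> A" using assms(1) by (rule bdd_funE) blast
  obtain B where B: "B \<ge> 0" "\<And>t. t \<in> {0..l} \<Longrightarrow> \<bar>g t\<bar> \<le> B" using assms(2) by (rule bdd_funE) blast
  have [measurable]: "f \<in> borel_measurable borel" "g \<in> borel_measurable borel" using assms by (auto simp: bdd_fun_def)
  show ?thesis by (rule bdd_funI[of _ "A * B"]) (use A B in \<open>auto simp: abs_mult intro!: mult_mono\<close>)
qed

lemma bdd_fun_add [intro]: assumes "bdd_fun f" "bdd_fun g" shows "bdd_fun (\<lambda>t. f t + g t)"
proof -
  obtain A where A: "A \<ge> 0" "\<And>t. t \<in> {0..l} \<Longrightarrow> \<bar>f t\<bar> \<le> A" using assms(1) by (rule bdd_funE) blast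
  obtain B where B: "B \<ge> 0" "\<And>t. t \<in> {0..l} \<Longrightarrow> \<bar>g t\<bar> \<le> B" using assms(2) by (rule bdd_funE) blast
  have [measurable]: "f \<in> borel_measurable borel" "g \<in> borel_measurable borel" using assms by (auto simp: bdd_fun_def)
  show ?thesis by (rule bdd_funI[of _ "A + B"]) (use A B in \<open>auto intro!: order_trans[OF abs_triangle_ineq] add_mono\<close>)
qed

lemma bdd_fun_diff [intro]: assumes "bdd_fun f" "bdd_fun g" shows "bdd_fun (\<lambda>t. f t - g t)"
  using bdd_fun_add[OF assms(1) bdd_fun_mult[OF bdd_fun_const[of "-1"] assms(2)]] by simp

lemma bdd_fun_divide [intro]: "bdd_fun f \<Longrightarrow> bdd_fun (\<lambda>t. f t / c)"
  using bdd_fun_mult[of f "\<lambda>_. 1 / c"] by auto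

lemma bdd_fun_green [intro!]: "bdd_fun (green l t)"
proof -
  have "\<bar>green l t s\<bar> \<le> (\<bar>t\<bar> + l) * (1 + (\<bar>t\<bar> + l) / l)" if "s \<in> {0..l}" for s
  proof -
    have "\<bar>max t s / l\<bar> \<le> (\<bar>t\<bar> + l) / l"
      unfolding abs_divide using that l_pos by (intro frac_le) auto
    then have "\<bar>1 - max t s / l\<bar> \<le> 1 + (\<bar>t\<bar> + l) / l" by linarith
    then show ?thesis unfolding green_def abs_mult using that l_pos by (intro mult_mono) auto
  qed
  then show ?thesis by (intro bdd_funI) auto
qed

lemma bdd_fun_integrable: assumes "bdd_fun f" shows "integrable \<mu> f"
proof -
  obtain C where C: "\<And>t. t \<in> {0..l} \<Longrightarrow> \<bar>f t\<bar> \<le> C" using bdd_funE[OF assms] by metis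
  show ?thesis
    by (rule integrable_const_bound[of _ C], rule eventually_mono[OF supp])
       (use C assms in \<open>auto simp: bdd_fun_def\<close>)
qed

lemma integral_cong_supp:
  assumes "f \<in> borel_measurable borel" "g \<in> borel_measurable borel" "\<And>t. t \<in> {0..l} \<Longrightarrow> f t = g t"
  shows "integral\<^sup>L \<mu> f = integral\<^sup>L \<mu> (g :: real \<Rightarrow> real)"
  by (intro integral_cong_AE eventually_mono[OF supp]) (use assms in auto)

lemma integral_mono_supp:
  assumes "bdd_fun f" "bdd_fun g" "\<And>t. t \<in> {0..l} \<Longrightarrow> f t \<le> g t"
  shows "integral\<^sup>L \<mu> f \<le> integral\<^sup>L \<mu> g"
  by (intro integral_mono_AE bdd_fun_integrable eventually_mono[OF supp] assms)

lemma integral_nonneg_supp: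
  assumes "\<And>t. t \<in> {0..l} \<Longrightarrow> 0 \<le> f t"
  shows "0 \<le> integral\<^sup>L \<mu> (f :: real \<Rightarrow> real)"
  by (intro integral_nonneg_AE eventually_mono[OF supp] assms)

lemma fubini:
  fixes h :: "real \<Rightarrow> real \<Rightarrow> real"
  assumes "(\<lambda>(t, s). h t s) \<in> borel_measurable (borel \<Otimes>\<^sub>M borel)"
    and "\<And>t s. t \<in> {0..l} \<Longrightarrow> s \<in> {0..l} \<Longrightarrow> \<bar>h t s\<bar> \<le> C"
  shows "(\<integral>t. (\<integral>s. h t s \<partial>\<mu>) \<partial>\<mu>) = (\<integral>s. (\<integral>t. h t s \<partial>\<mu>) \<partial>\<mu>)"
  by (rule fubini_bounded[of \<mu> \<mu> "{0..l}" "{0..l}" h C]) (use assms supp in \<open>auto intro: finite_measure_axioms\<close>)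

definition ip :: "(real \<Rightarrow> real) \<Rightarrow> (real \<Rightarrow> real) \<Rightarrow> real" where
  "ip f g = (\<integral>t. f t * g t \<partial>\<mu>)"

definition K :: "(real \<Rightarrow> real) \<Rightarrow> real \<Rightarrow> real" where
  "K f t = (\<integral>s. green l t s * f s \<partial>\<mu>)"

definition mass :: real where "mass = measure \<mu> UNIV"

lemma mass_nonneg: "0 \<le> mass" by (simp add: mass_def)

lemma bdd_fun_K [intro]: assumes "bdd_fun f" shows "bdd_fun (K f)"
proof -
  have [measurable]: "f \<in> borel_measurable borel" using assms by (simp add: bdd_fun_def)
  obtain C where C: "C \<ge> 0" "\<And>t. t \<in> {0..l} \<Longrightarrow> \<bar>f t\<bar> \<le> C" using assms by (rule bdd_funE) blast
  show ?thesis
  proof (rule bdd_funI)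
    show "K f \<in> borel_measurable borel" unfolding K_def by measurable
    fix t assume t: "t \<in> {0..l}"
    have "norm (K f t) \<le> (\<integral>s. norm (green l t s * f s) \<partial>\<mu>)"
      unfolding K_def by (rule integral_norm_bound)
    also have "\<dots> \<le> (\<integral>s. l * C \<partial>\<mu>)"
    proof (rule integral_mono_supp)
      show "bdd_fun (\<lambda>s. norm (green l t s * f s))"
        using bdd_fun_mult[OF bdd_fun_green assms, of t] by (simp add: bdd_fun_def)
      fix s assume s: "s \<in> {0..l}"
      have "\<bar>green l t s\<bar> \<le> l" using green_nonneg[OF l_pos t s] green_le[OF l_pos t s] t s by auto
      then show "norm (green l t s * f s) \<le> l * C"
        using C(2)[OF s] l_pos by (auto simp: abs_mult intro!: mult_mono)
    qed auto
    finally show "\<bar>K f t\<bar> \<le> mass * (l * C)" by (simp add: mass_def)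
  qed
qed

lemma K_integrand: "bdd_fun f \<Longrightarrow> integrable \<mu> (\<lambda>s. green l t s * f s)"
  by (intro bdd_fun_integrable bdd_fun_mult bdd_fun_green)

lemma K_diff: "bdd_fun f \<Longrightarrow> bdd_fun g \<Longrightarrow> K (\<lambda>t. f t - g t) t = K f t - K g t"
  unfolding K_def using K_integrand[of f t] K_integrand[of g t] by (simp add: right_diff_distrib)

lemma K_divide: "K (\<lambda>t. f t / c) t = K f t / c"
  unfolding K_def by simp

lemma K_nonneg: "(\<And>s. s \<in> {0..l} \<Longrightarrow> 0 \<le> f s) \<Longrightarrow> t \<in> {0..l} \<Longrightarrow> 0 \<le> K f t"
  unfolding K_def using green_nonneg[OF l_pos] by (intro integral_nonneg_supp mult_nonneg_nonneg) auto

lemma ip_commute: "ip f g = ip g f" by (simp add: ip_def mult.commute)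

lemma ip_diff_left: "bdd_fun f \<Longrightarrow> bdd_fun g \<Longrightarrow> bdd_fun h \<Longrightarrow> ip (\<lambda>t. f t - g t) h = ip f h - ip g h"
  unfolding ip_def using bdd_fun_integrable[OF bdd_fun_mult, of f h] bdd_fun_integrable[OF bdd_fun_mult, of g h]
  by (simp add: left_diff_distrib)

lemma ip_diff_right: "bdd_fun f \<Longrightarrow> bdd_fun g \<Longrightarrow> bdd_fun h \<Longrightarrow> ip h (\<lambda>t. f t - g t) = ip h f - ip h g"
  using ip_diff_left[of f g h] by (simp add: ip_commute)

lemma ip_mono:
  "bdd_fun f \<Longrightarrow> bdd_fun g \<Longrightarrow> bdd_fun f' \<Longrightarrow> bdd_fun g' \<Longrightarrow> (\<And>t. t \<in> {0..l} \<Longrightarrow> f t * g t \<le> f' t * g' t)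
    \<Longrightarrow> ip f g \<le> ip f' g'"
  unfolding ip_def by (intro integral_mono_supp bdd_fun_mult)

lemma ip_self_nonneg: "0 \<le> ip f f"
  unfolding ip_def by (intro integral_nonneg_supp) simp

lemma ip_cong:
  assumes "bdd_fun f" "bdd_fun g" "bdd_fun f'" "bdd_fun g'" "\<And>t. t \<in> {0..l} \<Longrightarrow> f t * g t = f' t * g' t"
  shows "ip f g = ip f' g'"
  using ip_mono[of f g f' g'] ip_mono[of f' g' f g] assms by force

text \<open>
  A substitute for the Cauchy-Schwarz inequality: some bound in terms of the two square norms is all that is
  used, and this one follows from \<open>2 |a b| \<le> a\<^sup>2 + b\<^sup>2\<close> pointwise.
\<close>
lemma abs_ip_le: assumes "bdd_fun f" "bdd_fun g" shows "\<bar>ip f g\<bar> \<le> ip f f + ip g g"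
proof -
  have "\<bar>f t * g t\<bar> \<le> f t * f t + g t * g t" for t
  proof -
    have "2 * (\<bar>f t\<bar> * \<bar>g t\<bar>) \<le> f t * f t + g t * g t"
      using sum_squares_bound[of "\<bar>f t\<bar>" "\<bar>g t\<bar>"] by (simp add: power2_eq_square)
    moreover have "0 \<le> \<bar>f t\<bar> * \<bar>g t\<bar>" by simp
    ultimately show ?thesis unfolding abs_mult by linarith
  qed
  then have "\<bar>ip f g\<bar> \<le> (\<integral>t. f t * f t + g t * g t \<partial>\<mu>)"
    unfolding ip_def using assms
    by (intro order_trans[OF integral_abs_bound] integral_mono bdd_fun_integrable integrable_abs) auto
  also have "\<dots> = ip f f + ip g g"
    unfolding ip_def using assms by (intro Bochner_Integration.integral_add bdd_fun_integrable) auto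
  finally show ?thesis .
qed

lemma ip_K_eq: "ip (K f) g = (\<integral>t. (\<integral>s. green l t s * f s * g t \<partial>\<mu>) \<partial>\<mu>)"
  by (simp add: ip_def K_def)

lemma ip_K_commute: assumes "bdd_fun f" "bdd_fun g" shows "ip (K f) g = ip f (K g)"
proof -
  have [measurable]: "f \<in> borel_measurable borel" "g \<in> borel_measurable borel" using assms by (auto simp: bdd_fun_def)
  obtain A where A: "A \<ge> 0" "\<And>t. t \<in> {0..l} \<Longrightarrow> \<bar>f t\<bar> \<le> A" using assms(1) by (rule bdd_funE) blast
  obtain B where B: "B \<ge> 0" "\<And>t. t \<in> {0..l} \<Longrightarrow> \<bar>g t\<bar> \<le> B" using assms(2) by (rule bdd_funE) blast
  have "ip (K f) g = (\<integral>s. (\<integral>t. green l t s * f s * g t \<partial>\<mu>) \<partial>\<mu>)"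
    unfolding ip_K_eq
  proof (rule fubini[where C = "l * A * B"])
    fix t s assume ts: "t \<in> {0..l}" "s \<in> {0..l}"
    have "\<bar>green l t s\<bar> \<le> l" using green_nonneg[OF l_pos ts] green_le[OF l_pos ts] ts by auto
    then show "\<bar>green l t s * f s * g t\<bar> \<le> l * A * B"
      unfolding abs_mult using A B ts l_pos by (intro mult_mono) auto
  qed measurable
  also have "\<dots> = ip (K g) f"
    unfolding ip_K_eq by (simp add: green_commute mult_ac)
  finally show ?thesis by (simp add: ip_commute)
qed

end

text \<open>
  The indicator function of \<open>]-\<infinity>,t[\<close> minus its mean over \<open>[0,l]\<close>, for \<open>t \<in> [0,l]\<close>.
\<close>
definition bridge :: "real \<Rightarrow> real \<Rightarrow> real \<Rightarrow> real" where
  "bridge l x t = (if x < t then 1 else 0) - t / l"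

text \<open>
  The Green function is the covariance of the Brownian bridge. Being a Gram kernel, it is positive
  semidefinite.
\<close>
lemma green_eq_integral_bridge:
  assumes "0 < l" "t \<in> {0..l}" "s \<in> {0..l}"
  shows "green l t s = (\<integral>x. indicator {0..l} x *\<^sub>R (bridge l x t * bridge l x s) \<partial>lborel)"
proof -
  define I where "I r = (\<lambda>x::real. indicator {0..<r} x :: real)" for r
  have I_int: "has_bochner_integral lborel (I r) r" if "r \<ge> 0" for r
    using that has_bochner_integral_real_indicator[of "{0..<r}" lborel] by (simp add: I_def)
  have eq: "indicator {0..l} x *\<^sub>R (bridge l x t * bridge l x s)
      = I (min t s) x - s / l * I t x - t / l * I s x + t * s / (l * l) * indicator {0..l} x" for x
    using assms by (auto simp: bridge_def I_def indicator_def field_simps)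
  have "has_bochner_integral lborel (\<lambda>x. indicator {0..l} x *\<^sub>R (bridge l x t * bridge l x s))
     (min t s - s / l * t - t / l * s + t * s / (l * l) * l)"
    unfolding eq using assms has_bochner_integral_real_indicator[of "{0..l}" lborel]
    by (intro has_bochner_integral_add has_bochner_integral_diff has_bochner_integral_mult_right I_int) auto
  then have "(\<integral>x. indicator {0..l} x *\<^sub>R (bridge l x t * bridge l x s) \<partial>lborel)
     = min t s - s / l * t - t / l * s + t * s / (l * l) * l"
    by (rule has_bochner_integral_integral_eq)
  also have "\<dots> = green l t s"
    using assms by (simp add: green_def min_def max_def field_simps)
  finally show ?thesis by simp
qed

context interval_mass
begin

text \<open>
  By \<open>green_eq_integral_bridge\<close> and Fubini, \<open>\<langle>K f, f\<rangle>\<close> is the integral over \<open>x\<close> of the square of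
  \<open>\<integral> bridge l x t * f t d\<mu>(t)\<close>.
\<close>
lemma ip_K_self_nonneg: assumes "bdd_fun f" shows "0 \<le> ip (K f) f"
proof -
  have [measurable]: "f \<in> borel_measurable borel" using assms by (auto simp: bdd_fun_def)
  have b[measurable]: "(\<lambda>(x, t). bridge l x t) \<in> borel_measurable (borel \<Otimes>\<^sub>M borel)"
    unfolding bridge_def by measurable
  obtain A where A: "A \<ge> 0" "\<And>t. t \<in> {0..l} \<Longrightarrow> \<bar>f t\<bar> \<le> A" using assms by (rule bdd_funE) blast
  define N where "N = density lborel (\<lambda>x. ennreal (indicator {0..l} x))"
  have sets_N[simp, measurable_cong]: "sets N = sets borel" by (simp add: N_def)
  interpret N: finite_measure N
    by (rule finite_measureI) (use l_pos in \<open>simp add: N_def emeasure_density ennreal_indicator\<close>)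
  have AE_N: "AE x in N. x \<in> {0..l}"
    unfolding N_def by (subst AE_density) (auto simp: ennreal_indicator indicator_def)
  have int_N: "integral\<^sup>L N h = (\<integral>x. indicator {0..l} x *\<^sub>R h x \<partial>lborel)" if "h \<in> borel_measurable borel" for h :: "real \<Rightarrow> real"
    unfolding N_def using that by (subst integral_density) auto
  have br: "\<bar>bridge l x t\<bar> \<le> 1" if "t \<in> {0..l}" for x t
    using that l_pos by (auto simp: bridge_def divide_le_eq_1)
  define B where "B x = (\<integral>s. bridge l x s * f s \<partial>\<mu>)" for x
  have [measurable]: "B \<in> borel_measurable borel" unfolding B_def by measurable
  have bf: "bdd_fun (\<lambda>s. bridge l x s * f s)" for x
  proof (rule bdd_funI)
    fix s assume "s \<in> {0..l}"
    then show "\<bar>bridge l x s * f s\<bar> \<le> 1 * A" unfolding abs_mult using br A by (intro mult_mono) auto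
  qed measurable
  have B_bd: "\<bar>B x\<bar> \<le> A * mass" for x
  proof -
    have "\<bar>B x\<bar> \<le> (\<integral>s. \<bar>bridge l x s * f s\<bar> \<partial>\<mu>)" unfolding B_def by (rule integral_abs_bound)
    also have "\<dots> \<le> (\<integral>s. 1 * A \<partial>\<mu>)"
    proof (rule integral_mono_supp)
      show "bdd_fun (\<lambda>s. \<bar>bridge l x s * f s\<bar>)" using bf[of x] by (simp add: bdd_fun_def)
      fix s assume "s \<in> {0..l}"
      then show "\<bar>bridge l x s * f s\<bar> \<le> 1 * A"
        unfolding abs_mult using br A by (intro mult_mono) auto
    qed auto
    finally show ?thesis by (simp add: mass_def mult.commute)
  qed
  have K_eq: "K f t = (\<integral>x. bridge l x t * B x \<partial>N)" if t: "t \<in> {0..l}" for t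
  proof -
    have "K f t = (\<integral>s. (\<integral>x. bridge l x t * (bridge l x s * f s) \<partial>N) \<partial>\<mu>)"
      unfolding K_def
    proof (intro integral_cong_supp)
      fix s assume s: "s \<in> {0..l}"
      have "green l t s = (\<integral>x. bridge l x t * bridge l x s \<partial>N)"
        by (subst int_N) (use green_eq_integral_bridge[OF l_pos t s] in auto)
      then show "green l t s * f s = (\<integral>x. bridge l x t * (bridge l x s * f s) \<partial>N)"
        by (simp flip: mult.assoc)
    qed measurable
    also have "\<dots> = (\<integral>x. (\<integral>s. bridge l x t * (bridge l x s * f s) \<partial>\<mu>) \<partial>N)"
    proof (rule fubini_bounded[of \<mu> N "{0..l}" "{0..l}" _ "1 * (1 * A)"])
      fix s x assume "s \<in> {0..l}" "x \<in> {0..l}"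
      then show "\<bar>bridge l x t * (bridge l x s * f s)\<bar> \<le> 1 * (1 * A)"
        unfolding abs_mult using br A t by (intro mult_mono) auto
    qed (use supp AE_N in \<open>auto intro: finite_measure_axioms N.finite_measure_axioms\<close>)
    finally show ?thesis by (simp add: B_def)
  qed
  have "ip (K f) f = (\<integral>t. (\<integral>x. B x * (bridge l x t * f t) \<partial>N) \<partial>\<mu>)"
    unfolding ip_def
  proof (intro integral_cong_supp)
    show "(\<lambda>t. K f t * f t) \<in> borel_measurable borel"
      using bdd_fun_K[OF assms] by (auto simp: bdd_fun_def)
    fix t assume t: "t \<in> {0..l}"
    show "K f t * f t = (\<integral>x. B x * (bridge l x t * f t) \<partial>N)"
      unfolding K_eq[OF t] by (subst integral_mult_left_zero[symmetric]) (simp add: mult_ac)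
  qed measurable
  also have "\<dots> = (\<integral>x. (\<integral>t. B x * (bridge l x t * f t) \<partial>\<mu>) \<partial>N)"
  proof (rule fubini_bounded[of \<mu> N "{0..l}" "{0..l}" _ "A * mass * (1 * A)"])
    fix s x assume "s \<in> {0..l}" "x \<in> {0..l}"
    then show "\<bar>B x * (bridge l x s * f s)\<bar> \<le> A * mass * (1 * A)"
      unfolding abs_mult[of "B x"] abs_mult[of "bridge l x s"] using B_bd br A mass_nonneg by (intro mult_mono) auto
  qed (use supp AE_N in \<open>auto intro: finite_measure_axioms N.finite_measure_axioms\<close>)
  also have "\<dots> = (\<integral>x. B x * B x \<partial>N)" by (simp add: B_def)
  also have "\<dots> \<ge> 0" by (intro integral_nonneg_AE) simp
  finally show ?thesis .
qed

text \<open>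
  \<open>green l t s \<le> l\<close> and \<open>2 |f(t) f(s)| \<le> f(t)\<^sup>2 + f(s)\<^sup>2\<close>.
\<close>
lemma ip_K_self_le: assumes "bdd_fun f" shows "ip (K f) f \<le> l * mass * ip f f"
proof -
  have [measurable]: "f \<in> borel_measurable borel" using assms by (auto simp: bdd_fun_def)
  have ff: "bdd_fun (\<lambda>t. f t * f t)" using assms by auto
  have "ip (K f) f \<le> (\<integral>t. (\<integral>s. l / 2 * (f s * f s) + l / 2 * (f t * f t) \<partial>\<mu>) \<partial>\<mu>)"
    unfolding ip_K_eq
  proof (intro integral_mono_supp)
    show "bdd_fun (\<lambda>t. \<integral>s. green l t s * f s * f t \<partial>\<mu>)"
      using bdd_fun_mult[OF bdd_fun_K assms, OF assms] by (simp add: K_def)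
    have "(\<integral>s. l / 2 * (f s * f s) + l / 2 * (f t * f t) \<partial>\<mu>) = l / 2 * ip f f + l / 2 * mass * (f t * f t)" for t
      using bdd_fun_integrable[OF ff] by (subst Bochner_Integration.integral_add) (auto simp: ip_def mass_def)
    then show "bdd_fun (\<lambda>t. \<integral>s. l / 2 * (f s * f s) + l / 2 * (f t * f t) \<partial>\<mu>)"
      by (simp only:) (intro bdd_fun_add bdd_fun_mult bdd_fun_const assms)
    fix t s assume ts: "t \<in> {0..l}" "s \<in> {0..l}"
    have "green l t s \<le> l" using green_le[OF l_pos ts] ts by auto
    have "2 * (\<bar>f t\<bar> * \<bar>f s\<bar>) \<le> f t * f t + f s * f s"
      using sum_squares_bound[of "\<bar>f t\<bar>" "\<bar>f s\<bar>"] by (simp add: power2_eq_square)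
    then have *: "\<bar>f s\<bar> * \<bar>f t\<bar> \<le> 1 / 2 * (f s * f s) + 1 / 2 * (f t * f t)" by (simp add: mult.commute)
    have "green l t s * f s * f t \<le> \<bar>green l t s\<bar> * (\<bar>f s\<bar> * \<bar>f t\<bar>)"
      by (metis abs_ge_self abs_mult mult.assoc)
    also have "\<dots> \<le> l * (1 / 2 * (f s * f s) + 1 / 2 * (f t * f t))"
      using green_nonneg[OF l_pos ts] \<open>green l t s \<le> l\<close> l_pos by (intro mult_mono *) auto
    finally show "green l t s * f s * f t \<le> l / 2 * (f s * f s) + l / 2 * (f t * f t)"
      by (simp add: algebra_simps)
  next
    fix t
    show "bdd_fun (\<lambda>s. green l t s * f s * f t)" using assms by auto
    show "bdd_fun (\<lambda>s. l / 2 * (f s * f s) + l / 2 * (f t * f t))"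
      by (intro bdd_fun_add bdd_fun_mult bdd_fun_const assms)
  qed
  also have "\<dots> = l * mass * ip f f"
  proof -
    have "(\<integral>s. l / 2 * (f s * f s) + l / 2 * (f t * f t) \<partial>\<mu>) = l / 2 * ip f f + l / 2 * mass * (f t * f t)" for t
      using bdd_fun_integrable[OF ff] by (subst Bochner_Integration.integral_add) (auto simp: ip_def mass_def)
    then show ?thesis using bdd_fun_integrable[OF ff]
      by (simp only:) (subst Bochner_Integration.integral_add, auto simp: ip_def mass_def)
  qed
  finally show ?thesis .
qed

text \<open>
  The solution of the string equation for \<open>z = 0\<close>, with boundary values \<open>1\<close> at \<open>0\<close> and \<open>0\<close> at \<open>l\<close>.
\<close>
definition e :: "real \<Rightarrow> real" where "e t = 1 - t / l"

lemma bdd_fun_e [intro!]: "bdd_fun e"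
  using bdd_fun_diff[OF bdd_fun_const[of 1] bdd_fun_divide[OF bdd_fun_ident, of l]] unfolding e_def[abs_def] .

lemma e_nonneg: "t \<in> {0..l} \<Longrightarrow> 0 \<le> e t" and e_le_1: "t \<in> {0..l} \<Longrightarrow> e t \<le> 1"
  using l_pos by (auto simp: e_def)

fun iter :: "nat \<Rightarrow> real \<Rightarrow> real" where
  "iter 0 = e"
| "iter (Suc n) = K (iter n)"

lemma bdd_fun_iter [intro!]: "bdd_fun (iter n)"
  by (induction n) auto

lemma iter_nonneg: "t \<in> {0..l} \<Longrightarrow> 0 \<le> iter n t"
  by (induction n arbitrary: t) (auto intro: e_nonneg K_nonneg)

definition moment :: "nat \<Rightarrow> real" where "moment n = ip (iter n) e"

text \<open>
  Symmetry of \<open>K\<close> moves all its powers to one side.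
\<close>
lemma ip_iter: "ip (iter i) (iter j) = moment (i + j)"
proof (induction j arbitrary: i)
  case (Suc j)
  have "ip (iter i) (iter (Suc j)) = ip (iter (Suc i)) (iter j)"
    using ip_K_commute[OF bdd_fun_iter bdd_fun_iter, of i j] by simp
  also have "\<dots> = moment (Suc i + j)" by (rule Suc)
  finally show ?case by simp
qed (simp add: moment_def)

lemma moment_nonneg: "0 \<le> moment n"
  unfolding moment_def ip_def by (intro integral_nonneg_supp mult_nonneg_nonneg iter_nonneg e_nonneg)

text \<open>
  A bound for the norm of \<open>K\<close>, increased by one to be positive even if the mass is zero.
\<close>
definition opbound :: real where "opbound = l * mass + 1"

lemma opbound_pos: "0 < opbound"
  unfolding opbound_def using mult_nonneg_nonneg[of l mass] mass_nonneg l_pos by linarith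

text \<open>
  \<open>mix i j\<close> is \<open>T\<^sup>i (1 - T)\<^sup>j e\<close> for the contraction \<open>T = K / opbound\<close>. Its inner products are the differences
  required by the Hausdorff moment problem.
\<close>
fun mix :: "nat \<Rightarrow> nat \<Rightarrow> real \<Rightarrow> real" where
  "mix i 0 = (\<lambda>t. iter i t / opbound ^ i)"
| "mix i (Suc j) = (\<lambda>t. mix i j t - mix (Suc i) j t)"

lemma bdd_fun_mix [intro!]: "bdd_fun (mix i j)"
  by (induction j arbitrary: i) auto

lemma K_mix: "K (mix i j) t = opbound * mix (Suc i) j t"
proof (induction j arbitrary: i)
  case 0
  then show ?case using opbound_pos by (simp add: K_divide)
next
  case (Suc j)
  then show ?case by (simp add: K_diff[OF bdd_fun_mix bdd_fun_mix] right_diff_distrib)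
qed

abbreviation scaled :: "nat \<Rightarrow> real" where "scaled n \<equiv> moment n / opbound ^ n"

lemma ip_mix: "ip (mix i j) (mix k m) = moment_diff scaled (i + k) (j + m)"
proof (induction m arbitrary: i j k)
  case 0
  show ?case
  proof (induction j arbitrary: i)
    case 0
    have "ip (mix i 0) (mix k 0) = ip (iter i) (iter k) / (opbound ^ i * opbound ^ k)"
      by (simp add: ip_def)
    then show ?case by (simp add: ip_iter power_add)
  next
    case (Suc j)
    then show ?case using ip_diff_left[OF bdd_fun_mix[of i j] bdd_fun_mix[of "Suc i" j] bdd_fun_mix[of k 0]]
      by simp
  qed
next
  case (Suc m)
  then show ?case using ip_diff_right[OF bdd_fun_mix[of k m] bdd_fun_mix[of "Suc k" m] bdd_fun_mix[of i j]]
    by simp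
qed

text \<open>
  For even exponents the number is a square norm; one odd exponent adds a factor \<open>T\<close> or \<open>1 - T\<close>, both of which are
  positive operators.
\<close>
lemma moment_diff_scaled_nonneg: "0 \<le> moment_diff scaled i j"
proof -
  have 00: "0 \<le> moment_diff scaled (2 * i) (2 * j)" for i j
    using ip_self_nonneg[of "mix i j"] ip_mix[of i j i j] by (simp add: mult_2)
  have K_eq: "ip (K (mix i j)) (mix i j) = opbound * moment_diff scaled (Suc (2 * i)) (2 * j)" for i j
  proof -
    have "ip (K (mix i j)) (mix i j) = opbound * ip (mix (Suc i) j) (mix i j)"
      unfolding ip_def K_mix by (simp add: mult.assoc)
    then show ?thesis by (simp add: ip_mix mult_2)
  qed
  have 10: "0 \<le> moment_diff scaled (Suc (2 * i)) (2 * j)" for i j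
    using ip_K_self_nonneg[OF bdd_fun_mix, of i j] opbound_pos by (simp add: K_eq zero_le_mult_iff)
  have 01: "0 \<le> moment_diff scaled (2 * i) (Suc (2 * j))" for i j
  proof -
    have "opbound * moment_diff scaled (Suc (2 * i)) (2 * j) \<le> l * mass * ip (mix i j) (mix i j)"
      using ip_K_self_le[OF bdd_fun_mix, of i j] by (simp add: K_eq)
    also have "\<dots> \<le> opbound * ip (mix i j) (mix i j)"
      by (intro mult_right_mono ip_self_nonneg) (simp add: opbound_def)
    finally show ?thesis using opbound_pos by (simp add: ip_mix mult_2)
  qed
  \<comment> \<open>\<open>x (1 - x) = x (1 - x)^2 + x^2 (1 - x)\<close> reduces the odd-odd case to the mixed ones.\<close>
  have 11: "0 \<le> moment_diff scaled (Suc (2 * i)) (Suc (2 * j))" for i j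
    using 10[of i "Suc j"] 01[of "Suc i" j] by simp
  obtain a where i: "i = 2 * a \<or> i = Suc (2 * a)" 
  proof -
    have "i = 2 * (i div 2) \<or> i = Suc (2 * (i div 2))" by presburger
    then show thesis by (rule that)
  qed
  obtain b where j: "j = 2 * b \<or> j = Suc (2 * b)" 
  proof -
    have "j = 2 * (j div 2) \<or> j = Suc (2 * (j div 2))" by presburger
    then show thesis by (rule that)
  qed
  from i j show ?thesis
    using 00[of a b] 10[of a b] 01[of a b] 11[of a b] by (elim disjE) (simp_all only:)
qed

text \<open>
  The moments of \<open>P\<close> determine the resolvent as well, even where its power series diverges. With \<open>S = \<eta> * opbound\<close>,
  the resolvent equation reads \<open>(1 + S) u = e + S (1 - T) u\<close>. Paired with \<open>(1 - T)\<^sup>k e\<close>, it expresses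
  \<open>\<langle>u, (1 - T)\<^sup>k e\<rangle>\<close> by \<open>\<langle>u, (1 - T)\<^bsup>k+1\<^esup> e\<rangle>\<close> with factor \<open>\<theta> = S / (1 + S) < 1\<close>. The integrals of
  \<open>(1 - t)\<^sup>k / (1 + S t)\<close> satisfy the same recursion. The difference \<open>d\<close> of the two sequences is bounded and satisfies
  \<open>d 0 = \<theta>\<^sup>k * d k\<close> for every \<open>k\<close>, so \<open>d 0 = 0\<close>.
\<close>

lemma green_spectral_measure:
  obtains P where "real_distribution P" "AE t in P. t \<in> {0..1}"
    "\<And>n. moment n = moment 0 * (\<integral>t. (opbound * t) ^ n \<partial>P)"
    "\<And>\<eta> u. 0 \<le> \<eta> \<Longrightarrow> bdd_fun u \<Longrightarrow> (\<And>t. t \<in> {0..l} \<Longrightarrow> u t = e t - \<eta> * K u t) \<Longrightarrow>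
       ip e u = moment 0 * (\<integral>t. 1 / (1 + \<eta> * (opbound * t)) \<partial>P)"
proof -
  obtain P where P: "real_distribution P" and supp_P: "AE t in P. t \<in> {0..1}"
    and mom: "\<And>i j. moment_diff scaled i j = scaled 0 * (\<integral>t. t ^ i * (1 - t) ^ j \<partial>P)"
    by (rule hausdorff_moment[of scaled, OF moment_diff_scaled_nonneg]) (rule that)
  interpret P: real_distribution P by (rule P)
  have "moment n = moment 0 * (\<integral>t. (opbound * t) ^ n \<partial>P)" for n
  proof -
    have "moment n = opbound ^ n * scaled n" using opbound_pos by simp
    also have "scaled n = moment 0 * (\<integral>t. t ^ n \<partial>P)" using mom[of n 0] by simp
    finally show ?thesis by (simp add: power_mult_distrib)
  qed
  moreover have "ip e u = moment 0 * (\<integral>t. 1 / (1 + \<eta> * (opbound * t)) \<partial>P)"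
    if \<eta>: "0 \<le> \<eta>" and u: "bdd_fun u" and u_eq: "\<And>t. t \<in> {0..l} \<Longrightarrow> u t = e t - \<eta> * K u t" for \<eta> u
  proof -
    define S where "S = \<eta> * opbound"
    have S: "S \<ge> 0" using \<eta> opbound_pos by (simp add: S_def)
    define \<theta> where "\<theta> = S / (1 + S)"
    have \<theta>: "0 \<le> \<theta>" "\<theta> < 1" using S by (auto simp: \<theta>_def)
    have frac: "x = D / (1 + S) + \<theta> * y" if "(1 + S) * x = D + S * y" for x D y
    proof -
      have "x = (D + S * y) / (1 + S)" using that S by (simp add: eq_divide_eq mult.commute)
      then show ?thesis by (simp add: \<theta>_def add_divide_distrib)
    qed
    define h where "h k t = (1 - t) ^ k / (1 + S * t)" for k :: nat and t :: real
    have [measurable]: "h k \<in> borel_measurable borel" for k unfolding h_def by measurable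
    have h_bd: "\<bar>h k t\<bar> \<le> 1" if "t \<in> {0..1}" for k t
    proof -
      have "0 \<le> (1 - t) ^ k" "(1 - t) ^ k \<le> 1" using that by (auto intro: power_le_one)
      moreover have "1 \<le> 1 + S * t" using that S by simp
      ultimately show ?thesis unfolding h_def by (simp add: divide_le_eq)
    qed
    have h_int: "integrable P (h k)" for k
      by (rule P.integrable_const_bound[of _ 1], rule eventually_mono[OF supp_P]) (use h_bd in auto)
    define d where "d k = ip (mix 0 k) u - moment 0 * (\<integral>t. h k t \<partial>P)" for k
    have rec_ip: "ip (mix 0 k) u = moment_diff scaled 0 k / (1 + S) + \<theta> * ip (mix 0 (Suc k)) u" for k
    proof -
      have "moment_diff scaled 0 k = ip (mix 0 k) e"
        using ip_mix[of 0 k 0 0] by simp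
      also have "\<dots> = ip (mix 0 k) (\<lambda>t. u t + \<eta> * K u t)"
        using u u_eq by (intro ip_cong bdd_fun_add bdd_fun_mult bdd_fun_K bdd_fun_mix bdd_fun_const bdd_fun_e) auto
      also have "\<dots> = ip (mix 0 k) u + \<eta> * ip (mix 0 k) (K u)"
        unfolding ip_def using bdd_fun_integrable[OF bdd_fun_mult[OF bdd_fun_mix u]]
          bdd_fun_integrable[OF bdd_fun_mult[OF bdd_fun_mix bdd_fun_K[OF u]]]
        by (simp add: distrib_left mult.left_commute)
      also have "ip (mix 0 k) (K u) = ip (K (mix 0 k)) u"
        using ip_K_commute[OF bdd_fun_mix u] by simp
      also have "ip (K (mix 0 k)) u = opbound * ip (mix (Suc 0) k) u"
        unfolding ip_def K_mix by (simp add: mult.assoc)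
      finally have D: "moment_diff scaled 0 k = ip (mix 0 k) u + S * ip (mix (Suc 0) k) u"
        by (simp only: S_def mult.assoc)
      have diff: "ip (mix 0 (Suc k)) u = ip (mix 0 k) u - ip (mix (Suc 0) k) u"
        using ip_diff_left[OF bdd_fun_mix bdd_fun_mix u] by simp
      have alg: "(1 + S) * x = D + S * z" if "D = x + S * y" "z = x - y" for x y z D
        unfolding that by (simp add: algebra_simps)
      show ?thesis by (rule frac[OF alg[OF D diff]])
    qed
    have rec_P: "(\<integral>t. h k t \<partial>P) = (\<integral>t. (1 - t) ^ k \<partial>P) / (1 + S) + \<theta> * (\<integral>t. h (Suc k) t \<partial>P)" for k
    proof -
      have "(\<integral>t. (1 - t) ^ k \<partial>P) = (\<integral>t. (1 + S) * h k t - S * h (Suc k) t \<partial>P)"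
      proof (intro integral_cong_AE eventually_mono[OF supp_P])
        fix t :: real assume "t \<in> {0..1}"
        then have "0 \<le> S * t" using S by simp
        then have "1 + S * t \<noteq> 0" by linarith
        moreover have "(1 + S) * h k t - S * h (Suc k) t = (1 - t) ^ k * (1 + S * t) / (1 + S * t)"
          unfolding h_def power_Suc times_divide_eq_right diff_divide_distrib[symmetric]
          by (rule arg_cong2[of _ _ _ _ "(/)"]) (simp_all add: algebra_simps)
        ultimately show "(1 - t) ^ k = (1 + S) * h k t - S * h (Suc k) t" by simp
      qed measurable
      also have "\<dots> = (1 + S) * (\<integral>t. h k t \<partial>P) - S * (\<integral>t. h (Suc k) t \<partial>P)"
        using h_int by simp
      finally have "(1 + S) * (\<integral>t. h k t \<partial>P) = (\<integral>t. (1 - t) ^ k \<partial>P) + S * (\<integral>t. h (Suc k) t \<partial>P)"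
        by linarith
      then show ?thesis by (rule frac)
    qed
    have d_rec: "d k = \<theta> * d (Suc k)" for k
    proof -
      have D: "moment_diff scaled 0 k = moment 0 * (\<integral>t. (1 - t) ^ k \<partial>P)"
        using mom[of 0 k] by simp
      have alg: "m * I / (1 + S) + \<theta> * a - m * (I / (1 + S) + \<theta> * c) = \<theta> * (a - m * c)" for m I a c :: real
        by (simp add: algebra_simps)
      show ?thesis unfolding d_def rec_ip[of k] rec_P[of k] D by (rule alg)
    qed
    have d_pow: "d 0 = \<theta> ^ k * d k" for k
    proof (induction k)
      case (Suc k)
      then show ?case using d_rec[of k] by (simp add: mult_ac)
    qed simp
    have d_bd: "\<bar>d k\<bar> \<le> 2 * moment 0 + ip u u" for k
    proof -
      have pk: "\<bar>t ^ 0 * (1 - t) ^ (k + k)\<bar> \<le> 1" if "t \<in> {0..1}" for t :: real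
        using that by (auto simp: power_abs intro!: power_le_one)
      have pk_meas: "(\<lambda>t::real. t ^ 0 * (1 - t) ^ (k + k)) \<in> borel_measurable P" by measurable
      have pk_int: "integrable P (\<lambda>t. t ^ 0 * (1 - t) ^ (k + k))"
      proof (rule P.integrable_const_bound[OF _ pk_meas])
        show "AE t in P. norm (t ^ 0 * (1 - t) ^ (k + k)) \<le> 1"
          unfolding real_norm_def by (rule eventually_mono[OF supp_P pk])
      qed
      have "(\<integral>t. t ^ 0 * (1 - t) ^ (k + k) \<partial>P) \<le> 1"
      proof (rule P.integral_le_const[OF pk_int])
        show "AE t in P. t ^ 0 * (1 - t) ^ (k + k) \<le> 1"
          by (rule eventually_mono[OF supp_P abs_le_D1[OF pk]])
      qed
      then have "scaled 0 * (\<integral>t. t ^ 0 * (1 - t) ^ (k + k) \<partial>P) \<le> scaled 0"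
        by (rule mult_left_le) (use moment_nonneg[of 0] in simp)
      then have "moment_diff scaled 0 (k + k) \<le> moment 0"
        unfolding mom[of 0 "k + k", symmetric] by (simp only: power_0 div_by_1)
      then have 1: "\<bar>ip (mix 0 k) u\<bar> \<le> moment 0 + ip u u"
        using abs_ip_le[OF bdd_fun_mix u, of 0 k] unfolding ip_mix[of 0 k 0 k] by (simp only: add_0_left)
      have "\<bar>\<integral>t. h k t \<partial>P\<bar> \<le> (\<integral>t. \<bar>h k t\<bar> \<partial>P)" by (rule integral_abs_bound[of P "h k"])
      also have "\<dots> \<le> 1"
      proof (rule P.integral_le_const)
        show "AE t in P. \<bar>h k t\<bar> \<le> 1" by (rule eventually_mono[OF supp_P h_bd])
      qed (rule integrable_abs[OF h_int])
      finally have "moment 0 * \<bar>\<integral>t. h k t \<partial>P\<bar> \<le> moment 0"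
        using moment_nonneg[of 0] by (rule mult_left_le)
      then have 2: "\<bar>moment 0 * (\<integral>t. h k t \<partial>P)\<bar> \<le> moment 0"
        using moment_nonneg[of 0] by (simp only: abs_mult abs_of_nonneg)
      have tri: "\<bar>a - b\<bar> \<le> 2 * m + c" if "\<bar>a\<bar> \<le> m + c" "\<bar>b\<bar> \<le> m" for a b c m :: real
        using that by linarith
      show ?thesis unfolding d_def by (rule tri[OF 1 2])
    qed
    have lim: "(\<lambda>k. \<theta> ^ k * (2 * moment 0 + ip u u)) \<longlonglongrightarrow> 0 * (2 * moment 0 + ip u u)"
      using \<theta> by (intro tendsto_mult_right LIMSEQ_power_zero) auto
    have bound: "\<bar>d 0\<bar> \<le> \<theta> ^ k * (2 * moment 0 + ip u u)" for k
    proof -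
      have "\<bar>d 0\<bar> = \<theta> ^ k * \<bar>d k\<bar>"
        unfolding d_pow[of k] abs_mult using \<theta>(1) by (simp only: abs_of_nonneg zero_le_power)
      also have "\<dots> \<le> \<theta> ^ k * (2 * moment 0 + ip u u)"
        by (rule mult_left_mono[OF d_bd zero_le_power[OF \<theta>(1)]])
      finally show ?thesis .
    qed
    have "\<bar>d 0\<bar> \<le> 0 * (2 * moment 0 + ip u u)"
      by (rule LIMSEQ_le_const[OF lim]) (use bound in blast)
    then have "d 0 = 0" by simp
    then have "ip (mix 0 0) u = moment 0 * (\<integral>t. h 0 t \<partial>P)"
      unfolding d_def by (simp only: eq_iff_diff_eq_0[symmetric])
    moreover have "ip (mix 0 0) u = ip e u" by simp
    moreover have "h 0 = (\<lambda>t. 1 / (1 + \<eta> * (opbound * t)))"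
      by (simp add: h_def[abs_def] S_def mult.assoc)
    ultimately show ?thesis by (simp only:)
  qed
  ultimately show thesis using that P supp_P by blast
qed

end

section \<open>Volterra equations for a finite mass distribution\<close>

context interval_mass
begin

text \<open>
  The operator of the integrated string equation \<open>y(t) = a + b t + \<eta> (volterra y)(t)\<close>; the positive part restricts the
  integration to \<open>s \<le> t\<close>.
\<close>
definition volterra :: "(real \<Rightarrow> real) \<Rightarrow> real \<Rightarrow> real" where
  "volterra f t = (\<integral>s. max 0 (t - s) * f s \<partial>\<mu>)"

lemma bdd_fun_kernel [intro!]: "bdd_fun (\<lambda>s. max 0 (t - s))"
  by (rule bdd_funI[of _ "\<bar>t\<bar> + l"]) auto

lemma bdd_fun_cong:
  assumes "bdd_fun f" "g \<in> borel_measurable borel" "\<And>t. t \<in> {0..l} \<Longrightarrow> \<bar>g t\<bar> \<le> \<bar>f t\<bar>"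
  shows "bdd_fun g"
proof -
  obtain C where "\<And>t. t \<in> {0..l} \<Longrightarrow> \<bar>f t\<bar> \<le> C" using assms(1) by (rule bdd_funE) blast
  then have "\<And>t. t \<in> {0..l} \<Longrightarrow> \<bar>g t\<bar> \<le> C" using assms(3) by (meson order_trans)
  then show ?thesis by (rule bdd_funI[OF assms(2)])
qed

lemma volterra_measurable [measurable]:
  assumes [measurable]: "f \<in> borel_measurable borel" shows "volterra f \<in> borel_measurable borel"
  unfolding volterra_def by measurable

lemma volterra_mono:
  assumes "bdd_fun f" "bdd_fun g" "\<And>s. s \<in> {0..l} \<Longrightarrow> f s \<le> g s"
  shows "volterra f t \<le> volterra g t"
  unfolding volterra_def using assms
  by (intro integral_mono_supp bdd_fun_mult bdd_fun_kernel mult_left_mono) auto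

lemma volterra_nonneg: "(\<And>s. s \<in> {0..l} \<Longrightarrow> 0 \<le> f s) \<Longrightarrow> 0 \<le> volterra f t"
  unfolding volterra_def by (intro integral_nonneg_supp mult_nonneg_nonneg) auto

lemma volterra_linear:
  "bdd_fun f \<Longrightarrow> bdd_fun g \<Longrightarrow> volterra (\<lambda>s. a * f s + b * g s) t = a * volterra f t + b * volterra g t"
  unfolding volterra_def
  using bdd_fun_integrable[OF bdd_fun_mult[OF bdd_fun_kernel[of t]], of f]
    bdd_fun_integrable[OF bdd_fun_mult[OF bdd_fun_kernel[of t]], of g]
  by (simp add: distrib_left mult.left_commute)

lemma bdd_fun_exp [intro!]: "bdd_fun (\<lambda>s. exp (\<kappa> * s))"
proof (rule bdd_funI)
  fix t assume t: "t \<in> {0..l}"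
  have "\<kappa> * t \<le> \<bar>\<kappa>\<bar> * l" using t by (intro mult_mono) auto
  then show "\<bar>exp (\<kappa> * t)\<bar> \<le> exp (\<bar>\<kappa>\<bar> * l)" by simp
qed measurable

text \<open>
  For large \<open>\<kappa>\<close> the Volterra operator contracts the weight \<open>exp (\<kappa> s)\<close>, since
  \<open>(t - s) exp (\<kappa> s) \<le> exp (\<kappa> t) / \<kappa>\<close>.
\<close>
lemma volterra_exp_le: assumes "0 < \<kappa>" shows "volterra (\<lambda>s. C * exp (\<kappa> * s)) t \<le> \<bar>C\<bar> * mass / \<kappa> * exp (\<kappa> * t)"
proof -
  have "max 0 (t - s) * (C * exp (\<kappa> * s)) \<le> \<bar>C\<bar> / \<kappa> * exp (\<kappa> * t)" for s
  proof -
    have "\<kappa> * max 0 (t - s) \<le> exp (\<kappa> * (t - s))"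
    proof (cases "s \<le> t")
      case True
      then have "max 0 (t - s) = t - s" by simp
      moreover have "\<kappa> * (t - s) \<le> exp (\<kappa> * (t - s))"
        using exp_ge_add_one_self[of "\<kappa> * (t - s)"] by linarith
      ultimately show ?thesis by (simp only:)
    qed simp
    then have "(\<kappa> * max 0 (t - s)) * exp (\<kappa> * s) \<le> exp (\<kappa> * (t - s)) * exp (\<kappa> * s)"
      by (intro mult_right_mono) auto
    also have "\<dots> = exp (\<kappa> * t)" by (simp add: exp_add[symmetric] algebra_simps)
    finally have *: "max 0 (t - s) * exp (\<kappa> * s) \<le> exp (\<kappa> * t) / \<kappa>"
      using assms by (simp add: pos_le_divide_eq mult_ac)
    have "max 0 (t - s) * (C * exp (\<kappa> * s)) \<le> \<bar>C\<bar> * (max 0 (t - s) * exp (\<kappa> * s))"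
      by (simp add: mult.left_commute mult_right_mono)
    also have "\<dots> \<le> \<bar>C\<bar> * (exp (\<kappa> * t) / \<kappa>)" by (intro mult_left_mono *) auto
    finally show ?thesis by simp
  qed
  then have "volterra (\<lambda>s. C * exp (\<kappa> * s)) t \<le> (\<integral>s. \<bar>C\<bar> / \<kappa> * exp (\<kappa> * t) \<partial>\<mu>)"
    unfolding volterra_def by (intro integral_mono_supp bdd_fun_mult bdd_fun_kernel bdd_fun_const bdd_fun_exp)
  also have "\<dots> = \<bar>C\<bar> * mass / \<kappa> * exp (\<kappa> * t)" by (simp add: mass_def)
  finally show ?thesis .
qed

text \<open>
  Only \<open>y \<ge> 0\<close> needs proof. Measured against the weight \<open>exp (\<kappa> t)\<close>, the bound on the negative part of \<open>y\<close> can be halved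
  again and again; here \<open>\<kappa> = 2 \<eta> mass + 1\<close> makes \<open>\<eta> * volterra\<close> a contraction by \<open>1/2\<close>.
\<close>
lemma volterra_solution_ge:
  assumes "0 \<le> \<eta>" and y: "bdd_fun y" and g: "\<And>t. t \<in> {0..l} \<Longrightarrow> 0 \<le> g t"
    and eq: "\<And>t. t \<in> {0..l} \<Longrightarrow> y t = g t + \<eta> * volterra y t" and t: "t \<in> {0..l}"
  shows "g t \<le> y t"
proof -
  define \<kappa> where "\<kappa> = 2 * \<eta> * mass + 1"
  have \<kappa>: "0 < \<kappa>" "2 * \<eta> * mass \<le> \<kappa>" using \<open>0 \<le> \<eta>\<close> mass_nonneg by (auto simp: \<kappa>_def add_nonneg_pos)
  obtain C where C: "0 \<le> C" "\<And>t. t \<in> {0..l} \<Longrightarrow> \<bar>y t\<bar> \<le> C" using y by (rule bdd_funE) blast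
  have step: "- y t \<le> C / 2 ^ n * exp (\<kappa> * t)" if "t \<in> {0..l}" for n t
    using that
  proof (induction n arbitrary: t)
    case 0
    have "C * 1 \<le> C * exp (\<kappa> * t)" using C \<kappa> 0 by (intro mult_left_mono) auto
    then show ?case using C(2)[OF 0] by auto
  next
    case (Suc n)
    have "volterra (\<lambda>s. - y s) t \<le> volterra (\<lambda>s. C / 2 ^ n * exp (\<kappa> * s)) t"
      using bdd_fun_mult[OF bdd_fun_const[of "-1"] y]
      by (intro volterra_mono Suc.IH bdd_fun_mult bdd_fun_const bdd_fun_exp) auto
    also have "\<dots> \<le> \<bar>C / 2 ^ n\<bar> * mass / \<kappa> * exp (\<kappa> * t)" by (rule volterra_exp_le[OF \<kappa>(1)])
    finally have "\<eta> * volterra (\<lambda>s. - y s) t \<le> \<eta> * (C / 2 ^ n * mass / \<kappa> * exp (\<kappa> * t))"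
      using C \<open>0 \<le> \<eta>\<close> by (intro mult_left_mono) auto
    also have "\<dots> = (2 * \<eta> * mass / \<kappa>) * (C / 2 ^ Suc n * exp (\<kappa> * t))" by (simp add: mult_ac)
    also have "\<dots> \<le> 1 * (C / 2 ^ Suc n * exp (\<kappa> * t))"
      using C \<kappa> by (intro mult_right_mono) auto
    also have "\<eta> * volterra (\<lambda>s. - y s) t = - (\<eta> * volterra y t)" by (simp add: volterra_def)
    finally show ?case using eq[OF Suc.prems] g[OF Suc.prems] by simp
  qed
  have y_nonneg: "0 \<le> y t" if t: "t \<in> {0..l}" for t
  proof -
    have "(\<lambda>n. C * exp (\<kappa> * t) * (1 / 2) ^ n) \<longlonglongrightarrow> C * exp (\<kappa> * t) * 0"
      by (intro tendsto_mult_left LIMSEQ_power_zero) auto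
    then have "- y t \<le> C * exp (\<kappa> * t) * 0"
      by (rule LIMSEQ_le_const) (use step[OF t] in \<open>auto simp: power_one_over field_simps\<close>)
    then show ?thesis by simp
  qed
  have "0 \<le> \<eta> * volterra y t" using \<open>0 \<le> \<eta>\<close> y_nonneg by (intro mult_nonneg_nonneg volterra_nonneg) auto
  then show ?thesis using eq[OF t] by simp
qed

text \<open>
  The Picard iterates increase and stay below the supersolution \<open>C exp (\<kappa> t)\<close>, so they converge pointwise, and the limit
  solves the equation by dominated convergence. The iterates are cut off outside \<open>[0,l]\<close>, where nothing is
  assumed about them.
\<close>
lemma volterra_iterates_converge:
  assumes "0 \<le> \<eta>" "0 \<le> a" "0 \<le> b"
    and S0: "\<And>t. t \<in> {0..l} \<Longrightarrow> S 0 t = a + b * t"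
    and S_Suc: "\<And>n t. t \<in> {0..l} \<Longrightarrow> S (Suc n) t = a + b * t + \<eta> * volterra (\<lambda>s. indicator {0..l} s * S n s) t"
  defines "y \<equiv> \<lambda>t. indicator {0..l} t * lim (\<lambda>n. S n t)"
  shows "bdd_fun (\<lambda>t. indicator {0..l} t * S n t)" "bdd_fun y"
    "\<And>t. t \<in> {0..l} \<Longrightarrow> y t = a + b * t + \<eta> * volterra y t"
proof -
  let ?T = "\<lambda>n t. indicator {0..l} t * S n t"
  define \<kappa> where "\<kappa> = 2 * \<eta> * mass + 1"
  have \<kappa>: "0 < \<kappa>" "2 * \<eta> * mass \<le> \<kappa>" using \<open>0 \<le> \<eta>\<close> mass_nonneg by (auto simp: \<kappa>_def add_nonneg_pos)
  define C where "C = 2 * (a + b * l)"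
  have C: "0 \<le> C" using assms(2,3) l_pos by (simp add: C_def)
  have C2: "a + b * t \<le> C / 2 * exp (\<kappa> * t)" if "t \<in> {0..l}" for t
  proof -
    have "a + b * t \<le> C / 2 * 1" using that assms(3) by (auto simp: C_def mult_left_mono)
    also have "\<dots> \<le> C / 2 * exp (\<kappa> * t)" using C \<kappa> that by (intro mult_left_mono) auto
    finally show ?thesis .
  qed
  have inv: "?T n \<in> borel_measurable borel \<and> (\<forall>t\<in>{0..l}. 0 \<le> S n t \<and> S n t \<le> C * exp (\<kappa> * t))" for n
  proof (induction n)
    case 0
    have "?T 0 = (\<lambda>t. indicator {0..l} t * (a + b * t))" using S0 by (auto simp: indicator_def fun_eq_iff)
    moreover have "C / 2 * exp (\<kappa> * t) \<le> C * exp (\<kappa> * t)" for t using C by (intro mult_right_mono) auto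
    ultimately have "?T 0 \<in> borel_measurable borel" "\<And>t. t \<in> {0..l} \<Longrightarrow> a + b * t \<le> C * exp (\<kappa> * t)"
      by (simp, blast intro: order_trans[OF C2])
    then show ?case using S0 assms(2,3) by auto
  next
    case (Suc n)
    have bd: "bdd_fun (?T n)"
      by (rule bdd_fun_cong[OF bdd_fun_mult[OF bdd_fun_const[of C] bdd_fun_exp[of \<kappa>]]]) (use Suc C in auto)
    have "?T (Suc n) = (\<lambda>t. indicator {0..l} t * (a + b * t + \<eta> * volterra (?T n) t))"
      using S_Suc by (auto simp: indicator_def fun_eq_iff)
    moreover have "volterra (?T n) \<in> borel_measurable borel" using Suc volterra_measurable by blast
    ultimately have m: "?T (Suc n) \<in> borel_measurable borel" by simp
    have "0 \<le> S (Suc n) t \<and> S (Suc n) t \<le> C * exp (\<kappa> * t)" if t: "t \<in> {0..l}" for t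
    proof
      have "0 \<le> volterra (?T n) t" using Suc by (intro volterra_nonneg) auto
      then show "0 \<le> S (Suc n) t" using t assms(1-3) by (simp add: S_Suc)
      have "volterra (?T n) t \<le> volterra (\<lambda>s. C * exp (\<kappa> * s)) t"
        by (intro volterra_mono bd bdd_fun_mult bdd_fun_const bdd_fun_exp) (use Suc in auto)
      also have "\<dots> \<le> \<bar>C\<bar> * mass / \<kappa> * exp (\<kappa> * t)" by (rule volterra_exp_le[OF \<kappa>(1)])
      finally have "\<eta> * volterra (?T n) t \<le> \<eta> * (C * mass / \<kappa> * exp (\<kappa> * t))"
        using C assms(1) by (intro mult_left_mono) auto
      also have "\<dots> = (2 * \<eta> * mass / \<kappa>) * (C / 2 * exp (\<kappa> * t))" by simp
      also have "\<dots> \<le> 1 * (C / 2 * exp (\<kappa> * t))"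
        using C \<kappa> by (intro mult_right_mono) auto
      finally show "S (Suc n) t \<le> C * exp (\<kappa> * t)" using C2[OF t] by (simp add: S_Suc[OF t])
    qed
    with m show ?case by blast
  qed
  show bd: "bdd_fun (?T n)" for n
    by (rule bdd_fun_cong[OF bdd_fun_mult[OF bdd_fun_const[of C] bdd_fun_exp[of \<kappa>]]]) (use inv[of n] C in auto)
  have S_mono: "S n t \<le> S (Suc n) t" if "t \<in> {0..l}" for n t
    using that
  proof (induction n arbitrary: t)
    case 0
    have "0 \<le> volterra (?T 0) t" using inv[of 0] by (intro volterra_nonneg) auto
    then show ?case using 0 assms(1) by (simp add: S0 S_Suc)
  next
    case (Suc n)
    have "volterra (?T n) t \<le> volterra (?T (Suc n)) t"
      by (intro volterra_mono bd) (use Suc.IH in auto)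
    then show ?case using assms(1) by (simp add: S_Suc[OF Suc.prems] mult_left_mono)
  qed
  have S_lim: "(\<lambda>n. S n t) \<longlonglongrightarrow> y t" if t: "t \<in> {0..l}" for t
  proof -
    have "incseq (\<lambda>n. S n t)" using S_mono[OF t] by (rule incseq_SucI)
    moreover have "bdd_above (range (\<lambda>n. S n t))" using inv t by (intro bdd_aboveI[of _ "C * exp (\<kappa> * t)"]) auto
    ultimately have "convergent (\<lambda>n. S n t)" using LIMSEQ_incseq_SUP convergentI by blast
    then show ?thesis using t by (simp add: y_def convergent_LIMSEQ_iff)
  qed
  have T_lim: "(\<lambda>n. ?T n t) \<longlonglongrightarrow> y t" for t
    using S_lim[of t] by (cases "t \<in> {0..l}") (auto simp: y_def)
  have y_meas: "y \<in> borel_measurable borel"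
    by (rule borel_measurable_LIMSEQ_real[OF T_lim]) (use inv in auto)
  show y_bd: "bdd_fun y"
  proof (rule bdd_fun_cong[OF bdd_fun_mult[OF bdd_fun_const[of C] bdd_fun_exp[of \<kappa>]] y_meas])
    fix t assume t: "t \<in> {0..l}"
    have "0 \<le> y t" using inv t by (intro LIMSEQ_le_const[OF S_lim[OF t]]) auto
    moreover have "y t \<le> C * exp (\<kappa> * t)" using inv t by (intro LIMSEQ_le_const2[OF S_lim[OF t]]) auto
    ultimately show "\<bar>y t\<bar> \<le> \<bar>C * exp (\<kappa> * t)\<bar>" by simp
  qed
  fix t assume t: "t \<in> {0..l}"
  have "(\<lambda>n. volterra (?T n) t) \<longlonglongrightarrow> volterra y t"
    unfolding volterra_def
  proof (rule integral_dominated_convergence)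
    show "integrable \<mu> (\<lambda>s. max 0 (t - s) * (C * exp (\<kappa> * s)))"
      by (intro bdd_fun_integrable bdd_fun_mult bdd_fun_kernel bdd_fun_const bdd_fun_exp)
    show "AE s in \<mu>. (\<lambda>n. max 0 (t - s) * ?T n s) \<longlonglongrightarrow> max 0 (t - s) * y s"
      by (intro always_eventually allI tendsto_mult_left T_lim)
    show "AE s in \<mu>. norm (max 0 (t - s) * ?T n s) \<le> max 0 (t - s) * (C * exp (\<kappa> * s))" for n
      by (rule eventually_mono[OF supp]) (use inv[of n] in \<open>auto simp: abs_mult intro!: mult_left_mono\<close>)
    show "(\<lambda>s. max 0 (t - s) * y s) \<in> borel_measurable \<mu>" using y_meas by measurable
    show "(\<lambda>s. max 0 (t - s) * ?T n s) \<in> borel_measurable \<mu>" for n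
    proof (rule borel_measurable_times)
      show "?T n \<in> borel_measurable \<mu>"
        using inv[of n] by (simp only: measurable_cong_sets[OF sets_\<mu> refl])
    qed measurable
  qed
  then have "(\<lambda>n. S (Suc n) t) \<longlonglongrightarrow> a + b * t + \<eta> * volterra y t"
    unfolding S_Suc[OF t] by (intro tendsto_intros)
  then show "y t = a + b * t + \<eta> * volterra y t"
    using LIMSEQ_Suc[OF S_lim[OF t]] LIMSEQ_unique by blast
qed

text \<open>
  \<open>\<phi> \<psi>' - \<psi> \<phi>' = 1\<close>, where the right derivatives at \<open>l\<close> are written as the integrals that the string equation
  gives for them. Inserting the equations of \<open>\<phi>\<close> and \<open>\<psi>\<close> produces double integrals that cancel after
  exchanging the order of integration.
\<close>
lemma wronskian:
  assumes \<phi>: "bdd_fun \<phi>" and \<psi>: "bdd_fun \<psi>"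
    and \<phi>_eq: "\<And>t. t \<in> {0..l} \<Longrightarrow> \<phi> t = 1 + \<eta> * volterra \<phi> t"
    and \<psi>_eq: "\<And>t. t \<in> {0..l} \<Longrightarrow> \<psi> t = t + \<eta> * volterra \<psi> t"
  shows "\<phi> l * (1 + \<eta> * (\<integral>t. \<psi> t \<partial>\<mu>)) - \<psi> l * (\<eta> * (\<integral>t. \<phi> t \<partial>\<mu>)) = 1"
proof -
  define A B A1 B1 where "A = (\<integral>t. \<phi> t \<partial>\<mu>)" and "B = (\<integral>t. \<psi> t \<partial>\<mu>)"
    and "A1 = (\<integral>t. t * \<phi> t \<partial>\<mu>)" and "B1 = (\<integral>t. t * \<psi> t \<partial>\<mu>)"
  have [measurable]: "\<phi> \<in> borel_measurable borel" "\<psi> \<in> borel_measurable borel" using \<phi> \<psi> by (auto simp: bdd_fun_def)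
  have vol_l: "volterra f l = l * (\<integral>t. f t \<partial>\<mu>) - (\<integral>t. t * f t \<partial>\<mu>)" if f: "bdd_fun f" for f
  proof -
    have [measurable]: "f \<in> borel_measurable borel" using f by (auto simp: bdd_fun_def)
    have "volterra f l = (\<integral>t. l * f t - t * f t \<partial>\<mu>)"
      unfolding volterra_def by (intro integral_cong_supp) (auto simp: algebra_simps)
    then show ?thesis using bdd_fun_integrable[OF f] bdd_fun_integrable[OF bdd_fun_mult[OF bdd_fun_ident f]] by simp
  qed
  define D where "D f g = (\<integral>t. (\<integral>s. g t * (max 0 (t - s) * f s) \<partial>\<mu>) \<partial>\<mu>)" for f g
  have D_eq: "D f g = (\<integral>t. g t * volterra f t \<partial>\<mu>)" for f g by (simp add: D_def volterra_def)
  have bdd_vol: "bdd_fun (\<lambda>t. g t * (\<eta> * volterra f t))" if "bdd_fun g" "bdd_fun h" "bdd_fun k" "\<And>t. t \<in> {0..l} \<Longrightarrow> h t = k t + \<eta> * volterra f t"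
    "f \<in> borel_measurable borel" for f g h k
  proof (rule bdd_fun_cong[OF bdd_fun_mult[OF that(1) bdd_fun_diff[OF that(2,3)]]])
    have [measurable]: "f \<in> borel_measurable borel" "g \<in> borel_measurable borel" using that by (auto simp: bdd_fun_def)
    show "(\<lambda>t. g t * (\<eta> * volterra f t)) \<in> borel_measurable borel" by measurable
  qed (use that in auto)
  have e1: "B = (\<integral>t. \<psi> t * \<phi> t \<partial>\<mu>) - \<eta> * D \<phi> \<psi>"
  proof -
    have "B = (\<integral>t. \<psi> t * \<phi> t - \<psi> t * (\<eta> * volterra \<phi> t) \<partial>\<mu>)"
      unfolding B_def by (intro integral_cong_supp) (auto simp: \<phi>_eq algebra_simps)
    also have "\<dots> = (\<integral>t. \<psi> t * \<phi> t \<partial>\<mu>) - (\<integral>t. \<psi> t * (\<eta> * volterra \<phi> t) \<partial>\<mu>)"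
      by (intro Bochner_Integration.integral_diff bdd_fun_integrable bdd_fun_mult[OF \<psi> \<phi>] bdd_vol[OF \<psi> \<phi> bdd_fun_const \<phi>_eq]) auto
    also have "(\<integral>t. \<psi> t * (\<eta> * volterra \<phi> t) \<partial>\<mu>) = \<eta> * D \<phi> \<psi>"
      by (simp add: D_eq mult.left_commute)
    finally show ?thesis .
  qed
  have e2: "A1 = (\<integral>t. \<psi> t * \<phi> t \<partial>\<mu>) - \<eta> * D \<psi> \<phi>"
  proof -
    have "A1 = (\<integral>t. \<psi> t * \<phi> t - \<phi> t * (\<eta> * volterra \<psi> t) \<partial>\<mu>)"
      unfolding A1_def by (intro integral_cong_supp) (auto simp: \<psi>_eq algebra_simps)
    also have "\<dots> = (\<integral>t. \<psi> t * \<phi> t \<partial>\<mu>) - (\<integral>t. \<phi> t * (\<eta> * volterra \<psi> t) \<partial>\<mu>)"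
      by (intro Bochner_Integration.integral_diff bdd_fun_integrable bdd_fun_mult[OF \<psi> \<phi>] bdd_vol[OF \<phi> \<psi> bdd_fun_ident \<psi>_eq]) auto
    also have "(\<integral>t. \<phi> t * (\<eta> * volterra \<psi> t) \<partial>\<mu>) = \<eta> * D \<psi> \<phi>"
      by (simp add: D_eq mult.left_commute)
    finally show ?thesis .
  qed
  obtain P where P: "0 \<le> P" "\<And>t. t \<in> {0..l} \<Longrightarrow> \<bar>\<phi> t\<bar> \<le> P" using \<phi> by (rule bdd_funE) blast
  obtain Q where Q: "0 \<le> Q" "\<And>t. t \<in> {0..l} \<Longrightarrow> \<bar>\<psi> t\<bar> \<le> Q" using \<psi> by (rule bdd_funE) blast
  have swap: "D \<psi> \<phi> = (\<integral>t. (\<integral>s. \<psi> t * (max 0 (s - t) * \<phi> s) \<partial>\<mu>) \<partial>\<mu>)"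
  proof -
    have "D \<psi> \<phi> = (\<integral>s. (\<integral>t. \<phi> t * (max 0 (t - s) * \<psi> s) \<partial>\<mu>) \<partial>\<mu>)"
      unfolding D_def
    proof (rule fubini[where C = "P * (l * Q)"])
      fix t s assume "t \<in> {0..l}" "s \<in> {0..l}"
      then show "\<bar>\<phi> t * (max 0 (t - s) * \<psi> s)\<bar> \<le> P * (l * Q)"
        unfolding abs_mult using P Q l_pos by (intro mult_mono) auto
    qed measurable
    then show ?thesis by (simp add: mult_ac)
  qed
  have "D \<psi> \<phi> - D \<phi> \<psi> = (\<integral>t. \<psi> t * (A1 - t * A) \<partial>\<mu>)"
  proof -
    have inner: "(\<integral>s. \<psi> t * (max 0 (s - t) * \<phi> s) \<partial>\<mu>) = \<psi> t * (A1 - t * A) + (\<integral>s. \<psi> t * (max 0 (t - s) * \<phi> s) \<partial>\<mu>)" for t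
    proof -
      have "max 0 (s - t) * \<phi> s = (s * \<phi> s - t * \<phi> s) + max 0 (t - s) * \<phi> s" for s
        by (simp add: max_def algebra_simps)
      then have "(\<integral>s. max 0 (s - t) * \<phi> s \<partial>\<mu>) = (A1 - t * A) + (\<integral>s. max 0 (t - s) * \<phi> s \<partial>\<mu>)"
        using bdd_fun_integrable[OF \<phi>] bdd_fun_integrable[OF bdd_fun_mult[OF bdd_fun_ident \<phi>]]
          bdd_fun_integrable[OF bdd_fun_mult[OF bdd_fun_kernel \<phi>]]
        by (simp add: A1_def A_def)
      then show ?thesis by (simp add: distrib_left)
    qed
    have bv: "bdd_fun (\<lambda>t. \<psi> t * volterra \<phi> t)"
    proof (rule bdd_funI)
      fix t assume t: "t \<in> {0..l}"
      have "\<bar>volterra \<phi> t\<bar> \<le> (\<integral>s. \<bar>max 0 (t - s) * \<phi> s\<bar> \<partial>\<mu>)" unfolding volterra_def by (rule integral_abs_bound)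
      also have "\<dots> \<le> (\<integral>s. l * P \<partial>\<mu>)"
      proof (rule integral_mono_supp)
        show "bdd_fun (\<lambda>s. \<bar>max 0 (t - s) * \<phi> s\<bar>)"
          by (rule bdd_fun_cong[OF bdd_fun_mult[OF bdd_fun_kernel \<phi>]]) auto
        fix s assume "s \<in> {0..l}"
        then show "\<bar>max 0 (t - s) * \<phi> s\<bar> \<le> l * P"
          unfolding abs_mult using P t by (intro mult_mono) auto
      qed auto
      finally have "\<bar>volterra \<phi> t\<bar> \<le> mass * (l * P)" by (simp add: mass_def)
      then show "\<bar>\<psi> t * volterra \<phi> t\<bar> \<le> Q * (mass * (l * P))"
        unfolding abs_mult using Q t by (intro mult_mono) auto
    qed measurable
    have "D \<psi> \<phi> = (\<integral>t. \<psi> t * (A1 - t * A) + \<psi> t * volterra \<phi> t \<partial>\<mu>)"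
      unfolding swap inner by (simp add: volterra_def)
    also have "\<dots> = (\<integral>t. \<psi> t * (A1 - t * A) \<partial>\<mu>) + D \<phi> \<psi>"
      unfolding D_eq by (intro Bochner_Integration.integral_add bdd_fun_integrable bv bdd_fun_mult[OF \<psi>] bdd_fun_diff bdd_fun_mult[OF bdd_fun_ident] bdd_fun_const)
    finally show ?thesis by simp
  qed
  also have "\<dots> = (\<integral>t. A1 * \<psi> t - A * (t * \<psi> t) \<partial>\<mu>)" by (simp add: algebra_simps)
  also have "\<dots> = A1 * B - A * B1"
    using bdd_fun_integrable[OF \<psi>] bdd_fun_integrable[OF bdd_fun_mult[OF bdd_fun_ident \<psi>]]
    by (simp add: B_def B1_def)
  finally have D_diff: "D \<psi> \<phi> - D \<phi> \<psi> = A1 * B - A * B1" .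
  have "B - A1 = \<eta> * (D \<psi> \<phi> - D \<phi> \<psi>)" using e1 e2 by (simp add: right_diff_distrib)
  then have key: "B - A1 = \<eta> * (A1 * B - A * B1)" unfolding D_diff .
  have \<phi>l: "\<phi> l = 1 + \<eta> * (l * A - A1)" and \<psi>l: "\<psi> l = l + \<eta> * (l * B - B1)"
    using \<phi>_eq[of l] \<psi>_eq[of l] vol_l[OF \<phi>] vol_l[OF \<psi>] l_pos by (auto simp: A_def A1_def B_def B1_def)
  have "\<phi> l * (1 + \<eta> * B) - \<psi> l * (\<eta> * A) = 1 + \<eta> * (B - A1) - \<eta> * (\<eta> * (A1 * B - A * B1))"
    unfolding \<phi>l \<psi>l by (simp add: algebra_simps)
  also have "\<dots> = 1" unfolding key by simp
  finally show ?thesis by (simp add: A_def B_def)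
qed

end

context interval_mass
begin

lemma integral_restrict:
  fixes f :: "real \<Rightarrow> real"
  assumes [measurable]: "f \<in> borel_measurable borel"
  shows "(\<integral>s. f s \<partial>density \<mu> (\<lambda>s. ennreal (indicator {..x} s))) = (\<integral>s. indicator {..x} s * f s \<partial>\<mu>)"
  by (subst integral_density) auto

lemma interval_mass_restrict:
  assumes "0 < x"
  shows "interval_mass (density \<mu> (\<lambda>s. ennreal (indicator {..x} s))) x"
proof -
  have "emeasure (density \<mu> (\<lambda>s. ennreal (indicator {..x} s))) UNIV = emeasure \<mu> {..x}"
    by (subst emeasure_density) (auto simp: ennreal_indicator)
  then have "finite_measure (density \<mu> (\<lambda>s. ennreal (indicator {..x} s)))"
    by (intro finite_measureI) (simp add: emeasure_eq_measure)
  moreover have "AE t in density \<mu> (\<lambda>s. ennreal (indicator {..x} s)). t \<in> {0..x}"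
    by (subst AE_density, measurable, rule eventually_mono[OF supp]) (auto simp: indicator_def split: if_splits)
  ultimately show ?thesis
    using assms unfolding interval_mass_def interval_mass_axioms_def by simp
qed

end

text \<open>
  The two fundamental solutions of the truncated string at \<open>z = - \<eta>\<close>.
\<close>
locale string_solutions = interval_mass +
  fixes \<eta> :: real and \<phi> \<psi> :: "real \<Rightarrow> real"
  assumes \<eta>_pos: "0 < \<eta>"
    and \<phi>_bdd [intro!]: "bdd_fun \<phi>" and \<psi>_bdd [intro!]: "bdd_fun \<psi>"
    and \<phi>_eq: "\<And>t. t \<in> {0..l} \<Longrightarrow> \<phi> t = 1 + \<eta> * volterra \<phi> t"
    and \<psi>_eq: "\<And>t. t \<in> {0..l} \<Longrightarrow> \<psi> t = t + \<eta> * volterra \<psi> t"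
begin

lemma \<phi>_ge: "t \<in> {0..l} \<Longrightarrow> 1 \<le> \<phi> t"
  by (rule volterra_solution_ge[OF less_imp_le[OF \<eta>_pos] \<phi>_bdd _ \<phi>_eq]) auto

lemma \<psi>_ge: "t \<in> {0..l} \<Longrightarrow> t \<le> \<psi> t"
  by (rule volterra_solution_ge[OF less_imp_le[OF \<eta>_pos] \<psi>_bdd _ \<psi>_eq]) auto

lemma volterra_0:
  assumes [measurable]: "f \<in> borel_measurable borel" shows "volterra f 0 = 0"
proof -
  have "volterra f 0 = (\<integral>s. 0 \<partial>\<mu>)"
    unfolding volterra_def by (intro integral_cong_supp) auto
  then show ?thesis by simp
qed

text \<open>
  The function \<open>D = \<phi>(x) \<psi> - \<psi>(x) \<phi>\<close> vanishes at \<open>x\<close>, and by the Wronskian identity on \<open>[0,x]\<close> its right slope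
  there is \<open>1\<close>. To the right of \<open>x\<close> it therefore solves a Volterra equation with nonnegative inhomogeneity, so it is
  nonnegative, and \<open>D(t) \<ge> 0\<close> is the claim.
\<close>
lemma ratio_antitone:
  assumes x: "0 < x" and t: "t \<in> {x..l}"
  shows "\<phi> t / \<psi> t \<le> \<phi> x / \<psi> x"
proof -
  have xl: "x \<in> {0..l}" using x t by simp
  have [measurable]: "\<phi> \<in> borel_measurable borel" "\<psi> \<in> borel_measurable borel" using \<phi>_bdd \<psi>_bdd by (auto simp: bdd_fun_def)
  interpret R: interval_mass "density \<mu> (\<lambda>s. ennreal (indicator {..x} s))" x
    by (rule interval_mass_restrict[OF x])
  have R_bdd: "R.bdd_fun f" if "bdd_fun f" for f
    using that xl unfolding R.bdd_fun_def bdd_fun_def by force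
  have R_vol: "R.volterra f r = volterra f r" if "f \<in> borel_measurable borel" "r \<in> {0..x}" for f r
  proof -
    have [measurable]: "f \<in> borel_measurable borel" by fact
    have "R.volterra f r = (\<integral>s. indicator {..x} s * (max 0 (r - s) * f s) \<partial>\<mu>)"
      unfolding R.volterra_def by (rule integral_restrict) measurable
    also have "\<dots> = volterra f r"
      unfolding volterra_def using that by (intro Bochner_Integration.integral_cong) (auto simp: indicator_def)
    finally show ?thesis .
  qed
  have W: "\<phi> x * (1 + \<eta> * (\<integral>s. indicator {..x} s * \<psi> s \<partial>\<mu>)) - \<psi> x * (\<eta> * (\<integral>s. indicator {..x} s * \<phi> s \<partial>\<mu>)) = 1"
    using R.wronskian[OF R_bdd[OF \<phi>_bdd] R_bdd[OF \<psi>_bdd], of \<eta>] R_vol \<phi>_eq \<psi>_eq xl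
    by (simp add: integral_restrict)
  define D where "D r = \<phi> x * \<psi> r + (- \<psi> x) * \<phi> r" for r
  have D_bdd: "bdd_fun D" unfolding D_def by (intro bdd_fun_add bdd_fun_mult bdd_fun_const \<phi>_bdd \<psi>_bdd)
  have [measurable]: "D \<in> borel_measurable borel" using D_bdd by (simp add: bdd_fun_def)
  have D_eq: "D r = \<phi> x * r - \<psi> x + \<eta> * volterra D r" if "r \<in> {0..l}" for r
  proof -
    have vD: "volterra D r = \<phi> x * volterra \<psi> r + (- \<psi> x) * volterra \<phi> r"
      unfolding D_def[abs_def] by (rule volterra_linear) auto
    show ?thesis unfolding vD unfolding D_def \<phi>_eq[OF that] \<psi>_eq[OF that] by (simp add: algebra_simps)
  qed
  have D_x: "D x = 0" by (simp add: D_def)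
  define E where "E r = indicator {x..} r * D r" for r
  have [measurable]: "E \<in> borel_measurable borel" unfolding E_def by measurable
  have E_bdd: "bdd_fun E"
    by (rule bdd_fun_cong[OF D_bdd]) (auto simp: E_def indicator_def)
  have F_bdd: "bdd_fun (\<lambda>s. indicator {..x} s * f s)" if "bdd_fun f" for f
  proof -
    have [measurable]: "f \<in> borel_measurable borel" using that by (simp add: bdd_fun_def)
    show ?thesis by (rule bdd_fun_cong[OF that]) (auto simp: indicator_def)
  qed
  define c where "c = (\<integral>s. indicator {..x} s * D s \<partial>\<mu>)"
  \<comment> \<open>The slope of \<open>D\<close> to the right of its zero \<open>x\<close> is the Wronskian.\<close>
  have slope: "\<phi> x + \<eta> * c = 1"
  proof -
    have "c = (\<integral>s. \<phi> x * (indicator {..x} s * \<psi> s) - \<psi> x * (indicator {..x} s * \<phi> s) \<partial>\<mu>)"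
      unfolding c_def D_def by (simp add: algebra_simps)
    also have "\<dots> = \<phi> x * (\<integral>s. indicator {..x} s * \<psi> s \<partial>\<mu>) - \<psi> x * (\<integral>s. indicator {..x} s * \<phi> s \<partial>\<mu>)"
      using bdd_fun_integrable[OF F_bdd[OF \<phi>_bdd]] bdd_fun_integrable[OF F_bdd[OF \<psi>_bdd]] by simp
    finally have c_eq: "c = \<phi> x * (\<integral>s. indicator {..x} s * \<psi> s \<partial>\<mu>) - \<psi> x * (\<integral>s. indicator {..x} s * \<phi> s \<partial>\<mu>)" .
    show ?thesis unfolding c_eq using W by (simp only: algebra_simps)
  qed
  have split: "volterra D r = volterra E r + max 0 (r - x) * c + volterra D x" if r: "r \<in> {x..}" for r
  proof -
    have eq: "max 0 (r - s) * D s = max 0 (r - s) * E s + max 0 (r - x) * (indicator {..x} s * D s) + max 0 (x - s) * D s" for s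
      using r D_x by (cases s x rule: linorder_cases) (auto simp: E_def algebra_simps)
    show ?thesis
      unfolding volterra_def eq c_def
      using bdd_fun_integrable[OF bdd_fun_mult[OF bdd_fun_kernel E_bdd]] bdd_fun_integrable[OF F_bdd[OF D_bdd]]
        bdd_fun_integrable[OF bdd_fun_mult[OF bdd_fun_kernel D_bdd]]
      by simp
  qed
  have E_eq: "E r = max 0 (r - x) + \<eta> * volterra E r" if r: "r \<in> {0..l}" for r
  proof (cases "x \<le> r")
    case True
    have "\<phi> x * x - \<psi> x + \<eta> * volterra D x = 0" using D_eq[OF xl] D_x by simp
    then have "D r = (r - x) * (\<phi> x + \<eta> * c) + \<eta> * volterra E r"
      using D_eq[OF r] split[of r] True by (simp add: algebra_simps)
    then show ?thesis using True by (simp add: slope E_def)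
  next
    case False
    have "volterra E r = (\<integral>s. 0 \<partial>\<mu>)"
      unfolding volterra_def using False by (intro Bochner_Integration.integral_cong) (auto simp: E_def indicator_def)
    then show ?thesis using False by (simp add: E_def)
  qed
  have "max 0 (t - x) \<le> E t"
    using volterra_solution_ge[OF _ E_bdd _ E_eq, of t] \<eta>_pos t x by simp
  then have "0 \<le> D t" using t by (simp add: E_def)
  moreover have "0 < \<psi> x" "0 < \<psi> t" using \<psi>_ge[of x] \<psi>_ge[of t] x t by auto
  ultimately show ?thesis by (simp add: D_def field_simps)
qed

text \<open>
  The coefficient for which \<open>\<phi> - weyl * \<psi>\<close> satisfies the Dirichlet condition at \<open>l\<close>.
\<close>
definition weyl :: real where "weyl = \<phi> l / \<psi> l"

definition u :: "real \<Rightarrow> real" where "u t = \<phi> t - weyl * \<psi> t"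

lemma u_bdd [intro!]: "bdd_fun u"
  unfolding u_def by (intro bdd_fun_diff bdd_fun_mult bdd_fun_const \<phi>_bdd \<psi>_bdd)

lemma \<psi>_l_pos: "0 < \<psi> l" using \<psi>_ge[of l] l_pos by simp

lemma u_volterra: "t \<in> {0..l} \<Longrightarrow> u t = 1 - weyl * t + \<eta> * volterra u t"
proof -
  assume t: "t \<in> {0..l}"
  have "volterra u t = 1 * volterra \<phi> t + (- weyl) * volterra \<psi> t"
    using volterra_linear[OF \<phi>_bdd \<psi>_bdd, of 1 "- weyl" t] by (simp add: u_def[abs_def])
  then show ?thesis by (simp only: u_def[of t] \<phi>_eq[OF t] \<psi>_eq[OF t]) (simp add: algebra_simps)
qed

lemma volterra_l: assumes [measurable]: "f \<in> borel_measurable borel" shows "volterra f l = l * ip e f"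
proof -
  have [measurable]: "e \<in> borel_measurable borel" using bdd_fun_e by (simp add: bdd_fun_def)
  have "volterra f l = (\<integral>s. l * (e s * f s) \<partial>\<mu>)"
    unfolding volterra_def using l_pos by (intro integral_cong_supp) (auto simp: e_def field_simps)
  then show ?thesis by (simp add: ip_def)
qed

text \<open>
  The equation \<open>u l = 0\<close>, solved for the coefficient of the linear term.
\<close>
lemma weyl_eq: "weyl = 1 / l + \<eta> * ip e u"
proof -
  have [measurable]: "u \<in> borel_measurable borel" using u_bdd by (simp add: bdd_fun_def)
  have "u l = 0" using \<psi>_l_pos by (simp add: u_def weyl_def)
  then have "weyl * l = 1 + \<eta> * (l * ip e u)"
    using u_volterra[of l] volterra_l[of u] l_pos by simp
  then show ?thesis using l_pos by (simp add: field_simps)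
qed

text \<open>
  Eliminating the coefficient \<open>weyl\<close> with the help of \<open>weyl_eq\<close> turns the initial value problem into a boundary value problem,
  and the Volterra kernel into the Green kernel: \<open>max 0 (t - s) = t (1 - s/l) - green l t s\<close>.
\<close>
lemma u_eq: assumes t: "t \<in> {0..l}" shows "u t = e t - \<eta> * K u t"
proof -
  have [measurable]: "u \<in> borel_measurable borel" "e \<in> borel_measurable borel" using u_bdd bdd_fun_e by (auto simp: bdd_fun_def)
  have "K u t = (\<integral>s. t * (e s * u s) - max 0 (t - s) * u s \<partial>\<mu>)"
    unfolding K_def
  proof (intro integral_cong_supp)
    fix s assume "s \<in> {0..l}"
    then have "green l t s = t * e s - max 0 (t - s)"
      using t l_pos by (simp add: green_def e_def min_def max_def field_simps)
    then show "green l t s * u s = t * (e s * u s) - max 0 (t - s) * u s"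
      by (simp only: left_diff_distrib mult.assoc)
  qed measurable
  also have "\<dots> = t * ip e u - volterra u t"
    using bdd_fun_integrable[OF bdd_fun_mult[OF bdd_fun_e u_bdd]] bdd_fun_integrable[OF bdd_fun_mult[OF bdd_fun_kernel u_bdd]]
    by (simp add: ip_def volterra_def)
  finally have Ku: "K u t = t * ip e u - volterra u t" .
  have "u t = 1 - (1 / l + \<eta> * ip e u) * t + \<eta> * volterra u t"
    using u_volterra[OF t] unfolding weyl_eq .
  then show ?thesis unfolding Ku e_def by (simp add: algebra_simps)
qed

lemma u_nonneg: assumes t: "t \<in> {0..l}" shows "0 \<le> u t"
proof (cases "t = 0")
  case True
  then show ?thesis using u_volterra[OF t] volterra_0[of u] u_bdd by (simp add: bdd_fun_def)
next
  case False
  then have "weyl \<le> \<phi> t / \<psi> t" unfolding weyl_def using t by (intro ratio_antitone) auto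
  moreover have "0 < \<psi> t" using \<psi>_ge[OF t] t False by auto
  ultimately show ?thesis by (simp add: u_def field_simps)
qed

text \<open>
  The resolvent moments \<open>\<langle>K\<^sup>n e, (1 + \<eta> K)\<inverse> e\<rangle>\<close>, that is, \<open>\<integral> \<lambda>\<^sup>n / (1 + \<eta> \<lambda>)\<close> with respect to the spectral measure of \<open>e\<close>.
\<close>
definition rho :: "nat \<Rightarrow> real" where "rho n = ip (iter n) u"

lemma rho_rec: "\<eta> * rho (Suc n) = moment n - rho n"
proof -
  have "\<eta> * rho (Suc n) = \<eta> * ip (iter n) (K u)"
    unfolding rho_def using ip_K_commute[OF bdd_fun_iter u_bdd, of n] by simp
  also have "\<dots> = ip (iter n) (\<lambda>t. \<eta> * K u t)" by (simp add: ip_def mult.left_commute)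
  also have "\<dots> = ip (iter n) (\<lambda>t. e t - u t)"
  proof (rule ip_cong)
    fix t assume "t \<in> {0..l}"
    then have "u t = e t - \<eta> * K u t" by (rule u_eq)
    then have "\<eta> * K u t = e t - u t" by linarith
    then show "iter n t * (\<eta> * K u t) = iter n t * (e t - u t)" by (simp only:)
  qed (intro bdd_fun_mult bdd_fun_diff bdd_fun_K bdd_fun_const bdd_fun_iter u_bdd bdd_fun_e)+
  also have "\<dots> = moment n - rho n"
    unfolding rho_def moment_def by (rule ip_diff_right[OF bdd_fun_e u_bdd bdd_fun_iter])
  finally show ?thesis .
qed

lemma rho_nonneg: "0 \<le> rho n"
  unfolding rho_def ip_def by (intro integral_nonneg_supp mult_nonneg_nonneg iter_nonneg u_nonneg)

lemma rho_le_moment: "rho n \<le> moment n"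
  using rho_rec[of n] mult_nonneg_nonneg[OF less_imp_le[OF \<eta>_pos] rho_nonneg[of "Suc n"]] by linarith

lemma weyl_rho: "weyl = 1 / l + \<eta> * rho 0"
  using weyl_eq by (simp add: rho_def)

end

section \<open>Solutions of the string equation\<close>

locale krein_string =
  fixes M :: "ennreal \<Rightarrow> ennreal"
  assumes krein: "M \<in> krein_strings"
begin

definition inside :: "real \<Rightarrow> bool" where
  "inside x \<longleftrightarrow> 0 \<le> x \<and> ennreal x < string_length M"

definition mass_upto :: "real \<Rightarrow> real" where "mass_upto x = enn2real (M (ennreal x))"

lemma M_mono: "a \<le> b \<Longrightarrow> M a \<le> M b"
  using krein by (auto simp: krein_strings_def mono_def)

lemma inside_finite: assumes "inside x" shows "M (ennreal x) < \<top>"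
proof -
  obtain y where "y \<in> {x. x < \<infinity> \<and> M x < \<infinity>}" "ennreal x < y"
    using assms unfolding inside_def string_length_def by (auto simp: less_Sup_iff)
  then have "M (ennreal x) \<le> M y" "M y < \<top>" using M_mono[of "ennreal x" y] by auto
  then show ?thesis by (rule le_less_trans)
qed

lemma inside_le: "inside y \<Longrightarrow> 0 \<le> x \<Longrightarrow> x \<le> y \<Longrightarrow> inside x"
  unfolding inside_def by (auto intro: le_less_trans ennreal_leI)

lemma inside_nonneg: "inside x \<Longrightarrow> 0 \<le> x"
  by (simp add: inside_def)

lemma ennreal_mass_upto: "inside x \<Longrightarrow> ennreal (mass_upto x) = M (ennreal x)"
  using inside_finite[of x] by (simp add: mass_upto_def)

lemma mass_upto_mono: "inside y \<Longrightarrow> 0 \<le> x \<Longrightarrow> x \<le> y \<Longrightarrow> mass_upto x \<le> mass_upto y"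
  unfolding mass_upto_def using inside_finite[of y] M_mono[of "ennreal x" "ennreal y"]
  by (intro enn2real_mono) (auto intro: ennreal_leI)

lemma mass_upto_nonneg: "0 \<le> mass_upto x" by (simp add: mass_upto_def)

text \<open>
  The distribution function of the truncated measure \<open>dM M b\<close>.
\<close>
definition trunc_cdf :: "real \<Rightarrow> real \<Rightarrow> real" where
  "trunc_cdf b t = (if t < 0 then 0 else mass_upto (min t b))"

lemma dM_eq: "dM M b = interval_measure (trunc_cdf b)"
  unfolding dM_def trunc_cdf_def mass_upto_def by (rule arg_cong[of _ _ interval_measure]) auto

lemma trunc_cdf_mono: assumes "inside b" "s \<le> t" shows "trunc_cdf b s \<le> trunc_cdf b t"
  using assms mass_upto_nonneg inside_nonneg[of b] unfolding trunc_cdf_def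
  by (auto intro!: mass_upto_mono intro: inside_le[of b])

lemma mass_upto_right_cont: assumes "inside t" shows "(mass_upto \<longlongrightarrow> mass_upto t) (at_right t)"
proof -
  have "continuous (at_right (ennreal t)) M" using krein by (simp add: krein_strings_def)
  then have M_lim: "(M \<longlongrightarrow> M (ennreal t)) (at_right (ennreal t))"
    by (simp add: continuous_within)
  have "filterlim ennreal (at_right (ennreal t)) (at_right t)"
    unfolding filterlim_at
  proof (intro conjI)
    show "\<forall>\<^sub>F s in at_right t. ennreal s \<in> {ennreal t<..} \<and> ennreal s \<noteq> ennreal t"
      using assms by (auto simp: eventually_at_filter inside_def ennreal_less_iff)
    show "(ennreal \<longlongrightarrow> ennreal t) (at_right t)"
      by (intro tendsto_ennrealI) (simp add: tendsto_ident_at)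
  qed
  then have "((\<lambda>s. M (ennreal s)) \<longlongrightarrow> M (ennreal t)) (at_right t)"
    by (rule filterlim_compose[OF M_lim])
  then show ?thesis
    unfolding mass_upto_def using inside_finite[OF assms] by (intro tendsto_enn2real) auto
qed

lemma trunc_cdf_right_cont: assumes "inside b" shows "continuous (at_right t) (trunc_cdf b)"
proof -
  have "(trunc_cdf b \<longlongrightarrow> trunc_cdf b t) (at_right t)"
  proof -
    consider "t < 0" | "0 \<le> t" "t < b" | "0 \<le> t" "b \<le> t" by linarith
    then show ?thesis
    proof cases
      case 1
      then have "\<forall>\<^sub>F s in at_right t. s < 0" by (auto simp: eventually_at_right_field)
      then have "\<forall>\<^sub>F s in at_right t. trunc_cdf b s = trunc_cdf b t"
        by eventually_elim (use 1 in \<open>simp add: trunc_cdf_def\<close>)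
      then show ?thesis by (rule tendsto_eventually)
    next
      case 2
      then have "\<forall>\<^sub>F s in at_right t. s < b \<and> t < s"
        by (auto simp: eventually_at_right_field)
      then have *: "\<forall>\<^sub>F s in at_right t. trunc_cdf b s = mass_upto s"
        by eventually_elim (use 2 in \<open>simp add: trunc_cdf_def\<close>)
      have "inside t" using inside_le[OF assms] 2 by simp
      then have "(mass_upto \<longlongrightarrow> trunc_cdf b t) (at_right t)"
        using mass_upto_right_cont[of t] 2 by (simp add: trunc_cdf_def)
      then show ?thesis by (subst tendsto_cong[OF *])
    next
      case 3
      then have "\<forall>\<^sub>F s in at_right t. t < s" by (simp add: eventually_at_right_less)
      then have "\<forall>\<^sub>F s in at_right t. trunc_cdf b s = trunc_cdf b t"
        by eventually_elim (use 3 in \<open>simp add: trunc_cdf_def min_def\<close>)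
      then show ?thesis by (rule tendsto_eventually)
    qed
  qed
  then show ?thesis by (simp add: continuous_within)
qed

lemma trunc_cdf_at_bot: "(trunc_cdf b \<longlongrightarrow> 0) at_bot"
proof (rule tendsto_eventually)
  show "\<forall>\<^sub>F t in at_bot. trunc_cdf b t = 0"
    using eventually_le_at_bot[of "-1"] by eventually_elim (simp add: trunc_cdf_def)
qed

lemma trunc_cdf_at_top: assumes "inside b" shows "(trunc_cdf b \<longlongrightarrow> mass_upto b) at_top"
proof (rule tendsto_eventually)
  show "\<forall>\<^sub>F t in at_top. trunc_cdf b t = mass_upto b"
    using eventually_ge_at_top[of b]
    by eventually_elim (use inside_nonneg[OF assms] in \<open>simp add: trunc_cdf_def min_def\<close>)
qed

lemma finite_borel_dM: assumes "inside b" shows "finite_borel_measure (dM M b)"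
  unfolding dM_eq
  by (rule finite_borel_measure_interval_measure[OF trunc_cdf_mono[OF assms] trunc_cdf_right_cont[OF assms] trunc_cdf_at_bot trunc_cdf_at_top[OF assms] mass_upto_nonneg])

lemma sets_dM [simp, measurable_cong]: "sets (dM M b) = sets borel" by (simp add: dM_eq)
lemma space_dM [simp]: "space (dM M b) = UNIV" by (simp add: dM_eq)

lemma cdf_dM: "inside b \<Longrightarrow> measure (dM M b) {..t} = trunc_cdf b t"
  unfolding dM_eq by (rule measure_interval_measure_Iic[OF trunc_cdf_mono trunc_cdf_right_cont trunc_cdf_at_bot])

lemma dM_Ioc:
  assumes "inside b" "0 \<le> s" "s \<le> t" "t \<le> b"
  shows "measure (dM M b) {s<..t} = mass_upto t - mass_upto s"
proof -
  have "measure (dM M b) {s<..t} = trunc_cdf b t - trunc_cdf b s"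
    unfolding dM_eq by (rule measure_interval_measure_Ioc[OF \<open>s \<le> t\<close> trunc_cdf_mono[OF assms(1)] trunc_cdf_right_cont[OF assms(1)]])
  then show ?thesis using assms by (simp add: trunc_cdf_def)
qed

lemma dM_UNIV: assumes "inside b" shows "measure (dM M b) UNIV = mass_upto b"
proof -
  have "emeasure (dM M b) UNIV = ennreal (mass_upto b)"
    unfolding dM_eq
    by (rule interval_measure_UNIV[OF trunc_cdf_mono[OF assms] trunc_cdf_right_cont[OF assms] trunc_cdf_at_bot trunc_cdf_at_top[OF assms] mass_upto_nonneg])
  then show ?thesis by (simp add: measure_def mass_upto_nonneg)
qed

lemma dM_supp: assumes "inside b" shows "AE t in dM M b. t \<in> {0..b}"
proof -
  interpret finite_borel_measure "dM M b" by (rule finite_borel_dM[OF assms])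
  have b: "0 \<le> b" using assms by (rule inside_nonneg)
  have "measure (dM M b) {..<0} = 0"
  proof -
    have "measure (dM M b) {..<0} = measure (dM M b) (\<Union>n. {..- 1 / Suc n})"
    proof (rule arg_cong[of _ _ "measure (dM M b)"], intro equalityI subsetI)
      fix t :: real assume "t \<in> {..<0}"
      then obtain n where "1 / real (Suc n) < - t" using nat_approx_posE[of "- t"] by auto
      then show "t \<in> (\<Union>n. {..- 1 / Suc n})" by (intro UN_I[of n]) auto
    qed (auto, smt (verit) divide_minus_left divide_pos_pos of_nat_0_le_iff)
    moreover have "emeasure (dM M b) (\<Union>n. {..- 1 / Suc n}) = 0"
    proof (rule emeasure_UN_eq_0)
      fix n
      have "measure (dM M b) {..- 1 / real (Suc n)} = 0"
        unfolding cdf_dM[OF assms] by (simp add: trunc_cdf_def)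
      then show "emeasure (dM M b) {..- 1 / Suc n} = 0" by (simp add: emeasure_eq_measure)
    qed auto
    ultimately show ?thesis by (simp add: measure_def)
  qed
  moreover have "measure (dM M b) {b<..} = 0"
  proof -
    have "measure (dM M b) UNIV = measure (dM M b) {..b} + measure (dM M b) {b<..}"
      by (subst finite_measure_Union[symmetric]) (auto intro: arg_cong[of _ _ "measure (dM M b)"])
    then show ?thesis using b by (simp add: dM_UNIV[OF assms] cdf_dM[OF assms] trunc_cdf_def)
  qed
  ultimately have "{..<0} \<in> null_sets (dM M b)" "{b<..} \<in> null_sets (dM M b)"
    by (auto simp: null_sets_def emeasure_eq_measure)
  then have "AE t in dM M b. t \<notin> {..<0}" "AE t in dM M b. t \<notin> {b<..}" by (auto dest: AE_not_in)
  then show ?thesis by eventually_elim auto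
qed

lemma interval_mass_dM: "inside x \<Longrightarrow> 0 < x \<Longrightarrow> interval_mass (dM M x) x"
  using finite_borel_dM[of x] dM_supp[of x]
  by (auto simp: interval_mass_def interval_mass_axioms_def finite_borel_measure_def)

text \<open>
  Truncations at different points are compatible, which allows them to be compared inside the largest one.
\<close>
lemma dM_restrict:
  assumes y: "inside y" and x: "0 \<le> x" "x \<le> y"
  shows "dM M x = density (dM M y) (\<lambda>s. ennreal (indicator {..x} s))"
proof (rule cdf_unique')
  interpret Y: finite_borel_measure "dM M y" by (rule finite_borel_dM[OF y])
  have ix: "inside x" using inside_le[OF y x] .
  let ?N = "density (dM M y) (\<lambda>s. ennreal (indicator {..x} s))"
  have N: "emeasure ?N A = emeasure (dM M y) ({..x} \<inter> A)" if "A \<in> sets borel" for A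
    using that by (subst emeasure_density) (auto simp: ennreal_indicator indicator_inter_arith[symmetric])
  show "finite_borel_measure (dM M x)" by (rule finite_borel_dM[OF ix])
  have "finite_measure ?N" by (rule finite_measureI) (simp add: N Y.emeasure_eq_measure)
  then show "finite_borel_measure ?N" by (simp add: finite_borel_measure_def finite_borel_measure_axioms_def)
  show "cdf (dM M x) = cdf ?N"
  proof
    fix t
    have "{..x} \<inter> {..t} = {..min x t}" by auto
    then have "cdf ?N t = measure (dM M y) {..min x t}" by (simp add: cdf_def measure_def N)
    also have "\<dots> = trunc_cdf x t" unfolding cdf_dM[OF y] using x by (auto simp: trunc_cdf_def min_def)
    finally show "cdf (dM M x) t = cdf ?N t" by (simp add: cdf_def cdf_dM[OF ix])
  qed
qed

end

lemma (in interval_mass) integral_restrict_mono: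
  assumes f: "bdd_fun f" and g: "bdd_fun g" "\<And>s. s \<in> {0..l} \<Longrightarrow> 0 \<le> g s"
    and le: "\<And>s. s \<in> {0..x} \<Longrightarrow> f s \<le> g s"
  shows "(\<integral>s. f s \<partial>density \<mu> (\<lambda>s. ennreal (indicator {..x} s))) \<le> (\<integral>s. g s \<partial>\<mu>)"
proof -
  have [measurable]: "f \<in> borel_measurable borel" using f by (simp add: bdd_fun_def)
  have "(\<integral>s. indicator {..x} s * f s \<partial>\<mu>) \<le> (\<integral>s. g s \<partial>\<mu>)"
  proof (rule integral_mono_supp)
    show "bdd_fun (\<lambda>s. indicator {..x} s * f s)"
      by (rule bdd_fun_cong[OF f]) (auto simp: indicator_def)
  qed (use g le in \<open>auto simp: indicator_def\<close>)
  then show ?thesis by (simp add: integral_restrict)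
qed

lemma green_mono:
  assumes "0 < x" "x \<le> y" "t \<in> {0..x}" "s \<in> {0..x}"
  shows "green x t s \<le> green y t s"
  unfolding green_def using assms by (intro mult_left_mono diff_left_mono divide_left_mono) auto

context krein_string
begin

lemma inside_extend: assumes "inside x" obtains y where "x < y" "inside y"
proof -
  obtain z where z: "ennreal x < z" "z < string_length M"
    using assms dense[of "ennreal x" "string_length M"] by (auto simp: inside_def)
  have "z < \<top>" using z(2) by (auto intro: less_le_trans)
  then obtain r where "z = ennreal r" "0 \<le> r" by (cases z) auto
  with z assms show thesis
    by (intro that[of r]) (auto simp: inside_def ennreal_less_iff)
qed

lemma set_integral_eq_volterra:
  fixes f :: "real \<Rightarrow> real"
  assumes X: "inside X" "0 < X" and t: "t \<in> {0..X}"
    and f[measurable]: "(\<lambda>s. indicator {0..X} s * f s) \<in> borel_measurable borel"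
  shows "(LINT s:{0..t}|dM M t. (t - s) * f s) = interval_mass.volterra (dM M X) (\<lambda>s. indicator {0..X} s * f s) t"
proof -
  interpret X: interval_mass "dM M X" X by (rule interval_mass_dM[OF X])
  have eq: "(\<lambda>s. indicator {0..t} s *\<^sub>R ((t - s) * f s)) = (\<lambda>s. indicator {0..t} s * ((t - s) * (indicator {0..X} s * f s)))"
    using t by (auto simp: indicator_def fun_eq_iff)
  have dMt: "dM M t = density (dM M X) (\<lambda>s. ennreal (indicator {..t} s))"
    using t by (intro dM_restrict X) auto
  have "(LINT s:{0..t}|dM M t. (t - s) * f s)
      = (\<integral>s. indicator {..t} s * (indicator {0..t} s * ((t - s) * (indicator {0..X} s * f s))) \<partial>dM M X)"
    unfolding set_lebesgue_integral_def eq dMt by (rule X.integral_restrict) measurable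
  also have "\<dots> = X.volterra (\<lambda>s. indicator {0..X} s * f s) t"
    unfolding X.volterra_def
  proof (rule X.integral_cong_supp)
    fix s assume "s \<in> {0..X}"
    then show "indicator {..t} s * (indicator {0..t} s * ((t - s) * (indicator {0..X} s * f s)))
        = max 0 (t - s) * (indicator {0..X} s * f s)"
      by (cases "s \<le> t") auto
  qed measurable
  finally show ?thesis .
qed

text \<open>
  A solution is only known to be integrable against \<open>(x - t) dM\<close>, a weight that vanishes at the endpoint. Applied on a
  slightly longer interval \<open>[0,Y]\<close>, whose weight is at least \<open>Y - X\<close> on \<open>[0,X]\<close>, this gives integrability on
  \<open>[0,X]\<close>, and then the equation itself gives boundedness.
\<close>
lemma string_solution_volterra:
  assumes sol: "string_solution M (- \<eta>) a b y" and X: "inside X" "0 < X"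
  defines "f \<equiv> \<lambda>s. indicator {0..X} s * y s"
  shows "interval_mass.bdd_fun X f"
    and "\<And>t. t \<in> {0..X} \<Longrightarrow> f t = a + b * t + \<eta> * interval_mass.volterra (dM M X) f t"
proof -
  obtain Y where Y: "X < Y" "inside Y" by (rule inside_extend[OF X(1)])
  interpret X: interval_mass "dM M X" X by (rule interval_mass_dM[OF X])
  interpret Y: interval_mass "dM M Y" Y using X Y by (intro interval_mass_dM) auto
  have sol_conj: "set_integrable (dM M x) {0..x} (\<lambda>t. (x - t) * y t)
      \<and> y x = a + b * x - - \<eta> * (LINT t:{0..x}|dM M x. (x - t) * y t)" if "inside x" for x
    using sol that unfolding string_solution_def inside_def by blast
  have sol'_int: "set_integrable (dM M x) {0..x} (\<lambda>t. (x - t) * y t)" if "inside x" for x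
    using sol_conj[OF that] by blast
  have sol'_eq: "y x = a + b * x + \<eta> * (LINT t:{0..x}|dM M x. (x - t) * y t)" if "inside x" for x
    by (rule trans[OF conjunct2[OF sol_conj[OF that]]]) simp
  define g where "g s = indicator {0..Y} s * ((Y - s) * y s)" for s
  have g_int: "integrable (dM M Y) g"
    using sol'_int[OF Y(2)] by (simp add: set_integrable_def g_def[abs_def])
  then have [measurable]: "g \<in> borel_measurable borel"
    using borel_measurable_integrable[OF g_int] by simp
  have "f = (\<lambda>s. indicator {0..X} s * (g s / (Y - s)))"
    using Y X by (auto simp: f_def g_def indicator_def fun_eq_iff)
  then have f_meas[measurable]: "f \<in> borel_measurable borel" by simp
  have f_eq: "f t = a + b * t + \<eta> * X.volterra f t" if t: "t \<in> {0..X}" for t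
  proof -
    have "inside t" using inside_le[OF X(1)] t by simp
    have "(LINT s:{0..t}|dM M t. (t - s) * y s) = X.volterra f t"
      unfolding f_def by (rule set_integral_eq_volterra[OF X t f_meas[unfolded f_def]])
    then have "y t = a + b * t + \<eta> * X.volterra f t"
      using sol'_eq[OF \<open>inside t\<close>] by (simp only:)
    moreover have "f t = y t" using t by (simp add: f_def)
    ultimately show ?thesis by (simp only:)
  qed
  show "X.bdd_fun f"
  proof (rule X.bdd_funI[OF f_meas])
    fix t assume t: "t \<in> {0..X}"
    have "\<bar>X.volterra f t\<bar> \<le> (\<integral>s. \<bar>g s\<bar> \<partial>dM M Y)"
    proof -
      have dMX: "dM M X = density (dM M Y) (\<lambda>s. ennreal (indicator {..X} s))"
        using X Y by (intro dM_restrict) auto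
      have "X.volterra f t = (\<integral>s. max 0 (t - s) * f s \<partial>dM M X)" by (rule X.volterra_def)
      also have "\<dots> = (\<integral>s. indicator {..X} s * (max 0 (t - s) * f s) \<partial>dM M Y)"
        unfolding dMX by (rule Y.integral_restrict) measurable
      also have "\<bar>\<dots>\<bar> \<le> (\<integral>s. \<bar>g s\<bar> \<partial>dM M Y)"
      proof (rule order_trans[OF integral_abs_bound integral_mono'])
        show "integrable (dM M Y) (\<lambda>s. \<bar>g s\<bar>)" using g_int by (rule integrable_abs)
        fix s
        show "\<bar>indicator {..X} s * (max 0 (t - s) * f s)\<bar> \<le> \<bar>g s\<bar>"
        proof (cases "s \<in> {0..X}")
          case True
          have "max 0 (t - s) * \<bar>y s\<bar> \<le> (Y - s) * \<bar>y s\<bar>" using True t Y by (intro mult_right_mono) auto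
          then show ?thesis using True Y by (simp add: f_def g_def abs_mult)
        qed (simp add: f_def)
      qed auto
      finally show ?thesis .
    qed
    then have "\<bar>\<eta> * X.volterra f t\<bar> \<le> \<bar>\<eta>\<bar> * (\<integral>s. \<bar>g s\<bar> \<partial>dM M Y)"
      unfolding abs_mult by (rule mult_left_mono) simp
    moreover have "\<bar>b * t\<bar> \<le> \<bar>b\<bar> * X" unfolding abs_mult using t by (intro mult_left_mono) auto
    ultimately show "\<bar>f t\<bar> \<le> \<bar>a\<bar> + \<bar>b\<bar> * X + \<bar>\<eta>\<bar> * (\<integral>s. \<bar>g s\<bar> \<partial>dM M Y)"
      unfolding f_eq[OF t] by linarith
  qed
  show "f t = a + b * t + \<eta> * X.volterra f t" if "t \<in> {0..X}" for t using f_eq[OF that] .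
qed

primrec picard :: "real \<Rightarrow> real \<Rightarrow> real \<Rightarrow> nat \<Rightarrow> real \<Rightarrow> real" where
  "picard \<eta> a b 0 x = a + b * x"
| "picard \<eta> a b (Suc n) x = a + b * x + \<eta> * (LINT s:{0..x}|dM M x. (x - s) * picard \<eta> a b n s)"

text \<open>
  The Picard iterates are defined on the whole string at once, so the limits on different pieces agree and no gluing is
  necessary.
\<close>
lemma string_solution_exists:
  assumes "0 \<le> \<eta>" "0 \<le> a" "0 \<le> b"
  shows "\<exists>y. string_solution M (- \<eta>) a b y"
proof
  let ?y = "\<lambda>x. lim (\<lambda>n. picard \<eta> a b n x)"
  have X_facts: "interval_mass.bdd_fun X (\<lambda>t. indicator {0..X} t * ?y t) \<and>
     (\<forall>t\<in>{0..X}. ?y t = a + b * t + \<eta> * interval_mass.volterra (dM M X) (\<lambda>t. indicator {0..X} t * ?y t) t)"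
    if X: "inside X" "0 < X" for X
  proof -
    interpret X: interval_mass "dM M X" X by (rule interval_mass_dM[OF X])
    define S where "S = picard \<eta> a b"
    have rec: "S (Suc n) t = a + b * t + \<eta> * X.volterra (\<lambda>s. indicator {0..X} s * S n s) t"
      if "t \<in> {0..X}" "(\<lambda>s. indicator {0..X} s * S n s) \<in> borel_measurable borel" for n t
      unfolding S_def picard.simps using set_integral_eq_volterra[OF X that(1), of "picard \<eta> a b n"] that(2)
      by (simp add: S_def)
    have meas: "(\<lambda>s. indicator {0..X} s * S n s) \<in> borel_measurable borel" for n
    proof (induction n)
      case 0
      have "S 0 = (\<lambda>s. a + b * s)" by (simp add: S_def fun_eq_iff)
      then show ?case by simp
    next
      case (Suc n)
      have "(\<lambda>s. indicator {0..X} s * S (Suc n) s)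
          = (\<lambda>s. indicator {0..X} s * (a + b * s + \<eta> * X.volterra (\<lambda>s. indicator {0..X} s * S n s) s))"
        using rec[OF _ Suc] by (auto simp: indicator_def fun_eq_iff)
      moreover have "X.volterra (\<lambda>s. indicator {0..X} s * S n s) \<in> borel_measurable borel"
        by (rule X.volterra_measurable[OF Suc])
      ultimately show ?case by simp
    qed
    have S0: "S 0 t = a + b * t" for t by (simp add: S_def)
    have S_Suc: "S (Suc n) t = a + b * t + \<eta> * X.volterra (\<lambda>s. indicator {0..X} s * S n s) t"
      if "t \<in> {0..X}" for n t by (rule rec[OF that meas])
    have bd: "X.bdd_fun (\<lambda>t. indicator {0..X} t * lim (\<lambda>n. S n t))"
      by (rule X.volterra_iterates_converge(2)[OF assms S0 S_Suc])
    have "lim (\<lambda>n. S n t) = a + b * t + \<eta> * X.volterra (\<lambda>t. indicator {0..X} t * lim (\<lambda>n. S n t)) t"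
      if t: "t \<in> {0..X}" for t
    proof -
      have "indicator {0..X} t * lim (\<lambda>n. S n t) = lim (\<lambda>n. S n t)" using t by simp
      moreover have "indicator {0..X} t * lim (\<lambda>n. S n t)
          = a + b * t + \<eta> * X.volterra (\<lambda>t. indicator {0..X} t * lim (\<lambda>n. S n t)) t"
        by (rule X.volterra_iterates_converge(3)[OF assms S0 S_Suc t])
      ultimately show ?thesis by (simp only:)
    qed
    with bd show ?thesis unfolding S_def[symmetric] by blast
  qed
  show "string_solution M (- \<eta>) a b ?y"
    unfolding string_solution_def
  proof (intro allI impI conjI)
    fix x :: real assume "0 \<le> x" "ennreal x < string_length M"
    then have x: "inside x" by (simp add: inside_def)
    then obtain X where "x < X" "inside X" by (rule inside_extend)
    then have X: "inside X" "0 < X" "x \<in> {0..X}" using \<open>0 \<le> x\<close> by auto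
    interpret X: interval_mass "dM M X" X by (rule interval_mass_dM[OF X(1,2)])
    interpret x: finite_borel_measure "dM M x" by (rule finite_borel_dM[OF x])
    note f = X_facts[OF X(1,2)]
    have f_meas[measurable]: "(\<lambda>t. indicator {0..X} t * ?y t) \<in> borel_measurable borel" using f by (simp add: X.bdd_fun_def)
    obtain C where "0 \<le> C" and C: "\<And>t. t \<in> {0..X} \<Longrightarrow> \<bar>indicator {0..X} t * ?y t\<bar> \<le> C"
      using conjunct1[OF f] by (rule X.bdd_funE) blast
    show "set_integrable (dM M x) {0..x} (\<lambda>t. (x - t) * ?y t)"
      unfolding set_integrable_def
    proof (rule x.integrable_const_bound[of _ "x * C"])
      have eq: "(\<lambda>s. indicator {0..x} s *\<^sub>R ((x - s) * ?y s)) = (\<lambda>s. indicator {0..x} s * ((x - s) * (indicator {0..X} s * ?y s)))"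
        using X by (auto simp: indicator_def fun_eq_iff)
      show "(\<lambda>s. indicator {0..x} s *\<^sub>R ((x - s) * ?y s)) \<in> borel_measurable (dM M x)"
        unfolding eq by measurable
      have "norm (indicator {0..x} s *\<^sub>R ((x - s) * ?y s)) \<le> x * C" for s
      proof (cases "s \<in> {0..x}")
        case True
        then have "\<bar>x - s\<bar> * \<bar>?y s\<bar> \<le> x * C" using C[of s] X by (intro mult_mono) auto
        then show ?thesis using True by (simp add: abs_mult)
      next
        case False
        have "0 \<le> C" using C[of 0] X by (auto intro: order_trans[OF abs_ge_zero])
        then show ?thesis using False \<open>0 \<le> x\<close> by simp
      qed
      then show "AE s in dM M x. norm (indicator {0..x} s *\<^sub>R ((x - s) * ?y s)) \<le> x * C" by simp
    qed
    show "?y x = a + b * x - - \<eta> * (LINT t:{0..x}|dM M x. (x - t) * ?y t)"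
      using f X set_integral_eq_volterra[OF X f_meas] by simp
  qed
qed

text \<open>
  The chosen solutions are arbitrary beyond the length of the string; the cut makes them measurable.
\<close>
definition cutphi :: "real \<Rightarrow> real \<Rightarrow> real \<Rightarrow> real" where
  "cutphi \<eta> x t = indicator {0..x} t * string_phi M (- \<eta>) t"
definition cutpsi :: "real \<Rightarrow> real \<Rightarrow> real \<Rightarrow> real" where
  "cutpsi \<eta> x t = indicator {0..x} t * string_psi M (- \<eta>) t"

lemma string_solutions_cut:
  assumes x: "inside x" "0 < x" and \<eta>: "0 < \<eta>"
  shows "string_solutions (dM M x) x \<eta> (cutphi \<eta> x) (cutpsi \<eta> x)"
proof -
  interpret X: interval_mass "dM M x" x by (rule interval_mass_dM[OF x])
  have eqs: "cutphi \<eta> x = (\<lambda>t. indicator {0..x} t * string_phi M (- \<eta>) t)"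
    "cutpsi \<eta> x = (\<lambda>t. indicator {0..x} t * string_psi M (- \<eta>) t)"
    by (auto simp: cutphi_def cutpsi_def)
  have "string_solution M (- \<eta>) 1 0 (string_phi M (- \<eta>))"
    unfolding string_phi_def by (rule someI_ex[OF string_solution_exists]) (use \<eta> in auto)
  note phi = string_solution_volterra[OF this x, folded eqs]
  have "string_solution M (- \<eta>) 0 1 (string_psi M (- \<eta>))"
    unfolding string_psi_def by (rule someI_ex[OF string_solution_exists]) (use \<eta> in auto)
  note psi = string_solution_volterra[OF this x, folded eqs]
  show ?thesis
  proof unfold_locales
    show "cutphi \<eta> x t = 1 + \<eta> * X.volterra (cutphi \<eta> x) t" if "t \<in> {0..x}" for t
      using phi(2)[OF that] unfolding cutphi_def[of \<eta> x t] by (simp only: mult_zero_left add_0_right)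
    show "cutpsi \<eta> x t = t + \<eta> * X.volterra (cutpsi \<eta> x) t" if "t \<in> {0..x}" for t
      using psi(2)[OF that] unfolding cutpsi_def[of \<eta> x t] by (simp only: mult_1_left add_0_left)
  qed (rule \<eta> phi(1) psi(1))+
qed

definition trunc_weyl :: "real \<Rightarrow> real \<Rightarrow> real" where
  "trunc_weyl \<eta> x = string_phi M (- \<eta>) x / string_psi M (- \<eta>) x"
definition trunc_moment :: "nat \<Rightarrow> real \<Rightarrow> real" where
  "trunc_moment n x = interval_mass.moment (dM M x) x n"
definition trunc_rho :: "real \<Rightarrow> nat \<Rightarrow> real \<Rightarrow> real" where
  "trunc_rho \<eta> n x = string_solutions.rho (dM M x) x (cutphi \<eta> x) (cutpsi \<eta> x) n"

context
  fixes x \<eta> :: real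
  assumes x: "inside x" "0 < x" and \<eta>: "0 < \<eta>"
begin

interpretation X: string_solutions "dM M x" x \<eta> "cutphi \<eta> x" "cutpsi \<eta> x"
  by (rule string_solutions_cut[OF x \<eta>])

lemma trunc_weyl_eq_weyl: "trunc_weyl \<eta> x = X.weyl"
  using x by (simp add: trunc_weyl_def X.weyl_def cutphi_def cutpsi_def)

lemma trunc_weyl_eq: "trunc_weyl \<eta> x = 1 / x + \<eta> * trunc_rho \<eta> 0 x"
  unfolding trunc_weyl_eq_weyl trunc_rho_def by (rule X.weyl_rho)

lemma trunc_rho_rec: "\<eta> * trunc_rho \<eta> (Suc n) x = trunc_moment n x - trunc_rho \<eta> n x"
  unfolding trunc_rho_def trunc_moment_def by (rule X.rho_rec)

lemma trunc_rho_nonneg: "0 \<le> trunc_rho \<eta> n x"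
  unfolding trunc_rho_def by (rule X.rho_nonneg)

lemma trunc_rho_le_moment: "trunc_rho \<eta> n x \<le> trunc_moment n x"
  unfolding trunc_rho_def trunc_moment_def by (rule X.rho_le_moment)

lemma psi_pos: "0 < string_psi M (- \<eta>) x"
  using X.\<psi>_l_pos x by (simp add: cutpsi_def)

lemma phi_ge_1: "1 \<le> string_phi M (- \<eta>) x"
  using X.\<phi>_ge[of x] x by (simp add: cutphi_def)

lemma trunc_weyl_antitone: "0 < t \<Longrightarrow> t \<le> x \<Longrightarrow> trunc_weyl \<eta> x \<le> trunc_weyl \<eta> t"
  using X.ratio_antitone[of t x] x by (simp add: trunc_weyl_def cutphi_def cutpsi_def)

end

lemma spectral_measure_finite:
  assumes x: "inside x" "0 < x"
  obtains P C where "real_distribution P" "AE t in P. t \<in> {0..1}" "0 < C"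
    "\<And>n. trunc_moment n x = trunc_moment 0 x * (\<integral>t. (C * t) ^ n \<partial>P)"
    "\<And>\<eta>. 0 < \<eta> \<Longrightarrow> trunc_rho \<eta> 0 x = trunc_moment 0 x * (\<integral>t. 1 / (1 + \<eta> * (C * t)) \<partial>P)"
proof -
  interpret X: interval_mass "dM M x" x by (rule interval_mass_dM[OF x])
  show thesis
  proof (rule X.green_spectral_measure)
    fix P
    assume P: "real_distribution P" "AE t in P. t \<in> {0..1}"
      "\<And>n. X.moment n = X.moment 0 * (\<integral>t. (X.opbound * t) ^ n \<partial>P)"
    assume res: "\<And>\<eta> u. 0 \<le> \<eta> \<Longrightarrow> X.bdd_fun u \<Longrightarrow> (\<And>t. t \<in> {0..x} \<Longrightarrow> u t = X.e t - \<eta> * X.K u t) \<Longrightarrow>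
       X.ip X.e u = X.moment 0 * (\<integral>t. 1 / (1 + \<eta> * (X.opbound * t)) \<partial>P)"
    have trunc_rho_eq: "trunc_rho \<eta> 0 x = trunc_moment 0 x * (\<integral>t. 1 / (1 + \<eta> * (X.opbound * t)) \<partial>P)" if \<eta>: "0 < \<eta>" for \<eta>
    proof -
      interpret S: string_solutions "dM M x" x \<eta> "cutphi \<eta> x" "cutpsi \<eta> x"
        by (rule string_solutions_cut[OF x \<eta>])
      have "X.ip X.e S.u = X.moment 0 * (\<integral>t. 1 / (1 + \<eta> * (X.opbound * t)) \<partial>P)"
        by (rule res[OF less_imp_le[OF \<eta>] S.u_bdd S.u_eq])
      then show ?thesis by (simp add: trunc_rho_def trunc_moment_def S.rho_def)
    qed
    show thesis
      by (rule that[OF P(1,2) X.opbound_pos P(3)[folded trunc_moment_def] trunc_rho_eq])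
  qed
qed

text \<open>
  A longer piece has a larger Green function, a larger \<open>e\<close> and more mass.
\<close>
lemma iter_mono:
  assumes "inside y" "0 < x" "x \<le> y" "t \<in> {0..x}"
  shows "interval_mass.iter (dM M x) x n t \<le> interval_mass.iter (dM M y) y n t"
  using assms(4)
proof (induction n arbitrary: t)
  interpret Y: interval_mass "dM M y" y using assms by (intro interval_mass_dM) auto
  interpret X: interval_mass "dM M x" x using assms inside_le[OF assms(1)] by (intro interval_mass_dM) auto
  {
    case 0
    then show ?case using assms by (simp add: X.e_def Y.e_def divide_left_mono)
  next
    case (Suc n)
    have dMX: "dM M x = density (dM M y) (\<lambda>s. ennreal (indicator {..x} s))"
      using assms by (intro dM_restrict) auto
    define f where "f s = indicator {0..x} s * (green x t s * X.iter n s)" for s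
    have m[measurable]: "X.iter n \<in> borel_measurable borel" using X.bdd_fun_iter by (simp add: X.bdd_fun_def)
    have f_bd: "Y.bdd_fun f"
    proof -
      obtain C where "0 \<le> C" "\<And>s. s \<in> {0..x} \<Longrightarrow> \<bar>green x t s * X.iter n s\<bar> \<le> C"
        using X.bdd_fun_mult[OF X.bdd_fun_green X.bdd_fun_iter] by (rule X.bdd_funE) blast
      then show ?thesis
        by (intro Y.bdd_funI[of _ "max C 0"]) (auto simp: f_def[abs_def] indicator_def)
    qed
    have "X.iter (Suc n) t = (\<integral>s. f s \<partial>dM M x)"
      unfolding X.iter.simps X.K_def by (intro X.integral_cong_supp) (auto simp: f_def)
    also have "\<dots> \<le> (\<integral>s. green y t s * Y.iter n s \<partial>dM M y)"
      unfolding dMX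
    proof (rule Y.integral_restrict_mono)
      fix s
      show "0 \<le> green y t s * Y.iter n s" if "s \<in> {0..y}"
        using that Suc.prems assms by (intro mult_nonneg_nonneg green_nonneg Y.iter_nonneg) auto
      show "f s \<le> green y t s * Y.iter n s" if s: "s \<in> {0..x}"
      proof -
        have "green x t s * X.iter n s \<le> green y t s * Y.iter n s"
          using s Suc.prems assms
          by (intro mult_mono green_mono Suc.IH green_nonneg X.iter_nonneg) auto
        then show ?thesis using s by (simp add: f_def)
      qed
    qed (use f_bd in auto)
    also have "\<dots> = Y.iter (Suc n) t" by (simp add: Y.K_def)
    finally show ?case .
  }
qed

lemma ip_restrict_mono:
  assumes y: "inside y" "0 < x" "x \<le> y"
    and bd: "interval_mass.bdd_fun x f" "interval_mass.bdd_fun x g" "interval_mass.bdd_fun y f'" "interval_mass.bdd_fun y g'"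
    and nn: "\<And>t. t \<in> {0..x} \<Longrightarrow> 0 \<le> f t" "\<And>t. t \<in> {0..x} \<Longrightarrow> 0 \<le> g t"
      "\<And>t. t \<in> {0..y} \<Longrightarrow> 0 \<le> f' t" "\<And>t. t \<in> {0..y} \<Longrightarrow> 0 \<le> g' t"
    and le: "\<And>t. t \<in> {0..x} \<Longrightarrow> f t \<le> f' t" "\<And>t. t \<in> {0..x} \<Longrightarrow> g t \<le> g' t"
  shows "interval_mass.ip (dM M x) f g \<le> interval_mass.ip (dM M y) f' g'"
proof -
  interpret Y: interval_mass "dM M y" y using y by (intro interval_mass_dM) auto
  interpret X: interval_mass "dM M x" x using y inside_le[OF y(1)] by (intro interval_mass_dM) auto
  have dMX: "dM M x = density (dM M y) (\<lambda>s. ennreal (indicator {..x} s))"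
    using y by (intro dM_restrict) auto
  define h where "h s = indicator {0..x} s * (f s * g s)" for s
  have m[measurable]: "f \<in> borel_measurable borel" "g \<in> borel_measurable borel" using bd by (auto simp: X.bdd_fun_def)
  have h_bd: "Y.bdd_fun h"
  proof -
    obtain C where "0 \<le> C" "\<And>s. s \<in> {0..x} \<Longrightarrow> \<bar>f s * g s\<bar> \<le> C"
      using X.bdd_fun_mult[OF bd(1,2)] by (rule X.bdd_funE) blast
    then show ?thesis
      by (intro Y.bdd_funI[of _ "max C 0"]) (auto simp: h_def[abs_def] indicator_def)
  qed
  have "X.ip f g = (\<integral>s. h s \<partial>dM M x)"
    unfolding X.ip_def by (intro X.integral_cong_supp) (auto simp: h_def)
  also have "\<dots> \<le> (\<integral>s. f' s * g' s \<partial>dM M y)"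
    unfolding dMX
  proof (rule Y.integral_restrict_mono)
    show "h s \<le> f' s * g' s" if s: "s \<in> {0..x}" for s
      using mult_mono[OF le(1)[OF s] le(2)[OF s]] nn s y by (auto simp: h_def)
  qed (use h_bd bd nn in \<open>auto intro: mult_nonneg_nonneg\<close>)
  finally show ?thesis by (simp add: Y.ip_def)
qed

text \<open>
  By \<open>trunc_weyl_antitone\<close> a longer piece has a smaller coefficient in \<open>u = \<phi> - weyl * \<psi>\<close>, hence a larger \<open>u\<close>.
\<close>
lemma trunc_rho_mono:
  assumes y: "inside y" "0 < x" "x \<le> y" and \<eta>: "0 < \<eta>"
  shows "trunc_rho \<eta> n x \<le> trunc_rho \<eta> n y"
proof -
  have x: "inside x" using y inside_le[OF y(1)] by auto
  interpret Y: string_solutions "dM M y" y \<eta> "cutphi \<eta> y" "cutpsi \<eta> y"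
    using y \<eta> by (intro string_solutions_cut) auto
  interpret X: string_solutions "dM M x" x \<eta> "cutphi \<eta> x" "cutpsi \<eta> x"
    using y x \<eta> by (intro string_solutions_cut) auto
  have "X.u t \<le> Y.u t" if t: "t \<in> {0..x}" for t
  proof -
    have "Y.weyl * string_psi M (- \<eta>) t \<le> X.weyl * string_psi M (- \<eta>) t"
    proof (rule mult_right_mono)
      show "Y.weyl \<le> X.weyl" using trunc_weyl_antitone[of y \<eta> x] trunc_weyl_eq_weyl[of x \<eta>] trunc_weyl_eq_weyl[of y \<eta>] x y \<eta> by auto
      show "0 \<le> string_psi M (- \<eta>) t" using X.\<psi>_ge[OF t] t by (simp add: cutpsi_def)
    qed
    then show ?thesis using t y by (simp add: X.u_def Y.u_def cutphi_def cutpsi_def)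
  qed
  then show ?thesis unfolding trunc_rho_def X.rho_def Y.rho_def
    by (intro ip_restrict_mono[OF y X.bdd_fun_iter X.u_bdd Y.bdd_fun_iter Y.u_bdd X.iter_nonneg X.u_nonneg
        Y.iter_nonneg Y.u_nonneg iter_mono[OF y]])
qed

end

section \<open>The limit of the truncated strings\<close>

context krein_string
begin

text \<open>
  The spectral measure, transported to \<open>[0,1]\<close> by \<open>\<lambda> \<mapsto> t = 1/(1 + \<lambda>)\<close> and weighted by \<open>t\<close>. The weight turns
  \<open>\<eta> / (1 + \<eta> \<lambda>)\<close> into \<open>\<eta> / (t + \<eta> (1 - t))\<close>, a function continuous on all of \<open>[0,1]\<close>, and the total mass, which is factored out, is
  \<open>trunc_rho 1 0 x\<close>, which stays bounded as \<open>x\<close> grows. The moments become integrals of \<open>(1 - t)\<^sup>n / t\<^bsup>n+1\<^esup>\<close>, which is singular at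
  \<open>t = 0\<close>, the image of \<open>\<lambda> = \<infinity>\<close>.
\<close>
lemma compactified_measure:
  assumes x: "inside x" "0 < x"
  shows "\<exists>Q. real_distribution Q \<and> (AE t in Q. t \<in> {0..1}) \<and>
    (\<forall>\<eta>>0. \<eta> * trunc_rho \<eta> 0 x = trunc_rho 1 0 x * (\<integral>t. \<eta> / (t + \<eta> * (1 - t)) \<partial>Q)) \<and>
    (\<forall>n. integrable Q (\<lambda>t. (1 - t) ^ n / t ^ Suc n) \<and> trunc_moment n x = trunc_rho 1 0 x * (\<integral>t. (1 - t) ^ n / t ^ Suc n \<partial>Q))"
proof (rule spectral_measure_finite[OF x])
  fix P C
  assume P: "real_distribution P" and suppP: "AE t in P. t \<in> {0..1}" and C: "0 < C"
    and mom_eq: "\<And>n. trunc_moment n x = trunc_moment 0 x * (\<integral>t. (C * t) ^ n \<partial>P)"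
    and trunc_rho_eq: "\<And>\<eta>. 0 < \<eta> \<Longrightarrow> trunc_rho \<eta> 0 x = trunc_moment 0 x * (\<integral>t. 1 / (1 + \<eta> * (C * t)) \<partial>P)"
  interpret P: real_distribution P by (rule P)
  define w where "w t = 1 / (1 + C * t)" for t
  have [measurable]: "w \<in> borel_measurable borel" unfolding w_def by measurable
  have w_bounds: "1 / (1 + C) \<le> w t \<and> w t \<le> 1" if "t \<in> {0..1}" for t
  proof -
    have "0 \<le> C * t" "C * t \<le> C * 1" using that C by (auto intro!: mult_left_mono)
    then have "1 / (1 + C) \<le> 1 / (1 + C * t)" "1 / (1 + C * t) \<le> 1 / 1"
      using C by (intro divide_left_mono; simp)+
    then show ?thesis by (simp add: w_def)
  qed
  have alg: "1 / k + \<eta> * (1 - 1 / k) = 1 / k * (1 + \<eta> * (k - 1))" if "0 < k" for k \<eta> :: real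
    using that by (simp add: field_simps)
  have alg2: "(1 - 1 / k) / (1 / k) = k - 1" if "0 < k" for k :: real
    using that by (simp add: field_simps)
  have w_pos: "0 < w t" if "t \<in> {0..1}" for t
    using w_bounds[OF that] C by (intro less_le_trans[of 0 "1 / (1 + C)" "w t"]) auto
  have w_norm: "norm (w t) \<le> 1" if "t \<in> {0..1}" for t
    using w_bounds[OF that] w_pos[OF that] by simp
  have w_int: "integrable P w"
    by (rule P.integrable_const_bound[OF eventually_mono[OF suppP w_norm]]) measurable
  define a m where "a = trunc_moment 0 x" and "m = trunc_rho 1 0 x"
  have m_eq: "m = a * (\<integral>t. w t \<partial>P)" using trunc_rho_eq[of 1] by (simp add: m_def a_def w_def[abs_def])
  have a: "0 \<le> a" using trunc_rho_nonneg[OF x, of 1 0] trunc_rho_le_moment[OF x, of 1 0] by (simp add: a_def)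
  have int_w: "1 / (1 + C) \<le> (\<integral>t. w t \<partial>P)"
    by (rule P.integral_ge_const[OF w_int], rule eventually_mono[OF suppP]) (use w_bounds in auto)
  show ?thesis
  proof (cases "a = 0")
    case True
    \<comment> \<open>The total mass is zero and any measure will do, provided that it does not charge the singularity at \<open>0\<close>.\<close>
    let ?Q = "return borel (1::real)"
    have Q: "real_distribution ?Q"
      by (intro real_distribution.intro prob_space_return real_distribution_axioms.intro) auto
    have mom0: "trunc_moment n x = 0" for n using mom_eq[of n] True by (simp add: a_def)
    have rr0: "trunc_rho \<eta> 0 x = 0" if "0 < \<eta>" for \<eta> using trunc_rho_eq[OF that] True by (simp add: a_def)
    have Q_int: "integrable ?Q f" if "f \<in> borel_measurable borel" for f :: "real \<Rightarrow> real"
    proof -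
      interpret Q: real_distribution ?Q by (rule Q)
      show ?thesis by (rule Q.integrable_const_bound[of _ "\<bar>f 1\<bar>"]) (use that in \<open>auto simp: AE_return\<close>)
    qed
    show ?thesis
    proof (intro exI[of _ ?Q] conjI allI impI)
      show "AE t in ?Q. t \<in> {0..1}" by (simp add: AE_return)
      show "integrable ?Q (\<lambda>t. (1 - t) ^ n / t ^ Suc n)" for n by (rule Q_int) measurable
    qed (simp_all only: Q mom0 rr0 zero_less_one mult_zero_left mult_zero_right)
  next
    case False
    then have a_pos: "0 < a" using a by simp
    then have m_pos: "0 < m" unfolding m_eq using int_w C
      by (intro mult_pos_pos) (auto intro: less_le_trans[of 0 "1 / (1 + C)"])
    define D where "D = density P (\<lambda>t. ennreal (a * max 0 (w t) / m))"
    define Q where "Q = distr D borel w"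
    have Q_int: "m * integral\<^sup>L Q h = a * (\<integral>t. w t * h (w t) \<partial>P)" if [measurable]: "h \<in> borel_measurable borel" for h
    proof -
      have "integral\<^sup>L Q h = (\<integral>t. h (w t) \<partial>D)"
        unfolding Q_def by (rule integral_distr) (auto simp: D_def)
      also have "\<dots> = (\<integral>t. (a * max 0 (w t) / m) * h (w t) \<partial>P)"
        unfolding D_def using a m_pos by (subst integral_density) auto
      also have "\<dots> = (\<integral>t. a / m * (w t * h (w t)) \<partial>P)"
      proof (intro integral_cong_AE eventually_mono[OF suppP])
        fix t :: real assume "t \<in> {0..1}"
        then show "a * max 0 (w t) / m * h (w t) = a / m * (w t * h (w t))"
          using w_pos[of t] by (simp add: max_def)
      qed measurable
      finally show ?thesis using m_pos by simp
    qed
    have "emeasure D UNIV = (\<integral>\<^sup>+t. ennreal (a * max 0 (w t) / m) \<partial>P)"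
      unfolding D_def by (subst emeasure_density) auto
    also have "\<dots> = (\<integral>\<^sup>+t. ennreal (a / m * w t) \<partial>P)"
    proof (intro nn_integral_cong_AE eventually_mono[OF suppP])
      fix t :: real assume "t \<in> {0..1}"
      then have "max 0 (w t) = w t" using w_pos[of t] by simp
      then show "ennreal (a * max 0 (w t) / m) = ennreal (a / m * w t)" by simp
    qed
    also have "\<dots> = ennreal (\<integral>t. a / m * w t \<partial>P)"
    proof (rule nn_integral_eq_integral)
      have "0 \<le> a / m * w t" if "t \<in> {0..1}" for t
        using w_pos[OF that] a m_pos by simp
      then show "AE t in P. 0 \<le> a / m * w t" by (rule eventually_mono[OF suppP])
    qed (use w_int in simp)
    also have "(\<integral>t. a / m * w t \<partial>P) = (a * (\<integral>t. w t \<partial>P)) / m" by simp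
    also have "\<dots> = 1" unfolding m_eq[symmetric] using m_pos by simp
    also have "ennreal 1 = 1" by simp
    finally have "prob_space D" by (intro prob_spaceI) (simp add: D_def)
    then have "prob_space Q" unfolding Q_def by (rule prob_space.prob_space_distr) (simp add: D_def)
    then have Q: "real_distribution Q"
      by (simp add: real_distribution_def real_distribution_axioms_def Q_def)
    interpret Q: real_distribution Q by (rule Q)
    have supp1: "AE t in Q. t \<in> {1 / (1 + C)..1}"
      unfolding Q_def D_def
      by (subst AE_distr_iff, simp, simp, subst AE_density, simp, rule eventually_mono[OF suppP])
         (use w_bounds in auto)
    have supp2: "AE t in Q. t \<in> {0..1}"
      using C by (intro eventually_mono[OF supp1]) (auto intro: order_trans[of 0 "1 / (1 + C)"])
    have 1: "\<eta> * trunc_rho \<eta> 0 x = m * (\<integral>t. \<eta> / (t + \<eta> * (1 - t)) \<partial>Q)" if \<eta>: "0 < \<eta>" for \<eta>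
    proof -
      have "m * (\<integral>t. \<eta> / (t + \<eta> * (1 - t)) \<partial>Q) = a * (\<integral>t. w t * (\<eta> / (w t + \<eta> * (1 - w t))) \<partial>P)"
        by (rule Q_int) measurable
      also have "(\<integral>t. w t * (\<eta> / (w t + \<eta> * (1 - w t))) \<partial>P) = (\<integral>t. \<eta> * (1 / (1 + \<eta> * (C * t))) \<partial>P)"
      proof (intro integral_cong_AE eventually_mono[OF suppP])
        fix t :: real assume t: "t \<in> {0..1}"
        have Ct: "0 \<le> C * t" using t C by simp
        have "w t + \<eta> * (1 - w t) = w t * (1 + \<eta> * (C * t))"
          using alg[of "1 + C * t" \<eta>] Ct by (simp add: w_def)
        then show "w t * (\<eta> / (w t + \<eta> * (1 - w t))) = \<eta> * (1 / (1 + \<eta> * (C * t)))"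
          using w_pos[OF t] by simp
      qed measurable
      also have "(\<integral>t. \<eta> * (1 / (1 + \<eta> * (C * t))) \<partial>P) = \<eta> * (\<integral>t. 1 / (1 + \<eta> * (C * t)) \<partial>P)"
        by (rule integral_mult_right_zero)
      finally show ?thesis unfolding trunc_rho_eq[OF \<eta>] a_def by (simp only: mult.left_commute)
    qed
    have 2: "integrable Q (\<lambda>t. (1 - t) ^ n / t ^ Suc n)" for n
    proof (rule Q.integrable_const_bound)
      have "norm ((1 - t) ^ n / t ^ Suc n) \<le> 1 / (1 / (1 + C)) ^ Suc n" if t: "t \<in> {1 / (1 + C)..1}" for t
      proof -
        have t0: "0 < t" using t C by (intro less_le_trans[of 0 "1 / (1 + C)" t]) auto
        have "\<bar>(1 - t) ^ n\<bar> \<le> 1" using t t0 by (auto simp: power_abs intro!: power_le_one)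
        moreover have "(1 / (1 + C)) ^ Suc n \<le> t ^ Suc n" using t C by (intro power_mono) auto
        ultimately show ?thesis using t0 C unfolding real_norm_def abs_divide by (intro frac_le) auto
      qed
      then show "AE t in Q. norm ((1 - t) ^ n / t ^ Suc n) \<le> 1 / (1 / (1 + C)) ^ Suc n"
        by (rule eventually_mono[OF supp1])
    qed measurable
    have 3: "trunc_moment n x = m * (\<integral>t. (1 - t) ^ n / t ^ Suc n \<partial>Q)" for n
    proof -
      have "m * (\<integral>t. (1 - t) ^ n / t ^ Suc n \<partial>Q) = a * (\<integral>t. w t * ((1 - w t) ^ n / w t ^ Suc n) \<partial>P)"
        by (rule Q_int) measurable
      also have "(\<integral>t. w t * ((1 - w t) ^ n / w t ^ Suc n) \<partial>P) = (\<integral>t. (C * t) ^ n \<partial>P)"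
      proof (intro integral_cong_AE eventually_mono[OF suppP])
        fix t :: real assume t: "t \<in> {0..1}"
        have Ct: "0 \<le> C * t" using t C by simp
        have "(1 - w t) / w t = C * t" using alg2[of "1 + C * t"] Ct by (simp add: w_def)
        then have "(C * t) ^ n = (1 - w t) ^ n / w t ^ n" by (simp only: power_divide[symmetric])
        then show "w t * ((1 - w t) ^ n / w t ^ Suc n) = (C * t) ^ n" using w_pos[OF t] by simp
      qed measurable
      finally show ?thesis using mom_eq[of n] by (simp add: a_def)
    qed
    show ?thesis
      unfolding m_def[symmetric]
      by (intro exI[of _ Q] conjI allI impI) (rule Q supp2 1 2 3; assumption?)+
  qed
qed

text \<open>
  \<open>1/L\<close>, read as \<open>0\<close> for a string of infinite length.
\<close>
definition inv_length :: real where
  "inv_length = (if string_length M = \<top> then 0 else 1 / enn2real (string_length M))"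

lemma exhausting_sequence:
  assumes L: "string_length M > 0"
  obtains X where "\<And>j. inside (X j)" "\<And>j. 0 < X j" "incseq X"
    "\<And>x. inside x \<Longrightarrow> \<forall>\<^sub>F j in sequentially. x \<le> X j" "(\<lambda>j. 1 / X j) \<longlonglongrightarrow> inv_length"
proof (cases "string_length M = \<top>")
  case True
  show thesis
  proof (rule that[of "\<lambda>j. real (Suc j)"])
    show "\<forall>\<^sub>F j in sequentially. x \<le> real (Suc j)" for x
    proof -
      obtain n where "x \<le> real n" using real_arch_simple by blast
      then show ?thesis by (intro eventually_sequentiallyI[of n]) auto
    qed
    show "(\<lambda>j. 1 / real (Suc j)) \<longlonglongrightarrow> inv_length"
      using LIMSEQ_Suc[OF lim_1_over_n] True by (simp add: inv_length_def)
  qed (use True in \<open>auto simp: inside_def incseq_def ennreal_less_top\<close>)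
next
  case False
  then obtain r where r: "string_length M = ennreal r" "0 \<le> r" by (cases "string_length M") auto
  with L have r0: "0 < r" by auto
  define X where "X j = r * (1 - 1 / real (Suc (Suc j)))" for j
  have Xlim: "X \<longlonglongrightarrow> r * (1 - 0)"
    unfolding X_def by (intro tendsto_intros LIMSEQ_Suc[OF LIMSEQ_Suc[OF lim_1_over_n]])
  have X_pos: "0 < X j" and X_less: "X j < r" for j using r0 by (auto simp: X_def)
  show thesis
  proof (rule that[of X])
    show "inside (X j)" for j using X_pos[of j] X_less[of j] r by (simp add: inside_def ennreal_less_iff)
    show "incseq X" unfolding incseq_def X_def using r0 by (auto intro!: mult_left_mono diff_left_mono divide_left_mono)
    show "\<forall>\<^sub>F j in sequentially. x \<le> X j" if "inside x" for x
    proof -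
      have "x < r * (1 - 0)" using that r by (auto simp: inside_def ennreal_less_iff)
      from order_tendstoD(1)[OF Xlim this] show ?thesis by eventually_elim simp
    qed
    show "(\<lambda>j. 1 / X j) \<longlonglongrightarrow> inv_length"
      using tendsto_divide[OF tendsto_const[of 1] Xlim] r r0 by (simp add: inv_length_def)
  qed (rule X_pos)
qed

lemma inv_length_nonneg: "0 \<le> inv_length" by (simp add: inv_length_def)

text \<open>
  Convergence of \<open>V(x)\<close> as \<open>x\<close> tends to the end of the string, tested on sequences of truncation points.
\<close>
definition weyl_limit :: "real \<Rightarrow> real \<Rightarrow> bool" where
  "weyl_limit \<eta> v \<longleftrightarrow> (\<forall>X. (\<forall>j. inside (X j)) \<longrightarrow> (\<forall>j. 0 < X j) \<longrightarrow>
     (\<forall>x. inside x \<longrightarrow> (\<forall>\<^sub>F j in sequentially. x \<le> X j)) \<longrightarrow> (\<lambda>j. trunc_weyl \<eta> (X j)) \<longlonglongrightarrow> v)"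

lemma weyl_limitI:
  assumes "\<And>X. (\<And>j. inside (X j)) \<Longrightarrow> (\<And>j. 0 < X j) \<Longrightarrow> (\<And>x. inside x \<Longrightarrow> \<forall>\<^sub>F j in sequentially. x \<le> X j) \<Longrightarrow>
      (\<lambda>j. trunc_weyl \<eta> (X j)) \<longlonglongrightarrow> v"
  shows "weyl_limit \<eta> v"
  unfolding weyl_limit_def using assms by blast

lemma weyl_limitD:
  assumes "weyl_limit \<eta> v" "\<And>j. inside (X j)" "\<And>j. 0 < X j" "\<And>x. inside x \<Longrightarrow> \<forall>\<^sub>F j in sequentially. x \<le> X j"
  shows "(\<lambda>j. trunc_weyl \<eta> (X j)) \<longlonglongrightarrow> v"
  using assms unfolding weyl_limit_def by blast

text \<open>
  The total masses \<open>trunc_rho 1 0 x\<close> increase and are bounded, so a subsequence of the compactified measures converges, and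
  monotonicity of \<open>trunc_weyl\<close> extends the limit to all sequences. A bound on the moments survives although their
  integrand \<open>(1 - t)\<^sup>n / t\<^bsup>n+1\<^esup>\<close> is unbounded near \<open>0\<close>, because it is the supremum of an increasing sequence of
  continuous functions. At \<open>t = 0\<close> the integrand is \<open>0\<close> by the convention for division, so an atom of the limit there,
  the mass that escapes to \<open>\<lambda> = \<infinity>\<close>, does not enter the moments.
\<close>
lemma limit_measure:
  assumes L: "string_length M > 0"
  obtains m Q where "0 \<le> m" "real_distribution Q" "AE t in Q. t \<in> {0..1}"
    "\<And>\<eta>. 0 < \<eta> \<Longrightarrow> weyl_limit \<eta> (inv_length + m * (\<integral>t. \<eta> / (t + \<eta> * (1 - t)) \<partial>Q))"
    "\<And>n B. (\<And>x. inside x \<Longrightarrow> 0 < x \<Longrightarrow> trunc_moment n x \<le> B) \<Longrightarrow>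
        ennreal m * (\<integral>\<^sup>+t. ennreal ((1 - t) ^ n / t ^ Suc n) \<partial>Q) \<le> ennreal B"
proof -
  obtain X where X: "\<And>j. inside (X j)" "\<And>j. 0 < X j" and X_inc: "incseq X"
    and X_ev: "\<And>x. inside x \<Longrightarrow> \<forall>\<^sub>F j in sequentially. x \<le> X j" and X_inv: "(\<lambda>j. 1 / X j) \<longlonglongrightarrow> inv_length"
    by (rule exhausting_sequence[OF L]) (rule that)
  have "\<forall>j. \<exists>Q. real_distribution Q \<and> (AE t in Q. t \<in> {0..1}) \<and>
    (\<forall>\<eta>>0. \<eta> * trunc_rho \<eta> 0 (X j) = trunc_rho 1 0 (X j) * (\<integral>t. \<eta> / (t + \<eta> * (1 - t)) \<partial>Q)) \<and>
    (\<forall>n. integrable Q (\<lambda>t. (1 - t) ^ n / t ^ Suc n) \<and> trunc_moment n (X j) = trunc_rho 1 0 (X j) * (\<integral>t. (1 - t) ^ n / t ^ Suc n \<partial>Q))"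
    using compactified_measure[OF X] by blast
  then obtain Qs where Qs: "\<And>j. real_distribution (Qs j)" "\<And>j. AE t in Qs j. t \<in> {0..1}"
    and Qs_rr: "\<And>j \<eta>. 0 < \<eta> \<Longrightarrow> \<eta> * trunc_rho \<eta> 0 (X j) = trunc_rho 1 0 (X j) * (\<integral>t. \<eta> / (t + \<eta> * (1 - t)) \<partial>Qs j)"
    and Qs_int: "\<And>j n. integrable (Qs j) (\<lambda>t. (1 - t) ^ n / t ^ Suc n)"
    and Qs_mom: "\<And>j n. trunc_moment n (X j) = trunc_rho 1 0 (X j) * (\<integral>t. (1 - t) ^ n / t ^ Suc n \<partial>Qs j)"
    unfolding choice_iff by blast
  show thesis
  proof (rule unit_interval_dist_convergent_subseq[of Qs, OF Qs])
    fix r Q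
    assume r: "strict_mono (r::nat\<Rightarrow>nat)" and Q: "real_distribution Q" "AE t in Q. t \<in> {0..1}"
      and conv: "\<And>h. h \<in> borel_measurable borel \<Longrightarrow> continuous_on {0..1} h \<Longrightarrow>
        (\<lambda>n. integral\<^sup>L (Qs (r n)) h) \<longlonglongrightarrow> integral\<^sup>L Q (h::real\<Rightarrow>real)"
    interpret Q: real_distribution Q by (rule Q(1))
    have r1: "0 < (1::real)" by simp
    have trunc_rho_conv: "convergent (\<lambda>j. trunc_rho 1 0 (X j))"
    proof -
      have inc: "incseq (\<lambda>j. trunc_rho 1 0 (X j))"
        using X X_inc by (intro incseq_SucI trunc_rho_mono) (auto simp: incseq_SucD)
      have "trunc_rho 1 0 (X j) \<le> trunc_weyl 1 (X 0)" for j
      proof -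
        have "trunc_rho 1 0 (X j) \<le> trunc_weyl 1 (X j)" using trunc_weyl_eq[OF X r1, of j] X(2)[of j] by simp
        also have "\<dots> \<le> trunc_weyl 1 (X 0)"
          using X_inc X by (intro trunc_weyl_antitone) (auto simp: incseq_def)
        finally show ?thesis .
      qed
      then have "bdd_above (range (\<lambda>j. trunc_rho 1 0 (X j)))" by (intro bdd_aboveI[of _ "trunc_weyl 1 (X 0)"]) auto
      from LIMSEQ_incseq_SUP[OF this inc] show ?thesis by (rule convergentI)
    qed
    define m where "m = lim (\<lambda>j. trunc_rho 1 0 (X j))"
    have m_lim: "(\<lambda>j. trunc_rho 1 0 (X j)) \<longlonglongrightarrow> m" using trunc_rho_conv by (simp add: m_def convergent_LIMSEQ_iff)
    have m_nonneg: "0 \<le> m" by (rule LIMSEQ_le_const[OF m_lim]) (use trunc_rho_nonneg[OF X r1] in auto)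
    have m_lim_r: "(\<lambda>j. trunc_rho 1 0 (X (r j))) \<longlonglongrightarrow> m" using LIMSEQ_subseq_LIMSEQ[OF m_lim r] by (simp add: comp_def)
    have pos_den: "t + \<eta> * (1 - t) \<noteq> 0" if "0 < \<eta>" "t \<in> {0..1}" for t \<eta> :: real
    proof (cases "t = 1")
      case False
      then have "0 < \<eta> * (1 - t)" using that by auto
      then show ?thesis using that by auto
    qed simp
    have lim_r: "(\<lambda>j. trunc_weyl \<eta> (X (r j))) \<longlonglongrightarrow> inv_length + m * (\<integral>t. \<eta> / (t + \<eta> * (1 - t)) \<partial>Q)" if \<eta>: "0 < \<eta>" for \<eta>
    proof -
      have "(\<lambda>j. 1 / X (r j) + trunc_rho 1 0 (X (r j)) * (\<integral>t. \<eta> / (t + \<eta> * (1 - t)) \<partial>Qs (r j)))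
          \<longlonglongrightarrow> inv_length + m * (\<integral>t. \<eta> / (t + \<eta> * (1 - t)) \<partial>Q)"
      proof (intro tendsto_add tendsto_mult m_lim_r conv)
        show "(\<lambda>j. 1 / X (r j)) \<longlonglongrightarrow> inv_length" using LIMSEQ_subseq_LIMSEQ[OF X_inv r] by (simp add: comp_def)
        show "continuous_on {0..1} (\<lambda>t. \<eta> / (t + \<eta> * (1 - t)))"
          by (intro continuous_intros ballI pos_den[OF \<eta>])
      qed measurable
      moreover have "trunc_weyl \<eta> (X (r j)) = 1 / X (r j) + trunc_rho 1 0 (X (r j)) * (\<integral>t. \<eta> / (t + \<eta> * (1 - t)) \<partial>Qs (r j))" for j
        unfolding trunc_weyl_eq[OF X \<eta>] Qs_rr[OF \<eta>] ..
      ultimately show ?thesis by simp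
    qed
    show thesis
    proof (rule that[OF m_nonneg Q])
      fix \<eta> :: real
      assume \<eta>: "0 < \<eta>"
      let ?l = "inv_length + m * (\<integral>t. \<eta> / (t + \<eta> * (1 - t)) \<partial>Q)"
      have lower: "?l \<le> trunc_weyl \<eta> x" if x: "inside x" "0 < x" for x
      proof (rule LIMSEQ_le_const2[OF lim_r[OF \<eta>]])
        obtain N where "\<forall>j\<ge>N. x \<le> X j" using X_ev[OF x(1)] by (auto simp: eventually_sequentially)
        then have "trunc_weyl \<eta> (X (r j)) \<le> trunc_weyl \<eta> x" if "j \<ge> N" for j
          using that seq_suble[OF r, of j] x X \<eta> by (intro trunc_weyl_antitone) (auto intro: order_trans)
        then show "\<exists>N. \<forall>n\<ge>N. trunc_weyl \<eta> (X (r n)) \<le> trunc_weyl \<eta> x" by blast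
      qed
      show "weyl_limit \<eta> ?l"
      proof (rule weyl_limitI)
        fix Y
        assume Y: "\<And>j. inside (Y j)" "\<And>j. 0 < Y j" and Y_ev: "\<And>x. inside x \<Longrightarrow> \<forall>\<^sub>F j in sequentially. x \<le> Y j"
        show "(\<lambda>j. trunc_weyl \<eta> (Y j)) \<longlonglongrightarrow> ?l"
        proof (rule order_tendstoI)
          fix a assume "a < ?l"
          then have "a < trunc_weyl \<eta> (Y j)" for j using lower[OF Y] by (rule less_le_trans)
          then show "\<forall>\<^sub>F j in sequentially. a < trunc_weyl \<eta> (Y j)" by simp
        next
          fix a assume "?l < a"
          from order_tendstoD(2)[OF lim_r[OF \<eta>] this] obtain j where j: "trunc_weyl \<eta> (X (r j)) < a"
            by (auto simp: eventually_sequentially)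
          from Y_ev[OF X(1), of "r j"] show "\<forall>\<^sub>F i in sequentially. trunc_weyl \<eta> (Y i) < a"
          proof eventually_elim
            case (elim i)
            then have "trunc_weyl \<eta> (Y i) \<le> trunc_weyl \<eta> (X (r j))" using X Y \<eta> by (intro trunc_weyl_antitone) auto
            with j show ?case by simp
          qed
        qed
      qed
    next
      fix n B
      assume B: "\<And>x. inside x \<Longrightarrow> 0 < x \<Longrightarrow> trunc_moment n x \<le> B"
      have [simp]: "0 \<le> B" using B[OF X, of 0] trunc_rho_nonneg[OF X r1] trunc_rho_le_moment[OF X r1] by (meson order_trans)
      define g where "g t = (1 - t) ^ n / t ^ Suc n" for t :: real
      \<comment> \<open>A continuous approximation of \<open>g\<close> from below: \<open>g t = (1 - t)\<^sup>n t / t\<^bsup>n+2\<^esup>\<close> with the denominator kept positive.\<close>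
      define h where "h k t = (1 - t) ^ n * t / (t ^ Suc (Suc n) + 1 / real (Suc k))" for k :: nat and t :: real
      have [measurable]: "g \<in> borel_measurable borel" "h k \<in> borel_measurable borel" for k
        unfolding g_def h_def by measurable
      have den: "0 < t ^ Suc (Suc n) + 1 / real (Suc k)" if "t \<in> {0..1}" for t :: real and k
        using that by (intro add_nonneg_pos) auto
      have h_nonneg: "0 \<le> h k t" if "t \<in> {0..1}" for k t
        unfolding h_def using that den[OF that, of k] by (intro divide_nonneg_pos mult_nonneg_nonneg) auto
      have h_le_g: "h k t \<le> g t" if t: "t \<in> {0..1}" for k t
      proof (cases "t = 0")
        case False
        then have "0 < t" using t by simp
        have "h k t \<le> (1 - t) ^ n * t / (t ^ Suc (Suc n))"
          unfolding h_def using \<open>0 < t\<close> t den[OF t, of k]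
          by (intro divide_left_mono mult_pos_pos mult_nonneg_nonneg zero_le_power zero_less_power) auto
        also have "\<dots> = g t" using \<open>0 < t\<close> by (simp add: g_def)
        finally show ?thesis .
      qed (simp add: h_def g_def)
      have h_lim: "(\<lambda>k. h k t) \<longlonglongrightarrow> g t" if t: "t \<in> {0..1}" for t
      proof (cases "t = 0")
        case False
        then have "t ^ Suc (Suc n) + 0 \<noteq> 0" by simp
        then have "(\<lambda>k. h k t) \<longlonglongrightarrow> (1 - t) ^ n * t / (t ^ Suc (Suc n) + 0)"
          unfolding h_def by (intro tendsto_intros LIMSEQ_Suc[OF lim_1_over_n])
        then show ?thesis using False by (simp add: g_def)
      qed (simp add: h_def g_def)
      have h_cont: "continuous_on {0..1} (h k)" for k
        unfolding h_def using den by (intro continuous_intros ballI) (auto simp: less_imp_neq[THEN not_sym])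
      have h_bd: "m * integral\<^sup>L Q (h k) \<le> B" for k
      proof (rule LIMSEQ_le_const2)
        show "(\<lambda>j. trunc_rho 1 0 (X (r j)) * integral\<^sup>L (Qs (r j)) (h k)) \<longlonglongrightarrow> m * integral\<^sup>L Q (h k)"
          by (intro tendsto_mult m_lim_r conv h_cont) measurable
        have "trunc_rho 1 0 (X (r j)) * integral\<^sup>L (Qs (r j)) (h k) \<le> B" for j
        proof -
          have "integral\<^sup>L (Qs (r j)) (h k) \<le> integral\<^sup>L (Qs (r j)) g"
          proof (rule integral_mono_AE')
            show "integrable (Qs (r j)) g" using Qs_int[of "r j" n] by (simp add: g_def[abs_def])
            show "AE t in Qs (r j). h k t \<le> g t" by (rule eventually_mono[OF Qs(2) h_le_g])
            show "AE t in Qs (r j). 0 \<le> g t"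
              by (rule eventually_mono[OF Qs(2) order_trans[OF h_nonneg h_le_g]])
          qed
          then have "trunc_rho 1 0 (X (r j)) * integral\<^sup>L (Qs (r j)) (h k) \<le> trunc_rho 1 0 (X (r j)) * integral\<^sup>L (Qs (r j)) g"
            using trunc_rho_nonneg[OF X r1] by (rule mult_left_mono)
          also have "\<dots> = trunc_moment n (X (r j))" unfolding Qs_mom g_def[abs_def] ..
          also have "\<dots> \<le> B" by (rule B[OF X])
          finally show ?thesis .
        qed
        then show "\<exists>N. \<forall>j\<ge>N. trunc_rho 1 0 (X (r j)) * integral\<^sup>L (Qs (r j)) (h k) \<le> B" by blast
      qed
      have h_int: "integrable Q (h k)" for k
      proof -
        have "bounded (h k ` {0..1})" by (intro compact_imp_bounded compact_continuous_image h_cont) auto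
        then obtain b where b: "\<And>t. t \<in> {0..1} \<Longrightarrow> norm (h k t) \<le> b" unfolding bounded_iff by blast
        show ?thesis by (rule Q.integrable_const_bound[OF eventually_mono[OF Q(2) b]]) measurable
      qed
      have "(\<integral>\<^sup>+t. ennreal m * ennreal (g t) \<partial>Q) = (\<integral>\<^sup>+t. liminf (\<lambda>k. ennreal m * ennreal (h k t)) \<partial>Q)"
      proof (intro nn_integral_cong_AE eventually_mono[OF Q(2)])
        fix t :: real assume t: "t \<in> {0..1}"
        have "(\<lambda>k. ennreal (m * h k t)) \<longlonglongrightarrow> ennreal (m * g t)"
          by (intro tendsto_ennrealI tendsto_mult_left h_lim t)
        then have "(\<lambda>k. ennreal m * ennreal (h k t)) \<longlonglongrightarrow> ennreal m * ennreal (g t)"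
          using m_nonneg by (simp add: ennreal_mult')
        then show "ennreal m * ennreal (g t) = liminf (\<lambda>k. ennreal m * ennreal (h k t))"
          by (intro lim_imp_Liminf[symmetric]) auto
      qed
      also have "\<dots> \<le> liminf (\<lambda>k. \<integral>\<^sup>+t. ennreal m * ennreal (h k t) \<partial>Q)"
        by (rule nn_integral_liminf) measurable
      also have "\<dots> \<le> liminf (\<lambda>k::nat. ennreal B)"
      proof (intro Liminf_mono always_eventually allI)
        fix k
        have "(\<integral>\<^sup>+t. ennreal m * ennreal (h k t) \<partial>Q) = ennreal m * (\<integral>\<^sup>+t. ennreal (h k t) \<partial>Q)"
          by (rule nn_integral_cmult) measurable
        also have "(\<integral>\<^sup>+t. ennreal (h k t) \<partial>Q) = ennreal (integral\<^sup>L Q (h k))"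
          by (rule nn_integral_eq_integral[OF h_int eventually_mono[OF Q(2) h_nonneg]])
        also have "ennreal m * \<dots> = ennreal (m * integral\<^sup>L Q (h k))"
          using m_nonneg by (simp add: ennreal_mult')
        also have "\<dots> \<le> ennreal B" by (intro ennreal_leI h_bd)
        finally show "(\<integral>\<^sup>+t. ennreal m * ennreal (h k t) \<partial>Q) \<le> ennreal B" .
      qed
      also have "\<dots> = ennreal B" by (simp add: Liminf_const)
      finally show "ennreal m * (\<integral>\<^sup>+t. ennreal ((1 - t) ^ n / t ^ Suc n) \<partial>Q) \<le> ennreal B"
        by (subst nn_integral_cmult[symmetric]) (auto simp: g_def)
    qed
  qed
qed

end

section \<open>Stieltjes functions in compactified form\<close>

text \<open>
  With \<open>t = 1/(1 + \<lambda>)\<close> the kernel \<open>1 / (1 - t (1 + z))\<close> is \<open>(1 + \<lambda>) / (\<lambda> - z)\<close>, the kernel of a Stieltjes function with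
  respect to a finite measure. An atom at \<open>t = 0\<close>, where the kernel is \<open>1\<close>, contributes to the constant term.
\<close>
definition stieltjes :: "real \<Rightarrow> real \<Rightarrow> real measure \<Rightarrow> complex \<Rightarrow> complex" where
  "stieltjes c m Q z = complex_of_real c + complex_of_real m * (LINT t|Q. 1 / (1 - complex_of_real t * (1 + z)))"

lemma slit_plane_iff: "z \<in> slit_plane \<longleftrightarrow> Im z \<noteq> 0 \<or> Re z < 0"
  by (auto simp: slit_plane_def complex_nonneg_Reals_iff)

text \<open>
  The kernel has its pole at \<open>z = 1/t - 1 = \<lambda> \<ge> 0\<close>.
\<close>
lemma kernel_nonzero:
  assumes "z \<in> slit_plane" "t \<in> {0..1}"
  shows "1 - complex_of_real t * (1 + z) \<noteq> 0"
proof
  assume "1 - complex_of_real t * (1 + z) = 0"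
  then have "Re (1 - complex_of_real t * (1 + z)) = 0" "Im (1 - complex_of_real t * (1 + z)) = 0" by (simp_all only: zero_complex.simps)
  then have *: "t * (1 + Re z) = 1" "t * Im z = 0" by auto
  then have "t \<noteq> 0" by auto
  then have "Im z = 0" "0 < t" using * assms(2) by auto
  moreover have "1 \<le> 1 + Re z"
  proof (rule ccontr)
    assume "\<not> 1 \<le> 1 + Re z"
    then have "t * (1 + Re z) < t * 1" using \<open>0 < t\<close> by (intro mult_strict_left_mono) auto
    then show False using * assms(2) by auto
  qed
  ultimately show False using assms(1) by (auto simp: slit_plane_iff)
qed

lemma kernel_bounded_below:
  assumes "z \<in> slit_plane"
  obtains \<delta> where "0 < \<delta>" "\<And>t. t \<in> {0..1} \<Longrightarrow> \<delta> \<le> cmod (1 - complex_of_real t * (1 + z))"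
proof -
  have "continuous_on {0..1} (\<lambda>t. cmod (1 - complex_of_real t * (1 + z)))"
    by (intro continuous_intros)
  then have "\<exists>s\<in>{0..1}. \<forall>t\<in>{0..1}. cmod (1 - complex_of_real s * (1 + z)) \<le> cmod (1 - complex_of_real t * (1 + z))"
    by (intro continuous_attains_inf) auto
  then obtain s where s: "s \<in> {0..1}"
    "\<forall>t\<in>{0..1}. cmod (1 - complex_of_real s * (1 + z)) \<le> cmod (1 - complex_of_real t * (1 + z))"
    by blast
  show thesis
    by (rule that[of "cmod (1 - complex_of_real s * (1 + z))"]) (use kernel_nonzero[OF assms s(1)] s in auto)
qed

locale compact_distribution = real_distribution Q for Q :: "real measure" +
  assumes suppQ: "AE t in Q. t \<in> {0..1}"
begin

lemma kernel_integrable: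
  assumes "z \<in> slit_plane"
  shows "integrable Q (\<lambda>t. 1 / (1 - complex_of_real t * (1 + z)))"
proof -
  obtain \<delta> where \<delta>: "0 < \<delta>" "\<And>t. t \<in> {0..1} \<Longrightarrow> \<delta> \<le> cmod (1 - complex_of_real t * (1 + z))"
    using assms by (rule kernel_bounded_below) blast
  have bd: "norm (1 / (1 - complex_of_real t * (1 + z))) \<le> 1 / \<delta>" if "t \<in> {0..1}" for t
    unfolding norm_divide norm_one using \<delta>(2)[OF that] \<delta>(1) less_le_trans[OF \<delta>(1) \<delta>(2)[OF that]]
    by (intro divide_left_mono mult_pos_pos) simp_all
  show ?thesis
    by (rule integrable_const_bound[OF eventually_mono[OF suppQ bd]]) measurable
qed

text \<open>
  Differentiation under the integral sign. Compactness of \<open>[0,1]\<close> keeps the denominator away from zero, which makes the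
  error of the difference quotients uniformly small.
\<close>
lemma stieltjes_holomorphic: "stieltjes c m Q holomorphic_on slit_plane"
proof -
  define k where "k z t = 1 / (1 - complex_of_real t * (1 + z))" for z t
  have [measurable]: "k z \<in> borel_measurable borel" for z unfolding k_def by measurable
  have "(\<lambda>z. LINT t|Q. k z t) field_differentiable (at z)" if z: "z \<in> slit_plane" for z
  proof -
    obtain \<delta> where \<delta>: "0 < \<delta>" "\<And>t. t \<in> {0..1} \<Longrightarrow> \<delta> \<le> cmod (1 - complex_of_real t * (1 + z))"
      using z by (rule kernel_bounded_below) blast
    have near: "\<delta> / 2 \<le> cmod (1 - complex_of_real t * (1 + w))" if "t \<in> {0..1}" "cmod (w - z) \<le> \<delta> / 2" for t w
    proof -
      have "cmod (complex_of_real t * (w - z)) \<le> 1 * (\<delta> / 2)"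
        unfolding norm_mult using that by (intro mult_mono) auto
      moreover have "1 - complex_of_real t * (1 + z) = (1 - complex_of_real t * (1 + w)) + complex_of_real t * (w - z)"
        by (simp add: algebra_simps)
      then have "cmod (1 - complex_of_real t * (1 + z)) \<le> cmod (1 - complex_of_real t * (1 + w)) + cmod (complex_of_real t * (w - z))"
        by (metis norm_triangle_ineq)
      ultimately show ?thesis using \<delta>(2)[OF that(1)] by linarith
    qed
    define D where "D = (LINT t|Q. complex_of_real t * (k z t)\<^sup>2)"
    have k_bd: "cmod (k w t) \<le> 2 / \<delta>" if "t \<in> {0..1}" "cmod (w - z) \<le> \<delta> / 2" for t w
    proof -
      have "1 / cmod (1 - complex_of_real t * (1 + w)) \<le> 1 / (\<delta> / 2)"
        using near[OF that] \<delta>(1) less_le_trans[OF half_gt_zero[OF \<delta>(1)] near[OF that]]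
        by (intro divide_left_mono mult_pos_pos) simp_all
      then show ?thesis by (simp add: k_def norm_divide)
    qed
    have k_int: "integrable Q (k w)" if "cmod (w - z) \<le> \<delta> / 2" for w
      by (rule integrable_const_bound[OF eventually_mono[OF suppQ k_bd[OF _ that]]]) measurable
    have z_near: "cmod (z - z) \<le> \<delta> / 2" using \<delta>(1) by simp
    have prod_bd: "cmod (complex_of_real t * (k z t)\<^sup>2) \<le> 1 * (2 / \<delta>)\<^sup>2" if "t \<in> {0..1}" for t
      unfolding norm_mult norm_power using k_bd[OF that z_near] that by (intro mult_mono power_mono) auto
    have D_int: "integrable Q (\<lambda>t. complex_of_real t * (k z t)\<^sup>2)"
      by (rule integrable_const_bound[OF eventually_mono[OF suppQ prod_bd]]) measurable
    have quot: "cmod (((LINT t|Q. k w t) - (LINT t|Q. k z t)) / (w - z) - D) \<le> (2 / \<delta>) ^ 3 * cmod (w - z)"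
      if w: "w \<noteq> z" "cmod (w - z) \<le> \<delta> / 2" for w
    proof -
      have pointwise: "(k w t - k z t) / (w - z) - complex_of_real t * (k z t)\<^sup>2 = (w - z) * ((complex_of_real t)\<^sup>2 * k w t * (k z t)\<^sup>2)"
        if t: "t \<in> {0..1}" for t
      proof -
        have nz: "1 - complex_of_real t * (1 + w) \<noteq> 0" "1 - complex_of_real t * (1 + z) \<noteq> 0"
          using near[OF t w(2)] near[OF t z_near] \<delta>(1) by auto
        have alg: "1 / a - 1 / b = (b - a) / (a * b)" if "a \<noteq> 0" "b \<noteq> 0" for a b :: complex
          using that by (simp add: field_simps)
        have d1: "k w t - k z t = (w - z) * (complex_of_real t * k w t * k z t)"
          unfolding k_def alg[OF nz] by (simp add: algebra_simps)
        then have "(k w t - k z t) / (w - z) = complex_of_real t * k w t * k z t" using w(1) by simp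
        then have "(k w t - k z t) / (w - z) - complex_of_real t * (k z t)\<^sup>2 = complex_of_real t * k z t * (k w t - k z t)"
          by (simp add: algebra_simps power2_eq_square)
        then show ?thesis unfolding d1 by (simp add: algebra_simps power2_eq_square)
      qed
      have "((LINT t|Q. k w t) - (LINT t|Q. k z t)) / (w - z) - D
          = (LINT t|Q. (k w t - k z t) / (w - z) - complex_of_real t * (k z t)\<^sup>2)"
        unfolding D_def using k_int[OF w(2)] k_int[OF z_near] D_int by simp
      also have "cmod \<dots> \<le> (LINT t|Q. cmod ((k w t - k z t) / (w - z) - complex_of_real t * (k z t)\<^sup>2))"
        by (rule integral_norm_bound)
      also have "\<dots> \<le> (2 / \<delta>) ^ 3 * cmod (w - z)"
      proof (rule integral_le_const)
        show "integrable Q (\<lambda>t. cmod ((k w t - k z t) / (w - z) - complex_of_real t * (k z t)\<^sup>2))"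
          using k_int[OF w(2)] k_int[OF z_near] D_int by (intro integrable_norm) auto
        have "cmod ((k w t - k z t) / (w - z) - complex_of_real t * (k z t)\<^sup>2) \<le> (2 / \<delta>) ^ 3 * cmod (w - z)"
          if t: "t \<in> {0..1}" for t
        proof -
          have "cmod ((complex_of_real t)\<^sup>2 * k w t * (k z t)\<^sup>2) \<le> 1 * (2 / \<delta>) * (2 / \<delta>)\<^sup>2"
            unfolding norm_mult norm_power using t k_bd[OF t w(2)] k_bd[OF t z_near] \<delta>(1)
            by (intro mult_mono power_mono mult_nonneg_nonneg) (auto intro: power_le_one)
          also have "\<dots> = (2 / \<delta>) ^ 3" by (simp add: power3_eq_cube power2_eq_square)
          finally show ?thesis unfolding pointwise[OF t] norm_mult[of "w - z"]
            by (subst mult.commute) (rule mult_right_mono, auto)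
        qed
        then show "AE t in Q. cmod ((k w t - k z t) / (w - z) - complex_of_real t * (k z t)\<^sup>2) \<le> (2 / \<delta>) ^ 3 * cmod (w - z)"
          by (rule eventually_mono[OF suppQ])
      qed
      finally show ?thesis .
    qed
    have "((\<lambda>w. ((LINT t|Q. k w t) - (LINT t|Q. k z t)) / (w - z) - D) \<longlongrightarrow> 0) (at z)"
    proof (rule Lim_null_comparison)
      have "\<forall>\<^sub>F w in at z. w \<noteq> z \<and> dist w z < \<delta> / 2"
        using \<delta>(1) by (auto simp: eventually_at intro!: exI[of _ "\<delta> / 2"])
      then show "\<forall>\<^sub>F w in at z. norm (((LINT t|Q. k w t) - (LINT t|Q. k z t)) / (w - z) - D) \<le> (2 / \<delta>) ^ 3 * cmod (w - z)"
        by eventually_elim (intro quot, auto simp: dist_norm)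
      have "((\<lambda>w. (2 / \<delta>) ^ 3 * cmod (w - z)) \<longlongrightarrow> (2 / \<delta>) ^ 3 * cmod (z - z)) (at z)"
        by (intro tendsto_intros)
      then show "((\<lambda>w. (2 / \<delta>) ^ 3 * cmod (w - z)) \<longlongrightarrow> 0) (at z)" by simp
    qed
    then have "((\<lambda>w. ((LINT t|Q. k w t) - (LINT t|Q. k z t)) / (w - z)) \<longlongrightarrow> D) (at z)"
      by (rule LIM_zero_cancel)
    then have "((\<lambda>z. LINT t|Q. k z t) has_field_derivative D) (at z)"
      by (simp add: has_field_derivative_iff)
    then show ?thesis by (auto simp: field_differentiable_def)
  qed
  then have "(\<lambda>z. LINT t|Q. k z t) holomorphic_on slit_plane"
    by (auto simp: holomorphic_on_def intro: field_differentiable_at_within)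
  then show ?thesis
    unfolding stieltjes_def[abs_def] k_def by (intro holomorphic_intros)
qed

text \<open>
  The kernel values for fixed \<open>z\<close> lie in a common open half plane, together with the positive numbers, so neither an
  average of them nor its sum with a nonnegative constant can vanish.
\<close>
lemma stieltjes_nonzero:
  assumes z: "z \<in> slit_plane" and nn: "0 \<le> c" "0 \<le> m" "0 < c \<or> 0 < m"
  shows "stieltjes c m Q z \<noteq> 0"
proof -
  \<comment> \<open>All values \<open>1 - t (1 + z)\<close> lie on the segment from \<open>1\<close> to \<open>-z\<close>, hence in the open half plane around
    the bisector \<open>b\<close> of these two directions. Their inverses lie in the half plane around the conjugate of \<open>b\<close>, which
    contains the positive numbers.\<close>
  define b where "b = 1 - z / complex_of_real (cmod z)"
  have z0: "z \<noteq> 0" using z by (auto simp: slit_plane_iff)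
  then have n: "0 < cmod z" by simp
  have re: "Re z < cmod z"
  proof (rule ccontr)
    assume "\<not> Re z < cmod z"
    then have "Re z = cmod z" using complex_Re_le_cmod[of z] by linarith
    then have "Im z = 0" "0 < Re z" using n cmod_power2[of z] by auto
    then show False using z by (auto simp: slit_plane_iff)
  qed
  have b1: "0 < Re b" using re n by (simp add: b_def divide_less_eq)
  have bz: "Re (cnj b * (- z)) = cmod z - Re z"
  proof -
    have "cnj b * (- z) = - z + (cnj z * z) / complex_of_real (cmod z)" by (simp add: b_def algebra_simps)
    also have "cnj z * z = complex_of_real ((cmod z)\<^sup>2)" by (metis complex_norm_square mult.commute)
    also have "complex_of_real ((cmod z)\<^sup>2) / complex_of_real (cmod z) = complex_of_real (cmod z)"
      using n by (simp add: power2_eq_square)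
    finally show ?thesis by simp
  qed
  define k where "k t = 1 / (1 - complex_of_real t * (1 + z))" for t
  have pos: "0 < Re (b * k t)" if t: "t \<in> {0..1}" for t
  proof -
    define d where "d = 1 - complex_of_real t * (1 + z)"
    have d0: "d \<noteq> 0" unfolding d_def by (rule kernel_nonzero[OF z t])
    have d_eq: "d = complex_of_real (1 - t) + complex_of_real t * (- z)" by (simp add: d_def algebra_simps)
    have "Re (cnj b * d) = (1 - t) * Re b + t * (cmod z - Re z)"
    proof -
      have re_mult: "Re (complex_of_real a * w) = a * Re w" for a w by simp
      have "cnj b * d = complex_of_real (1 - t) * cnj b + complex_of_real t * (cnj b * (- z))"
        unfolding d_eq by (simp add: algebra_simps)
      then have "Re (cnj b * d) = (1 - t) * Re (cnj b) + t * Re (cnj b * (- z))" by (simp only: plus_complex.sel re_mult)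
      then show ?thesis unfolding bz by simp
    qed
    also have "\<dots> > 0"
    proof (cases "t = 1")
      case False
      then have "0 < (1 - t) * Re b" using t b1 by auto
      moreover have "0 \<le> t * (cmod z - Re z)" using t re by simp
      ultimately show ?thesis by linarith
    qed (use re in simp)
    finally have "0 < Re (cnj b * d)" .
    moreover have "Re (b * k t) = Re (cnj b * d) / (cmod d)\<^sup>2"
    proof -
      have "b * k t = b * cnj d / complex_of_real ((cmod d)\<^sup>2)"
        unfolding k_def d_def[symmetric] using complex_div_cnj[of b d] by simp
      then have "Re (b * k t) = Re (b * cnj d) / (cmod d)\<^sup>2" by (metis Re_divide_of_real)
      also have "Re (b * cnj d) = Re (cnj b * d)" by simp
      finally show ?thesis .
    qed
    ultimately show ?thesis using d0 by simp
  qed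
  have k_int: "integrable Q k" unfolding k_def[abs_def] by (rule kernel_integrable[OF z])
  have "Re (b * (LINT t|Q. k t)) = (LINT t|Q. Re (b * k t))"
    using k_int by (subst integral_Re) auto
  moreover have "0 < (LINT t|Q. Re (b * k t))"
  proof -
    have int: "integrable Q (\<lambda>t. Re (b * k t))" using k_int by (intro integrable_Re) auto
    have nn: "AE t in Q. 0 \<le> Re (b * k t)" by (rule eventually_mono[OF suppQ less_imp_le[OF pos]])
    have "(LINT t|Q. Re (b * k t)) \<noteq> 0"
    proof
      assume "(LINT t|Q. Re (b * k t)) = 0"
      then have "AE t in Q. Re (b * k t) = 0" using integral_nonneg_eq_0_iff_AE[OF int nn] by simp
      then have "AE t in Q. False" using suppQ by eventually_elim (use pos in force)
      then show False by simp
    qed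
    moreover have "0 \<le> (LINT t|Q. Re (b * k t))" by (rule integral_nonneg_AE[OF nn])
    ultimately show ?thesis by simp
  qed
  ultimately have "0 < Re (b * (LINT t|Q. k t))" by simp
  moreover have "Re (b * stieltjes c m Q z) = c * Re b + m * Re (b * (LINT t|Q. k t))"
    unfolding stieltjes_def k_def[symmetric] by (simp add: algebra_simps)
  ultimately have "0 < Re (b * stieltjes c m Q z)"
    using nn b1 by (auto intro: add_pos_nonneg add_nonneg_pos)
  then show ?thesis by auto
qed

text \<open>
  The values \<open>z = - 1/\<eta>\<close> are those at which the limit of the truncated strings is known.
\<close>
lemma stieltjes_neg_real:
  assumes "0 < \<eta>"
  shows "stieltjes c m Q (complex_of_real (- 1 / \<eta>)) = complex_of_real (c + m * (\<integral>t. \<eta> / (t + \<eta> * (1 - t)) \<partial>Q))"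
proof -
  have "1 / (1 - complex_of_real t * (1 + complex_of_real (- 1 / \<eta>))) = complex_of_real (\<eta> / (t + \<eta> * (1 - t)))" for t
  proof -
    have "1 - complex_of_real t * (1 + complex_of_real (- 1 / \<eta>)) = complex_of_real (1 - t * (1 + - 1 / \<eta>))" by simp
    also have "1 - t * (1 + - 1 / \<eta>) = (t + \<eta> * (1 - t)) / \<eta>" using assms by (simp add: field_simps)
    finally show ?thesis by simp
  qed
  note eq = this
  show ?thesis
    unfolding stieltjes_def eq by (simp only: integral_complex_of_real of_real_add of_real_mult)
qed

end

text \<open>
  The measure may be infinite on the whole line, as spectral measures are; every half line \<open>{..x}\<close> is assumed to have
  finite measure, and restricting to \<open>{..x + 1}\<close> reduces the claims to finite measures.
\<close>
lemma interval_measure_distribution: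
  fixes N :: "real measure"
  assumes sets[simp, measurable_cong]: "sets N = sets borel" and fin: "\<And>x. emeasure N {..x} < \<top>"
  defines "\<sigma> \<equiv> \<lambda>x. measure N {..x}"
  shows "mono \<sigma>" "\<And>x. continuous (at_right x) \<sigma>" "interval_measure \<sigma> = N"
proof -
  show mono: "mono \<sigma>"
    unfolding mono_def \<sigma>_def using fin by (auto intro!: measure_mono_fmeasurable simp: fmeasurable_def)
  show cont: "continuous (at_right x) \<sigma>" for x
  proof -
    let ?N = "density N (indicator {..x + 1})"
    have N: "emeasure ?N A = emeasure N ({..x + 1} \<inter> A)" if "A \<in> sets borel" for A
      using that by (subst emeasure_density) (auto simp: indicator_inter_arith[symmetric])
    have "finite_measure ?N" by (rule finite_measureI) (use fin[of "x + 1"] sets_eq_imp_space_eq[OF sets] in \<open>simp add: N less_top\<close>)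
    then interpret F: finite_borel_measure ?N by (simp add: finite_borel_measure_def finite_borel_measure_axioms_def)
    have cdf_eq: "cdf ?N t = \<sigma> t" if "t \<le> x + 1" for t
    proof -
      have "{..x + 1} \<inter> {..t} = {..t}" using that by auto
      then show ?thesis by (simp add: cdf_def measure_def N \<sigma>_def)
    qed
    have "(cdf ?N \<longlongrightarrow> cdf ?N x) (at_right x)"
      using F.cdf_is_right_cont[of x] by (simp add: continuous_within)
    moreover have "\<forall>\<^sub>F t in at_right x. cdf ?N t = \<sigma> t"
    proof -
      have "\<forall>\<^sub>F t in at_right x. t < x + 1" by (auto simp: eventually_at_right_field intro!: exI[of _ "x + 1"])
      then show ?thesis by eventually_elim (simp add: cdf_eq)
    qed
    ultimately have "(\<sigma> \<longlongrightarrow> cdf ?N x) (at_right x)" by (rule Lim_transform_eventually)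
    then show ?thesis by (simp add: continuous_within cdf_eq)
  qed
  have N_Ioc: "emeasure N {a<..b} = ennreal (\<sigma> b - \<sigma> a)" if "a \<le> b" for a b
  proof -
    have "emeasure N {..b} = emeasure N {..a} + emeasure N {a<..b}"
      using that by (subst plus_emeasure) (auto intro: arg_cong[of _ _ "emeasure N"])
    moreover have "emeasure N {..b} = ennreal (\<sigma> b)" "emeasure N {..a} = ennreal (\<sigma> a)"
      unfolding \<sigma>_def using fin by (simp_all add: emeasure_eq_ennreal_measure less_top[symmetric])
    ultimately have "emeasure N {a<..b} = ennreal (\<sigma> b) - ennreal (\<sigma> a)"
      by (simp add: ennreal_add_diff_cancel_left)
    then show ?thesis by (simp add: ennreal_minus \<sigma>_def)
  qed
  show "interval_measure \<sigma> = N"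
  proof (rule measure_eqI_generator_eq[where \<Omega>=UNIV])
    fix X assume "X \<in> range (\<lambda>(a, b). {a<..b::real})"
    then obtain a b where X: "X = {a<..b}" by auto
    show "emeasure (interval_measure \<sigma>) X = emeasure N X"
    proof (cases "a \<le> b")
      case True
      then show ?thesis unfolding X N_Ioc[OF True]
        by (intro emeasure_interval_measure_Ioc monoD[OF mono] cont)
    qed (simp add: X)
  next
    show "(\<Union>i. {- real (i::nat)<..real i}) = UNIV" by (rule UN_Ioc_eq_UNIV)
    show "emeasure (interval_measure \<sigma>) {- real i<..real i} \<noteq> \<infinity>" for i
      by (subst emeasure_interval_measure_Ioc) (auto intro: monoD[OF mono] cont)
  qed (auto simp: borel_sigma_sets_Ioc Int_stable_def)
qed

context compact_distribution
begin

text \<open>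
  The spectral measure is the image of \<open>Q\<close> with density \<open>m/t\<close> under \<open>t \<mapsto> \<lambda> = 1/t - 1\<close>. An atom of \<open>Q\<close> at \<open>t = 0\<close>
  has no image in \<open>[0,\<infinity>[\<close> and is added to the constant. The moment estimate is an inequality because the
  integral over \<open>Q\<close> also includes points that are mapped to \<open>\<lambda> = 0\<close>.
\<close>
lemma stieltjes_spectral_representation:
  assumes c: "0 \<le> c" and m: "0 \<le> m"
  obtains c' \<sigma> where "spectral_representation (Proper (restrict (stieltjes c m Q) slit_plane)) c' \<sigma>"
    "\<And>n. (\<integral>\<^sup>+u\<in>{0<..}. ennreal (u ^ n) \<partial>interval_measure \<sigma>)
        \<le> ennreal m * (\<integral>\<^sup>+t. ennreal ((1 - t) ^ n / t ^ Suc n) \<partial>Q)"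
proof -
  have Q1: "emeasure Q UNIV = 1" using emeasure_space_1 by simp
  define g where "g t = (if 0 < t \<and> t \<le> 1 then m / t else 0)" for t
  have g_nonneg: "0 \<le> g t" for t using m by (simp add: g_def)
  have [measurable]: "g \<in> borel_measurable borel" unfolding g_def by measurable
  define N where "N = distr (density Q (\<lambda>t. ennreal (g t))) borel (\<lambda>t. 1 / t - 1)"
  have sets_N[simp, measurable_cong]: "sets N = sets borel" by (simp add: N_def)
  have nn: "(\<integral>\<^sup>+u. f u \<partial>N) = (\<integral>\<^sup>+t. ennreal (g t) * f (1 / t - 1) \<partial>Q)" if [measurable]: "f \<in> borel_measurable borel" for f
    unfolding N_def by (simp add: nn_integral_distr nn_integral_density)
  have em: "emeasure N A = (\<integral>\<^sup>+t. ennreal (g t) * indicator A (1 / t - 1) \<partial>Q)" if "A \<in> sets borel" for A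
    using nn[of "indicator A"] that by simp
  have fin: "emeasure N {..x} < \<top>" for x
  proof -
    have "emeasure N {..x} \<le> (\<integral>\<^sup>+t. ennreal (m * (1 + \<bar>x\<bar>)) \<partial>Q)"
      unfolding em[of "{..x}", simplified]
    proof (rule nn_integral_mono)
      fix t
      have "ennreal (g t) \<le> ennreal (m * (1 + \<bar>x\<bar>))" if "1 / t - 1 \<le> x"
      proof (rule ennreal_leI)
        have "m * (1 / t) \<le> m * (1 + \<bar>x\<bar>)" using that m by (intro mult_left_mono) auto
        then show "g t \<le> m * (1 + \<bar>x\<bar>)" using m by (auto simp: g_def)
      qed
      then show "ennreal (g t) * indicator {..x} (1 / t - 1) \<le> ennreal (m * (1 + \<bar>x\<bar>))"
        by (auto simp: indicator_def)
    qed
    also have "\<dots> < \<top>" by (simp add: Q1)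
    finally show ?thesis .
  qed
  define \<sigma> where "\<sigma> x = measure N {..x}" for x
  note \<sigma> = interval_measure_distribution[OF sets_N fin, folded \<sigma>_def[abs_def]]
  have \<sigma>_neg: "\<sigma> x = 0" if "x < 0" for x
  proof -
    have "ennreal (g t) * indicator {..x} (1 / t - 1) = 0" for t
    proof (cases "0 < t \<and> t \<le> 1")
      case True
      then have "1 \<le> 1 / t" by simp
      then show ?thesis using that by auto
    qed (auto simp: g_def)
    note zero = this
    have "emeasure N {..x} = 0" unfolding em[of "{..x}", simplified] zero by simp
    then show ?thesis by (simp add: \<sigma>_def measure_def)
  qed
  define c' where "c' = c + m * measure Q {0}"
  have c': "0 \<le> c'" using c m by (simp add: c'_def)
  have fin_norm: "(\<integral>\<^sup>+u\<in>{0..}. ennreal (1 / (1 + u)) \<partial>interval_measure \<sigma>) < \<infinity>"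
  proof -
    have "(\<integral>\<^sup>+u\<in>{0..}. ennreal (1 / (1 + u)) \<partial>N) \<le> (\<integral>\<^sup>+t. ennreal m \<partial>Q)"
    proof (subst nn, measurable, rule nn_integral_mono)
      fix t
      show "ennreal (g t) * (ennreal (1 / (1 + (1 / t - 1))) * indicator {0..} (1 / t - 1)) \<le> ennreal m"
      proof (cases "0 < t \<and> t \<le> 1")
        case True
        then show ?thesis using m by (auto simp: g_def indicator_def ennreal_mult[symmetric])
      qed (auto simp: g_def)
    qed
    also have "\<dots> < \<infinity>" by (simp add: Q1)
    finally show ?thesis unfolding \<sigma>(3) .
  qed
  have rep: "stieltjes c m Q z = complex_of_real c' + (LINT u:{0..}|interval_measure \<sigma>. 1 / (complex_of_real u - z))"
    if z: "z \<in> slit_plane" for z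
  proof -
    have "(LINT u:{0..}|N. 1 / (complex_of_real u - z))
        = (LINT t|density Q (\<lambda>t. ennreal (g t)). indicator {0..} (1 / t - 1) *\<^sub>R (1 / (complex_of_real (1 / t - 1) - z)))"
      unfolding set_lebesgue_integral_def N_def by (rule integral_distr) auto
    also have "\<dots> = (LINT t|Q. g t *\<^sub>R (indicator {0..} (1 / t - 1) *\<^sub>R (1 / (complex_of_real (1 / t - 1) - z))))"
      by (rule integral_density) (auto simp: g_nonneg)
    also have "\<dots> = (LINT t|Q. complex_of_real m * (1 / (1 - complex_of_real t * (1 + z))) - complex_of_real m * indicator {0} t)"
    proof (intro integral_cong_AE eventually_mono[OF suppQ])
      fix t :: real assume t: "t \<in> {0..1}"
      show "g t *\<^sub>R (indicator {0..} (1 / t - 1) *\<^sub>R (1 / (complex_of_real (1 / t - 1) - z)))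
          = complex_of_real m * (1 / (1 - complex_of_real t * (1 + z))) - complex_of_real m * indicator {0} t"
      proof (cases "t = 0")
        case False
        then have t0: "0 < t" "t \<le> 1" using t by auto
        then have "1 \<le> 1 / t" by simp
        then have ind: "indicator {0..} (1 / t - 1) = (1::real)" by simp
        have tc: "complex_of_real t \<noteq> 0" using t0 by simp
        have "complex_of_real (1 / t - 1) - z = (1 - complex_of_real t * (1 + z)) / complex_of_real t"
          using tc by (simp add: diff_divide_distrib)
        then have "g t *\<^sub>R (1 / (complex_of_real (1 / t - 1) - z)) = complex_of_real m * (1 / (1 - complex_of_real t * (1 + z)))"
          using t0 tc by (simp add: g_def scaleR_conv_of_real)
        then show ?thesis using False ind by simp
      qed (simp add: g_def)
    qed measurable
    also have "\<dots> = complex_of_real m * (LINT t|Q. 1 / (1 - complex_of_real t * (1 + z))) - complex_of_real m * complex_of_real (measure Q {0})"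
    proof -
      have i1: "integrable Q (\<lambda>t. complex_of_real m * (1 / (1 - complex_of_real t * (1 + z))))"
        by (intro integrable_mult_right kernel_integrable z)
      have i2: "integrable Q (\<lambda>t. complex_of_real m * indicator {0} t)"
        by (intro integrable_mult_right integrable_real_indicator[THEN integrable_of_real, of "{0}", simplified of_real_indicator])
           (auto simp: less_top[symmetric] emeasure_eq_measure)
      have i3: "(LINT t|Q. (indicator {0} t :: complex)) = complex_of_real (measure Q {0})"
        by (subst of_real_indicator[symmetric], subst integral_complex_of_real) simp
      show ?thesis
        unfolding Bochner_Integration.integral_diff[OF i1 i2] integral_mult_right_zero i3 ..
    qed
    finally show ?thesis unfolding \<sigma>(3) by (simp add: stieltjes_def c'_def)
  qed
  have "spectral_representation (Proper (restrict (stieltjes c m Q) slit_plane)) c' \<sigma>"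
    unfolding spectral_representation_def
  proof (intro conjI allI impI c' \<sigma>(1,2) \<sigma>_neg fin_norm)
    show "Proper (restrict (stieltjes c m Q) slit_plane) = Proper (\<lambda>z\<in>slit_plane. complex_of_real c' +
        (LINT u:{0..}|interval_measure \<sigma>. 1 / (complex_of_real u - z)))"
      using rep by (auto simp: restrict_def fun_eq_iff)
  qed
  moreover have "(\<integral>\<^sup>+u\<in>{0<..}. ennreal (u ^ n) \<partial>interval_measure \<sigma>)
        \<le> ennreal m * (\<integral>\<^sup>+t. ennreal ((1 - t) ^ n / t ^ Suc n) \<partial>Q)" for n
  proof -
    have "(\<integral>\<^sup>+u\<in>{0<..}. ennreal (u ^ n) \<partial>N) \<le> (\<integral>\<^sup>+t. ennreal m * ennreal ((1 - t) ^ n / t ^ Suc n) \<partial>Q)"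
    proof (subst nn, measurable, rule nn_integral_mono)
      fix t
      show "ennreal (g t) * (ennreal ((1 / t - 1) ^ n) * indicator {0<..} (1 / t - 1)) \<le> ennreal m * ennreal ((1 - t) ^ n / t ^ Suc n)"
      proof (cases "0 < t \<and> t \<le> 1")
        case True
        have "(1 / t - 1) ^ n = (1 - t) ^ n / t ^ n"
          using True by (simp add: power_divide[symmetric] diff_divide_distrib)
        then have "g t * (1 / t - 1) ^ n = m * ((1 - t) ^ n / t ^ Suc n)"
          using True by (simp add: g_def)
        then show ?thesis using m g_nonneg[of t] True by (auto simp: indicator_def ennreal_mult'[symmetric])
      qed (auto simp: g_def)
    qed
    also have "\<dots> = ennreal m * (\<integral>\<^sup>+t. ennreal ((1 - t) ^ n / t ^ Suc n) \<partial>Q)"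
      by (rule nn_integral_cmult) measurable
    finally show ?thesis unfolding \<sigma>(3) .
  qed
  ultimately show thesis by (rule that)
qed

end

section \<open>The characteristic function as a transform of the limit\<close>

lemma slit_plane_open: "open slit_plane"
  unfolding slit_plane_def by (intro open_Compl closed_nonneg_Reals_complex)

lemma slit_plane_connected: "connected slit_plane"
proof -
  have "slit_plane = - (complex_of_real ` {0..})"
    unfolding slit_plane_def nonneg_Reals_def by (auto simp: image_def)
  then show ?thesis using starlike_imp_connected[OF starlike_slotted_complex_plane_right[of 0]] by simp
qed

lemma slit_plane_inverse: "z \<in> slit_plane \<Longrightarrow> 1 / z \<in> slit_plane" 
proof -
  assume z: "z \<in> slit_plane"
  then have "z \<noteq> 0" by (auto simp: slit_plane_iff)
  then have n: "0 < (cmod z)\<^sup>2" by simp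
  have "Re (1 / z) = Re z / (cmod z)\<^sup>2" "Im (1 / z) = - Im z / (cmod z)\<^sup>2"
    by (simp_all add: Re_divide Im_divide cmod_power2)
  then show ?thesis using z n by (auto simp: slit_plane_iff divide_neg_pos)
qed

text \<open>
  \<open>(1/(-z)) * (1 / (- (1/z) * V(1/z))) = 1 / V(1/z)\<close>.
\<close>
lemma minus_transform_Proper:
  "minus_transform (Proper (restrict V slit_plane)) =
    (if \<forall>z\<in>slit_plane. V z = 0 then Infinite else Proper (\<lambda>z\<in>slit_plane. 1 / V (1 / z)))"
proof (cases "\<forall>z\<in>slit_plane. V z = 0")
  case False
  have "(\<lambda>z\<in>slit_plane. 1 / (- z) * (restrict (\<lambda>z. 1 / (- z * restrict V slit_plane z)) slit_plane) (1 / z))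
      = (\<lambda>z\<in>slit_plane. 1 / V (1 / z))"
  proof (intro restrict_ext)
    fix z assume z: "z \<in> slit_plane"
    then have "z \<noteq> 0" by (auto simp: slit_plane_iff)
    then show "1 / (- z) * (restrict (\<lambda>z. 1 / (- z * restrict V slit_plane z)) slit_plane) (1 / z) = 1 / V (1 / z)"
      using slit_plane_inverse[OF z] by simp
  qed
  then show ?thesis using False by (simp add: minus_transform_def)
qed (simp add: minus_transform_def)

lemma neg_real_slit_plane: "z < 0 \<Longrightarrow> complex_of_real z \<in> slit_plane"
  by (simp add: slit_plane_iff)

lemma slit_plane_identity:
  assumes "f holomorphic_on slit_plane" "g holomorphic_on slit_plane"
    and eq: "\<And>x::real. x < 0 \<Longrightarrow> f (complex_of_real x) = g (complex_of_real x)" and z: "z \<in> slit_plane"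
  shows "f z = g z"
proof -
  have "f z - g z = 0"
  proof (rule analytic_continuation[of "\<lambda>z. f z - g z" slit_plane "complex_of_real ` {..<0}" "-1"])
    show "(\<lambda>z. f z - g z) holomorphic_on slit_plane" using assms by (intro holomorphic_intros)
    show "complex_of_real ` {..<0} \<subseteq> slit_plane" by (auto simp: neg_real_slit_plane)
    show "- 1 islimpt complex_of_real ` {..<0}"
      unfolding islimpt_sequential
    proof (intro exI conjI allI)
      show "complex_of_real (- 1 - 1 / real (Suc n)) \<in> complex_of_real ` {..<0} - {- 1}" for n
      proof -
        have "0 < 1 / real (Suc n)" by simp
        then have lt: "- 1 - 1 / real (Suc n) < - 1" by linarith
        have "complex_of_real (- 1 - 1 / real (Suc n)) \<noteq> complex_of_real (- 1)"
          unfolding of_real_eq_iff using lt by linarith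
        moreover have "- 1 - 1 / real (Suc n) \<in> {..<0}" unfolding lessThan_iff using lt by linarith
        ultimately show ?thesis by (intro DiffI imageI) (simp_all only: singleton_iff of_real_minus of_real_1 not_False_eq_True)
      qed
      have "(\<lambda>n. complex_of_real (- 1 - 1 / real (Suc n))) \<longlonglongrightarrow> complex_of_real (- 1 - 0)"
        by (intro tendsto_of_real tendsto_diff tendsto_const LIMSEQ_Suc[OF lim_1_over_n])
      then show "(\<lambda>n. complex_of_real (- 1 - 1 / real (Suc n))) \<longlonglongrightarrow> - 1" by simp
    qed
  qed (use slit_plane_open slit_plane_connected eq z in \<open>auto simp: slit_plane_iff\<close>)
  then show ?thesis by simp
qed

context krein_string
begin

text \<open>
  Translates limits along the extended half line, as used for strings, into statements about real truncation points.
\<close>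
lemma eventually_at_left_length:
  assumes L: "string_length M > 0" and P: "\<And>x. inside x \<Longrightarrow> 0 < x \<Longrightarrow> a < ennreal x \<Longrightarrow> P (ennreal x)" and a: "a < string_length M"
  shows "eventually P (at_left (string_length M))"
proof -
  have "max a 0 < string_length M" using L a by simp
  moreover have "P y" if y: "max a 0 < y" "y < string_length M" for y
  proof -
    obtain x where x: "y = ennreal x" "0 \<le> x" using y by (cases y) auto
    have "0 < y" using y(1) by (rule le_less_trans[rotated]) simp
    then show ?thesis using P[of x] y x by (auto simp: inside_def)
  qed
  ultimately show ?thesis using eventually_at_left[OF L] by blast
qed

lemma at_left_length_nontrivial: assumes L: "string_length M > 0" shows "at_left (string_length M) \<noteq> bot"
proof
  assume "at_left (string_length M) = bot"
  then have "eventually (\<lambda>_. False) (at_left (string_length M))" by simp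
  then obtain b where "b < string_length M" "\<forall>y>b. \<not> y < string_length M"
    using eventually_at_left[OF L] by auto
  then show False using dense by blast
qed

text \<open>
  At \<open>z = - \<eta>\<close> the quotient \<open>\<psi>/\<phi>\<close> is the reciprocal of \<open>trunc_weyl\<close>, so its limit is \<open>1 / V(- 1/\<eta>)\<close> if \<open>V\<close> does
  not vanish. A Stieltjes function vanishes either nowhere or identically; in the latter case \<open>trunc_weyl\<close> decreases to
  \<open>0\<close>, the quotient tends to infinity, and both sides are \<open>Infinite\<close>. Uniqueness of the continuation is the identity
  theorem.
\<close>
lemma characteristic_function_eq:
  assumes L: "string_length M > 0" and m: "0 \<le> m" and Q: "compact_distribution Q"
    and lim: "\<And>\<eta>. 0 < \<eta> \<Longrightarrow> weyl_limit \<eta> (inv_length + m * (\<integral>t. \<eta> / (t + \<eta> * (1 - t)) \<partial>Q))"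
  defines "V \<equiv> stieltjes inv_length m Q"
  shows "characteristic_function M = minus_transform (Proper (restrict V slit_plane))"
proof -
  interpret Q: compact_distribution Q by (rule Q)
  define v where "v \<eta> = inv_length + m * (\<integral>t. \<eta> / (t + \<eta> * (1 - t)) \<partial>Q)" for \<eta>
  have V_v: "V (complex_of_real (- 1 / \<eta>)) = complex_of_real (v \<eta>)" if "0 < \<eta>" for \<eta>
    unfolding V_def v_def by (rule Q.stieltjes_neg_real[OF that])
  obtain X where X: "\<And>j. inside (X j)" "\<And>j. 0 < X j" and X_inc: "incseq X"
    and X_ev: "\<And>x. inside x \<Longrightarrow> \<forall>\<^sub>F j in sequentially. x \<le> X j" and X_inv: "(\<lambda>j. 1 / X j) \<longlonglongrightarrow> inv_length"
    by (rule exhausting_sequence[OF L]) (rule that)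
  have X_lim: "(\<lambda>j. trunc_weyl \<eta> (X j)) \<longlonglongrightarrow> v \<eta>" if "0 < \<eta>" for \<eta>
    unfolding v_def by (rule weyl_limitD[OF lim[OF that] X X_ev])
  have v_le: "v \<eta> \<le> trunc_weyl \<eta> x" if \<eta>: "0 < \<eta>" and x: "inside x" "0 < x" for \<eta> x
  proof (rule LIMSEQ_le_const2[OF X_lim[OF \<eta>]])
    obtain N where "\<forall>j\<ge>N. x \<le> X j" using X_ev[OF x(1)] by (auto simp: eventually_sequentially)
    then show "\<exists>N. \<forall>j\<ge>N. trunc_weyl \<eta> (X j) \<le> trunc_weyl \<eta> x"
      using X x \<eta> by (intro exI[of _ N]) (auto intro!: trunc_weyl_antitone)
  qed
  have trunc_weyl_lim: "((\<lambda>x. trunc_weyl \<eta> (enn2real x)) \<longlongrightarrow> v \<eta>) (at_left (string_length M))" if \<eta>: "0 < \<eta>" for \<eta>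
  proof (rule order_tendstoI)
    fix a assume "a < v \<eta>"
    then show "\<forall>\<^sub>F x in at_left (string_length M). a < trunc_weyl \<eta> (enn2real x)"
      using v_le[OF \<eta>] by (intro eventually_at_left_length[OF L _ L]) (auto intro: less_le_trans)
  next
    fix a assume "v \<eta> < a"
    from order_tendstoD(2)[OF X_lim[OF \<eta>] this] obtain j where j: "trunc_weyl \<eta> (X j) < a"
      by (auto simp: eventually_sequentially)
    show "\<forall>\<^sub>F x in at_left (string_length M). trunc_weyl \<eta> (enn2real x) < a"
    proof (rule eventually_at_left_length[OF L])
      show "ennreal (X j) < string_length M" using X(1)[of j] by (simp add: inside_def)
      fix x assume x: "inside x" "0 < x" "ennreal (X j) < ennreal x"
      then have "X j \<le> x" using X(2)[of j] by (simp add: ennreal_less_iff)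
      then have "trunc_weyl \<eta> x \<le> trunc_weyl \<eta> (X j)" using x X \<eta> by (intro trunc_weyl_antitone) auto
      then show "trunc_weyl \<eta> (enn2real (ennreal x)) < a" using j x by simp
    qed
  qed
  define r where "r z x = string_psi M z (enn2real x) / string_phi M z (enn2real x)" for z x
  have r_wf: "r z x = inverse (trunc_weyl (- z) (enn2real x))" for z x
    by (simp add: r_def trunc_weyl_def)
  have L0: "string_length M \<noteq> 0" using L by auto
  have char: "characteristic_function M =
     (if \<forall>z<0. filterlim (r z) at_top (at_left (string_length M)) then Infinite
         else Proper (THE W. W \<in> extensional slit_plane \<and> W holomorphic_on slit_plane \<and>
                (\<forall>z<0. ((\<lambda>x. complex_of_real (r z x)) \<longlongrightarrow> W (complex_of_real z)) (at_left (string_length M)))))"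
    unfolding characteristic_function_def Let_def r_def using L0 by (simp only: if_False)
  show ?thesis
  proof (cases "inv_length = 0 \<and> m = 0")
    case True
    have v0: "v \<eta> = 0" for \<eta> using True by (simp add: v_def)
    have "filterlim (r z) at_top (at_left (string_length M))" if z: "z < 0" for z
      unfolding r_wf
    proof (rule filterlim_inverse_at_top)
      show "((\<lambda>x. trunc_weyl (- z) (enn2real x)) \<longlongrightarrow> 0) (at_left (string_length M))"
        using trunc_weyl_lim[of "- z"] z v0 by simp
      have "0 < trunc_weyl (- z) x" if x: "inside x" "0 < x" for x
        using phi_ge_1[OF x, of "- z"] psi_pos[OF x, of "- z"] z by (simp add: trunc_weyl_def)
      then show "\<forall>\<^sub>F x in at_left (string_length M). 0 < trunc_weyl (- z) (enn2real x)"
        by (intro eventually_at_left_length[OF L _ L]) auto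
    qed
    moreover have "V z = 0" for z using True by (simp add: V_def stieltjes_def)
    ultimately show ?thesis by (simp add: char minus_transform_Proper)
  next
    case False
    then have pos: "0 < inv_length \<or> 0 < m" using inv_length_nonneg m by auto
    have V_nz: "V z \<noteq> 0" if "z \<in> slit_plane" for z
      unfolding V_def using Q.stieltjes_nonzero[OF that inv_length_nonneg m pos] .
    have v_nz: "v \<eta> \<noteq> 0" if \<eta>: "0 < \<eta>" for \<eta>
    proof -
      have "complex_of_real (- 1 / \<eta>) \<in> slit_plane" using \<eta> by (intro neg_real_slit_plane) simp
      from V_nz[OF this] show ?thesis unfolding V_v[OF \<eta>] by simp
    qed
    have r_lim: "(r z \<longlongrightarrow> inverse (v (- z))) (at_left (string_length M))" if z: "z < 0" for z
      unfolding r_wf using z by (intro tendsto_inverse trunc_weyl_lim v_nz) auto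
    have not_inf: "\<not> (\<forall>z<0. filterlim (r z) at_top (at_left (string_length M)))"
    proof
      assume "\<forall>z<0. filterlim (r z) at_top (at_left (string_length M))"
      then have "filterlim (r (- 1)) at_top (at_left (string_length M))" by simp
      then have "filterlim (r (- 1)) at_infinity (at_left (string_length M))"
        by (rule filterlim_at_top_imp_at_infinity)
      then show False
        using not_tendsto_and_filterlim_at_infinity[OF at_left_length_nontrivial[OF L] r_lim[of "-1"]] by simp
    qed
    define W where "W = (\<lambda>z\<in>slit_plane. 1 / V (1 / z))"
    have W_neg: "W (complex_of_real z) = complex_of_real (inverse (v (- z)))" if z: "z < 0" for z
    proof -
      have "1 / complex_of_real z = complex_of_real (- 1 / (- z))" by simp
      then have "V (1 / complex_of_real z) = complex_of_real (v (- z))" using V_v[of "- z"] z by simp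
      then show ?thesis using neg_real_slit_plane[OF z] by (simp add: W_def divide_inverse)
    qed
    have W_hol: "W holomorphic_on slit_plane"
    proof -
      have "(\<lambda>z. V (1 / z)) holomorphic_on slit_plane"
      proof (rule holomorphic_on_compose_gen[of "\<lambda>z. 1 / z" slit_plane V slit_plane, unfolded comp_def])
        show "(\<lambda>z. 1 / z) holomorphic_on slit_plane"
          by (intro holomorphic_intros) (auto simp: slit_plane_iff)
        show "V holomorphic_on slit_plane" unfolding V_def by (rule Q.stieltjes_holomorphic)
        show "(\<lambda>z. 1 / z) ` slit_plane \<subseteq> slit_plane" using slit_plane_inverse by auto
      qed
      then have "(\<lambda>z. 1 / V (1 / z)) holomorphic_on slit_plane"
        by (intro holomorphic_intros) (use V_nz slit_plane_inverse in auto)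
      then show ?thesis by (rule holomorphic_transform) (simp add: W_def)
    qed
    have "(THE W. W \<in> extensional slit_plane \<and> W holomorphic_on slit_plane \<and>
                (\<forall>z<0. ((\<lambda>x. complex_of_real (r z x)) \<longlongrightarrow> W (complex_of_real z)) (at_left (string_length M)))) = W"
    proof (rule the_equality)
      show "W \<in> extensional slit_plane \<and> W holomorphic_on slit_plane \<and>
                (\<forall>z<0. ((\<lambda>x. complex_of_real (r z x)) \<longlongrightarrow> W (complex_of_real z)) (at_left (string_length M)))"
      proof (intro conjI allI impI W_hol)
        show "W \<in> extensional slit_plane" by (simp add: W_def)
        show "((\<lambda>x. complex_of_real (r z x)) \<longlongrightarrow> W (complex_of_real z)) (at_left (string_length M))" if "z < 0" for z
          unfolding W_neg[OF that] by (intro tendsto_of_real r_lim that)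
      qed
    next
      fix W'
      assume W': "W' \<in> extensional slit_plane \<and> W' holomorphic_on slit_plane \<and>
                (\<forall>z<0. ((\<lambda>x. complex_of_real (r z x)) \<longlongrightarrow> W' (complex_of_real z)) (at_left (string_length M)))"
      have eq: "W' (complex_of_real z) = W (complex_of_real z)" if z: "z < 0" for z
      proof (rule tendsto_unique[OF at_left_length_nontrivial[OF L]])
        show "((\<lambda>x. complex_of_real (r z x)) \<longlongrightarrow> W' (complex_of_real z)) (at_left (string_length M))"
          using W' z by blast
        show "((\<lambda>x. complex_of_real (r z x)) \<longlongrightarrow> W (complex_of_real z)) (at_left (string_length M))"
          unfolding W_neg[OF z] by (intro tendsto_of_real r_lim z)
      qed
      show "W' = W"
      proof (rule extensionalityI)
        show "W' \<in> extensional slit_plane" using W' by blast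
        show "W \<in> extensional slit_plane" by (simp add: W_def)
        show "W' z = W z" if "z \<in> slit_plane" for z
          using slit_plane_identity[OF conjunct1[OF conjunct2[OF W']] W_hol eq that] .
      qed
    qed
    moreover have "\<not> (\<forall>z\<in>slit_plane. V z = 0)"
      using V_nz neg_real_slit_plane[of "-1"] by auto
    ultimately show ?thesis using not_inf by (simp add: char minus_transform_Proper W_def)
  qed
qed

text \<open>
  Induction on \<open>n\<close> shows that the resolvent moments of order \<open>n\<close> converge to those of \<open>T\<close>, called \<open>R\<close> in the proof.
  Suppose this is known for \<open>n\<close>. Since resolvent moments increase with the string,
  \<open>trunc_moment n x = trunc_rho \<eta> n x + \<eta> * trunc_rho \<eta> (Suc n) x\<close> is at most \<open>\<integral> u\<^sup>n dT\<close> plus a term that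
  vanishes with \<open>\<eta>\<close> for fixed \<open>x\<close>; this is the asserted bound. On the other hand
  \<open>trunc_moment n x \<ge> trunc_rho \<eta> n x\<close>, whose limit is close to \<open>\<integral> u\<^sup>n dT\<close> for small \<open>\<eta>\<close>, so the moments of order \<open>n\<close>
  converge, and the recursion of the resolvent moments passes to order \<open>n + 1\<close>. The start of the induction identifies \<open>c\<close>
  with \<open>1/L\<close>.
\<close>
lemma moments_bounded_by_limit:
  assumes L: "string_length M > 0" and T: "finite_measure T" and sets_T[simp, measurable_cong]: "sets T = sets borel"
    and AE_T: "AE u in T. 0 \<le> u" and T_int: "\<And>n. integrable T (\<lambda>u. u ^ n)"
    and lim: "\<And>\<eta>. 0 < \<eta> \<Longrightarrow> weyl_limit \<eta> (c + \<eta> * (\<integral>u. 1 / (1 + \<eta> * u) \<partial>T))"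
    and x: "inside x" "0 < x"
  shows "trunc_moment n x \<le> (\<integral>u. u ^ n \<partial>T)"
proof -
  interpret T: finite_measure T by (rule T)
  obtain X where X: "\<And>j. inside (X j)" "\<And>j. 0 < X j" and X_inc: "incseq X"
    and X_ev: "\<And>x. inside x \<Longrightarrow> \<forall>\<^sub>F j in sequentially. x \<le> X j" and X_inv: "(\<lambda>j. 1 / X j) \<longlonglongrightarrow> inv_length"
    by (rule exhausting_sequence[OF L]) (rule that)
  define s where "s n = (\<integral>u. u ^ n \<partial>T)" for n
  define R where "R \<eta> n = (\<integral>u. u ^ n / (1 + \<eta> * u) \<partial>T)" for \<eta> n
  have k_bd: "0 \<le> u ^ n / (1 + \<eta> * u) \<and> u ^ n / (1 + \<eta> * u) \<le> u ^ n" if "0 < \<eta>" "0 \<le> u" for u \<eta> :: real and n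
  proof -
    have "1 \<le> 1 + \<eta> * u" using that by simp
    moreover have "0 \<le> u ^ n" using that by simp
    moreover have "0 \<le> p / k \<and> p / k \<le> p" if "0 \<le> p" "1 \<le> k" for p k :: real
      using that divide_left_mono[of 1 k p] by simp
    ultimately show ?thesis by blast
  qed
  have R_int: "integrable T (\<lambda>u. u ^ n / (1 + \<eta> * u))" if \<eta>: "0 < \<eta>" for \<eta> n
  proof (rule Bochner_Integration.integrable_bound[OF T_int[of n]])
    show "AE u in T. norm (u ^ n / (1 + \<eta> * u)) \<le> norm (u ^ n)"
    proof (rule eventually_mono[OF AE_T])
      fix u :: real assume "0 \<le> u"
      from k_bd[OF \<eta> this, of n] show "norm (u ^ n / (1 + \<eta> * u)) \<le> norm (u ^ n)"
        unfolding real_norm_def by linarith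
    qed
  qed measurable
  have R_nonneg: "0 \<le> R \<eta> n" if \<eta>: "0 < \<eta>" for \<eta> n
    unfolding R_def by (intro integral_nonneg_AE eventually_mono[OF AE_T]) (use k_bd[OF \<eta>] in auto)
  have R_le: "R \<eta> n \<le> s n" if \<eta>: "0 < \<eta>" for \<eta> n
    unfolding R_def s_def by (intro integral_mono_AE R_int T_int \<eta> eventually_mono[OF AE_T]) (use k_bd[OF \<eta>] in auto)
  have R_rec: "\<eta> * R \<eta> (Suc n) = s n - R \<eta> n" if \<eta>: "0 < \<eta>" for \<eta> n
  proof -
    have "\<eta> * R \<eta> (Suc n) = (\<integral>u. \<eta> * (u ^ Suc n / (1 + \<eta> * u)) \<partial>T)"
      unfolding R_def by (rule integral_mult_right_zero[symmetric])
    also have "\<dots> = (\<integral>u. u ^ n - u ^ n / (1 + \<eta> * u) \<partial>T)"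
    proof (intro integral_cong_AE eventually_mono[OF AE_T])
      fix u :: real assume "0 \<le> u"
      then have "0 < 1 + \<eta> * u" using \<eta> by (simp add: add_pos_nonneg)
      moreover have "\<eta> * (a * u / k) = a - a / k" if "0 < k" "k = 1 + \<eta> * u" for k a :: real
        using that(1) unfolding that(2) by (simp add: field_simps)
      ultimately show "\<eta> * (u ^ Suc n / (1 + \<eta> * u)) = u ^ n - u ^ n / (1 + \<eta> * u)"
        by (simp only: power_Suc2)
    qed measurable
    also have "\<dots> = s n - R \<eta> n"
      unfolding s_def R_def by (intro Bochner_Integration.integral_diff T_int R_int \<eta>)
    finally show ?thesis .
  qed
  \<comment> \<open>The limit \<open>\<eta> \<rightarrow> 0\<close> in an inequality.\<close>
  have at0: "a \<le> b" if "\<And>\<eta>::real. 0 < \<eta> \<Longrightarrow> a \<le> b + \<eta> * k" for a b k :: real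
  proof (rule tendsto_lowerbound[of "\<lambda>\<eta>. b + \<eta> * k" "b + 0 * k" "at_right 0", simplified])
    show "((\<lambda>\<eta>. b + \<eta> * k) \<longlongrightarrow> b) (at_right 0)"
      by (rule tendsto_eq_intros refl | simp)+
    show "\<forall>\<^sub>F \<eta> in at_right 0. a \<le> b + \<eta> * k"
      using that by (auto simp: eventually_at_filter)
  qed
  have trunc_weyl_lim: "(\<lambda>j. trunc_weyl \<eta> (X j)) \<longlonglongrightarrow> c + \<eta> * R \<eta> 0" if \<eta>: "0 < \<eta>" for \<eta>
    using weyl_limitD[OF lim[OF \<eta>] X X_ev] by (simp add: R_def)
  have c_eq: "c = inv_length"
  proof (rule antisym)
    have "c \<le> 1 / X i" for i
    proof (rule at0)
      fix \<eta> :: real assume \<eta>: "0 < \<eta>"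
      have "c + \<eta> * R \<eta> 0 \<le> trunc_weyl \<eta> (X i)"
      proof (rule LIMSEQ_le_const2[OF trunc_weyl_lim[OF \<eta>]])
        show "\<exists>N. \<forall>j\<ge>N. trunc_weyl \<eta> (X j) \<le> trunc_weyl \<eta> (X i)"
          using X X_inc \<eta> by (intro exI[of _ i]) (auto intro!: trunc_weyl_antitone simp: incseq_def)
      qed
      also have "\<dots> = 1 / X i + \<eta> * trunc_rho \<eta> 0 (X i)" by (rule trunc_weyl_eq[OF X \<eta>])
      also have "\<dots> \<le> 1 / X i + \<eta> * trunc_moment 0 (X i)"
        using trunc_rho_le_moment[OF X \<eta>] \<eta> by (intro add_left_mono mult_left_mono) auto
      finally show "c \<le> 1 / X i + \<eta> * trunc_moment 0 (X i)" using R_nonneg[OF \<eta>, of 0] \<eta> by (smt (verit) mult_nonneg_nonneg)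
    qed
    then show "c \<le> inv_length" by (intro LIMSEQ_le_const[OF X_inv]) auto
    show "inv_length \<le> c"
    proof (rule at0)
      fix \<eta> :: real assume \<eta>: "0 < \<eta>"
      have "inv_length \<le> c + \<eta> * R \<eta> 0"
      proof (rule LIMSEQ_le[OF X_inv trunc_weyl_lim[OF \<eta>]])
        show "\<exists>N. \<forall>j\<ge>N. 1 / X j \<le> trunc_weyl \<eta> (X j)"
          using trunc_weyl_eq[OF X \<eta>] trunc_rho_nonneg[OF X \<eta>] \<eta> by auto
      qed
      also have "\<dots> \<le> c + \<eta> * s 0" using R_le[OF \<eta>, of 0] \<eta> by (intro add_left_mono mult_left_mono) auto
      finally show "inv_length \<le> c + \<eta> * s 0" .
    qed
  qed
  have trunc_rho_below: "trunc_rho \<eta> n x \<le> R \<eta> n" if A: "(\<lambda>j. trunc_rho \<eta> n (X j)) \<longlonglongrightarrow> R \<eta> n" and \<eta>: "0 < \<eta>" and x: "inside x" "0 < x" for \<eta> n x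
  proof (rule LIMSEQ_le_const[OF A])
    obtain N where "\<forall>j\<ge>N. x \<le> X j" using X_ev[OF x(1)] by (auto simp: eventually_sequentially)
    then show "\<exists>N. \<forall>j\<ge>N. trunc_rho \<eta> n x \<le> trunc_rho \<eta> n (X j)"
      using X x \<eta> by (intro exI[of _ N]) (auto intro!: trunc_rho_mono)
  qed
  have mom_le: "trunc_moment n x \<le> s n" if A: "\<And>\<eta>. 0 < \<eta> \<Longrightarrow> (\<lambda>j. trunc_rho \<eta> n (X j)) \<longlonglongrightarrow> R \<eta> n" and x: "inside x" "0 < x" for n x
  proof (rule at0)
    fix \<eta> :: real assume \<eta>: "0 < \<eta>"
    have "trunc_moment n x = trunc_rho \<eta> n x + \<eta> * trunc_rho \<eta> (Suc n) x" using trunc_rho_rec[OF x \<eta>, of n] by simp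
    also have "\<dots> \<le> s n + \<eta> * trunc_moment (Suc n) x"
      using order_trans[OF trunc_rho_below[OF A[OF \<eta>] \<eta> x] R_le[OF \<eta>]] trunc_rho_le_moment[OF x \<eta>, of "Suc n"] \<eta>
      by (intro add_mono mult_left_mono) auto
    finally show "trunc_moment n x \<le> s n + \<eta> * trunc_moment (Suc n) x" .
  qed
  have main: "(\<lambda>j. trunc_rho \<eta> n (X j)) \<longlonglongrightarrow> R \<eta> n" if "0 < \<eta>" for \<eta> n
    using that
  proof (induction n arbitrary: \<eta>)
    case 0
    have "(\<lambda>j. (trunc_weyl \<eta> (X j) - 1 / X j) / \<eta>) \<longlonglongrightarrow> (c + \<eta> * R \<eta> 0 - inv_length) / \<eta>"
      using 0 by (intro tendsto_divide tendsto_diff trunc_weyl_lim X_inv tendsto_const) auto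
    moreover have "(trunc_weyl \<eta> (X j) - 1 / X j) / \<eta> = trunc_rho \<eta> 0 (X j)" for j
      using 0 unfolding trunc_weyl_eq[OF X 0] by simp
    ultimately show ?case using 0 by (simp add: c_eq)
  next
    case (Suc n)
    have mom_lim: "(\<lambda>j. trunc_moment n (X j)) \<longlonglongrightarrow> s n"
    proof (rule order_tendstoI)
      fix a assume a: "a < s n"
      obtain \<eta>' where \<eta>': "0 < \<eta>'" "\<eta>' * s (Suc n) < s n - a"
      proof -
        have s0: "0 \<le> s (Suc n)" using R_le[of 1 "Suc n"] R_nonneg[of 1 "Suc n"] by simp
        have "(s n - a) / (s (Suc n) + 1) * s (Suc n) < s n - a"
        proof -
          have "(s n - a) * s (Suc n) < (s n - a) * (s (Suc n) + 1)" using a by (intro mult_strict_left_mono) auto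
          then show ?thesis using s0 by (simp add: divide_less_eq)
        qed
        then show thesis using a s0 by (intro that[of "(s n - a) / (s (Suc n) + 1)"]) auto
      qed
      have "\<eta>' * R \<eta>' (Suc n) \<le> \<eta>' * s (Suc n)" using R_le[OF \<eta>'(1)] \<eta>'(1) by (intro mult_left_mono) auto
      then have "a < R \<eta>' n" using R_rec[OF \<eta>'(1), of n] \<eta>'(2) by linarith
      from order_tendstoD(1)[OF Suc.IH[OF \<eta>'(1)] this]
      show "\<forall>\<^sub>F j in sequentially. a < trunc_moment n (X j)"
        by eventually_elim (use trunc_rho_le_moment[OF X \<eta>'(1)] in \<open>auto intro: less_le_trans\<close>)
    next
      fix a assume "s n < a"
      then have "trunc_moment n (X j) < a" for j using mom_le[OF Suc.IH X] by (rule le_less_trans[rotated])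
      then show "\<forall>\<^sub>F j in sequentially. trunc_moment n (X j) < a" by simp
    qed
    have "(\<lambda>j. (trunc_moment n (X j) - trunc_rho \<eta> n (X j)) / \<eta>) \<longlonglongrightarrow> (s n - R \<eta> n) / \<eta>"
      using Suc.prems by (intro tendsto_divide tendsto_diff mom_lim Suc.IH tendsto_const) auto
    moreover have "(trunc_moment n (X j) - trunc_rho \<eta> n (X j)) / \<eta> = trunc_rho \<eta> (Suc n) (X j)" for j
      using Suc.prems unfolding trunc_rho_rec[OF X Suc.prems, symmetric] by simp
    moreover have "(s n - R \<eta> n) / \<eta> = R \<eta> (Suc n)"
      using Suc.prems unfolding R_rec[OF Suc.prems, symmetric] by simp
    ultimately show ?case by simp
  qed
  show ?thesis using mom_le[OF main x] by (simp add: s_def)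
qed

end

text \<open>
  The moment conditions exclude the point \<open>0\<close>, where a spectral measure may only have a finite atom. So they
  make the whole measure finite and all its moments integrable.
\<close>
lemma spectral_distribution_finite_measure:
  assumes rep: "spectral_representation W c \<sigma>"
    and mom_fin: "\<And>n::nat. (\<integral>\<^sup>+u\<in>{0<..}. ennreal (u ^ n) \<partial>interval_measure \<sigma>) < \<infinity>"
  defines "T \<equiv> density (interval_measure \<sigma>) (indicator {0..})"
  shows "finite_measure T" "AE u in T. 0 \<le> u" "\<And>n. integrable T (\<lambda>u. u ^ n)"
    "\<And>z. z \<in> slit_plane \<Longrightarrow> (LINT u:{0..}|interval_measure \<sigma>. 1 / (complex_of_real u - z)) = (LINT u|T. 1 / (complex_of_real u - z))"
proof -
  have mono: "mono \<sigma>" and cont: "\<And>x. continuous (at_right x) \<sigma>" and neg: "\<And>x. x < 0 \<Longrightarrow> \<sigma> x = 0"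
    using rep by (auto simp: spectral_representation_def)
  let ?S = "interval_measure \<sigma>"
  have S0: "emeasure ?S {0} < \<top>"
  proof -
    have "emeasure ?S {0} \<le> emeasure ?S {-1<..0}" by (intro emeasure_mono) auto
    also have "\<dots> = ennreal (\<sigma> 0 - \<sigma> (-1))" by (intro emeasure_interval_measure_Ioc monoD[OF mono] cont) auto
    finally show ?thesis by (rule le_less_trans) simp
  qed
  have sets_T[simp, measurable_cong]: "sets T = sets borel" by (simp add: T_def)
  have T_nn: "(\<integral>\<^sup>+u. f u \<partial>T) = (\<integral>\<^sup>+u. indicator {0..} u * f u \<partial>?S)" if [measurable]: "f \<in> borel_measurable borel" for f
    unfolding T_def by (rule nn_integral_density) auto
  have T_mom: "(\<integral>\<^sup>+u. ennreal (u ^ n) \<partial>T) < \<infinity>" for n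
  proof -
    have "(\<integral>\<^sup>+u. ennreal (u ^ n) \<partial>T) \<le> (\<integral>\<^sup>+u. indicator {0} u + ennreal (u ^ n) * indicator {0<..} u \<partial>?S)"
      unfolding T_nn[of "\<lambda>u. ennreal (u ^ n)", simplified]
      by (intro nn_integral_mono) (cases n, auto simp: indicator_def)
    also have "\<dots> = emeasure ?S {0} + (\<integral>\<^sup>+u\<in>{0<..}. ennreal (u ^ n) \<partial>?S)"
      by (subst nn_integral_add) auto
    also have "\<dots> < \<infinity>" using S0 mom_fin[of n] by (simp add: less_top)
    finally show ?thesis .
  qed
  show AE: "AE u in T. 0 \<le> u"
    unfolding T_def by (subst AE_density) (auto simp: indicator_def)
  show "finite_measure T"
    using T_mom[of 0] by (intro finite_measureI) (simp add: less_top nn_integral_const)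
  show "integrable T (\<lambda>u. u ^ n)" for n
  proof (rule integrableI_nonneg)
    show "AE u in T. 0 \<le> u ^ n" using AE by eventually_elim simp
  qed (use T_mom[of n] in auto)
  show "(LINT u:{0..}|?S. 1 / (complex_of_real u - z)) = (LINT u|T. 1 / (complex_of_real u - z))"
    if z: "z \<in> slit_plane" for z
  proof -
    have "T = density ?S (\<lambda>u. ennreal (indicator {0..} u))"
      unfolding T_def by (intro arg_cong[of _ _ "density ?S"]) (auto simp: ennreal_indicator fun_eq_iff)
    then have "(LINT u|T. 1 / (complex_of_real u - z)) = (LINT u|?S. indicator {0..} u *\<^sub>R (1 / (complex_of_real u - z)))"
      by (simp only:) (rule integral_density, auto)
    then show ?thesis by (simp only: set_lebesgue_integral_def)
  qed
qed

context krein_string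
begin

definition moments_bounded :: bool where
  "moments_bounded \<longleftrightarrow> (\<forall>n. \<exists>B. \<forall>x. inside x \<longrightarrow> 0 < x \<longrightarrow> trunc_moment n x \<le> B)"

text \<open>
  By \<open>characteristic_function_eq\<close> the string belongs to \<open>M_minus\<close> if the limit function \<open>V\<close> belongs to \<open>W_plus\<close>, and
  bounded moments imply the latter through \<open>limit_measure\<close> and \<open>stieltjes_spectral_representation\<close>. Conversely, the
  transform is injective, so a function in \<open>W_plus\<close> with the same transform equals \<open>V\<close>, and its
  spectral measure bounds the moments by \<open>moments_bounded_by_limit\<close>. The function \<open>Infinite\<close> in \<open>W_plus\<close> cannot occur: its transform
  is \<open>0\<close>, which \<open>1 / V(1/z)\<close> never is.
\<close>
theorem M_minus_iff_moments_bounded: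
  assumes L: "string_length M > 0"
  shows "M \<in> M_minus \<longleftrightarrow> moments_bounded"
proof (rule limit_measure[OF L])
  fix m Q
  assume m: "0 \<le> m" and Q_rd: "real_distribution Q" and Q_supp: "AE t in Q. t \<in> {0..1}"
    and lim: "\<And>\<eta>. 0 < \<eta> \<Longrightarrow> weyl_limit \<eta> (inv_length + m * (\<integral>t. \<eta> / (t + \<eta> * (1 - t)) \<partial>Q))"
    and bound: "\<And>n B. (\<And>x. inside x \<Longrightarrow> 0 < x \<Longrightarrow> trunc_moment n x \<le> B) \<Longrightarrow>
        ennreal m * (\<integral>\<^sup>+t. ennreal ((1 - t) ^ n / t ^ Suc n) \<partial>Q) \<le> ennreal B"
  have Q: "compact_distribution Q"
    using Q_rd Q_supp by (simp add: compact_distribution_def compact_distribution_axioms_def)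
  interpret Q: compact_distribution Q by (rule Q)
  define V where "V = stieltjes inv_length m Q"
  have char: "characteristic_function M = minus_transform (Proper (restrict V slit_plane))"
    unfolding V_def by (rule characteristic_function_eq[OF L m Q lim])
  show ?thesis
  proof
    assume B: moments_bounded
    show "M \<in> M_minus"
    proof (rule Q.stieltjes_spectral_representation[OF inv_length_nonneg m])
      fix c' \<sigma>
      assume rep: "spectral_representation (Proper (restrict (stieltjes inv_length m Q) slit_plane)) c' \<sigma>"
        and mom_fin: "\<And>n. (\<integral>\<^sup>+u\<in>{0<..}. ennreal (u ^ n) \<partial>interval_measure \<sigma>)
        \<le> ennreal m * (\<integral>\<^sup>+t. ennreal ((1 - t) ^ n / t ^ Suc n) \<partial>Q)"
      have "(\<integral>\<^sup>+u\<in>{0<..}. ennreal (u ^ n) \<partial>interval_measure \<sigma>) < \<infinity>" for n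
      proof -
        obtain b where "\<And>x. inside x \<Longrightarrow> 0 < x \<Longrightarrow> trunc_moment n x \<le> b" using B by (auto simp: moments_bounded_def)
        from order_trans[OF mom_fin bound[OF this]] show ?thesis by (rule le_less_trans) auto
      qed
      then have "Proper (restrict V slit_plane) \<in> W_plus"
        unfolding W_plus_def W_class_def V_def using rep by auto
      then show "M \<in> M_minus" using krein char by (auto simp: M_minus_def W_minus_def)
    qed
  next
    assume "M \<in> M_minus"
    then obtain W where W: "W \<in> W_plus" and eq: "minus_transform (Proper (restrict V slit_plane)) = minus_transform W"
      using char by (auto simp: M_minus_def W_minus_def)
    have m1: "- 1 \<in> slit_plane" by (simp add: slit_plane_iff)
    have V_zero: "V z = 0" if "V (- 1) = 0" for z
    proof -
      have "\<not> (0 < inv_length \<or> 0 < m)"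
        using Q.stieltjes_nonzero[OF m1 inv_length_nonneg m] that by (auto simp: V_def)
      then have "inv_length = 0" "m = 0" using inv_length_nonneg m by auto
      then show ?thesis by (simp add: V_def stieltjes_def)
    qed
    have "W \<noteq> Infinite"
    proof
      assume inf: "W = Infinite"
      have "minus_transform W = Proper (\<lambda>z\<in>slit_plane. 1 / (- z) * (restrict (\<lambda>z. 0) slit_plane) (1 / z))"
        unfolding inf by (simp add: minus_transform_def)
      then have "Proper (\<lambda>z\<in>slit_plane. 1 / V (1 / z)) = Proper (\<lambda>z\<in>slit_plane. 1 / (- z) * (restrict (\<lambda>z. 0) slit_plane) (1 / z))"
        and nz: "\<not> (\<forall>z\<in>slit_plane. V z = 0)"
        using eq by (auto simp: minus_transform_Proper split: if_splits)
      then have "(\<lambda>z\<in>slit_plane. 1 / V (1 / z)) (- 1) = (\<lambda>z\<in>slit_plane. 1 / (- z) * (restrict (\<lambda>z. 0) slit_plane) (1 / z)) (- 1)"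
        by simp
      then have "V (- 1) = 0" using m1 by simp
      then show False using nz V_zero by simp
    qed
    then obtain c \<sigma> where rep: "spectral_representation W c \<sigma>"
      and mom_fin: "\<And>n::nat. (\<integral>\<^sup>+u\<in>{0<..}. ennreal (u ^ n) \<partial>interval_measure \<sigma>) < \<infinity>"
      using W by (auto simp: W_plus_def)
    define V' where "V' z = complex_of_real c + (LINT u:{0..}|interval_measure \<sigma>. 1 / (complex_of_real u - z))" for z
    have W_eq: "W = Proper (restrict V' slit_plane)"
      using rep by (simp add: spectral_representation_def V'_def[abs_def])
    have V_V': "V z = V' z" if z: "z \<in> slit_plane" for z
    proof (cases "\<forall>z\<in>slit_plane. V z = 0")
      case True
      then have "\<forall>z\<in>slit_plane. V' z = 0"
        using eq unfolding W_eq minus_transform_Proper by (auto split: if_splits)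
      then show ?thesis using True z by simp
    next
      case False
      then have "(\<lambda>z\<in>slit_plane. 1 / V (1 / z)) = (\<lambda>z\<in>slit_plane. 1 / V' (1 / z))"
        using eq unfolding W_eq minus_transform_Proper by (auto split: if_splits)
      from fun_cong[OF this, of "1 / z"] show ?thesis using slit_plane_inverse[OF z] by simp
    qed
    define T where "T = density (interval_measure \<sigma>) (indicator {0..})"
    note T = spectral_distribution_finite_measure[OF rep mom_fin, folded T_def]
    have sets_T: "sets T = sets borel" by (simp add: T_def)
    have lim': "weyl_limit \<eta> (c + \<eta> * (\<integral>u. 1 / (1 + \<eta> * u) \<partial>T))" if \<eta>: "0 < \<eta>" for \<eta>
    proof -
      define z where "z = complex_of_real (- 1 / \<eta>)"
      have z: "z \<in> slit_plane" unfolding z_def by (rule neg_real_slit_plane) (use \<eta> in simp)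
      have "(LINT u|T. 1 / (complex_of_real u - z)) = (LINT u|T. complex_of_real (\<eta> * (1 / (1 + \<eta> * u))))"
      proof (rule Bochner_Integration.integral_cong[OF refl])
        fix u
        have "u + 1 / \<eta> = (1 + \<eta> * u) / \<eta>" using \<eta> by (simp add: field_simps)
        then have "1 / (u + 1 / \<eta>) = \<eta> * (1 / (1 + \<eta> * u))" by simp
        moreover have "complex_of_real u - z = complex_of_real (u + 1 / \<eta>)" by (simp add: z_def)
        ultimately show "1 / (complex_of_real u - z) = complex_of_real (\<eta> * (1 / (1 + \<eta> * u)))"
          by (metis of_real_1 of_real_divide)
      qed
      then have "V' z = complex_of_real (c + \<eta> * (\<integral>u. 1 / (1 + \<eta> * u) \<partial>T))"
        unfolding V'_def T(4)[OF z] by (simp only: integral_complex_of_real integral_mult_right_zero of_real_add)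
      then have "complex_of_real (inv_length + m * (\<integral>t. \<eta> / (t + \<eta> * (1 - t)) \<partial>Q)) = complex_of_real (c + \<eta> * (\<integral>u. 1 / (1 + \<eta> * u) \<partial>T))"
        using V_V'[OF z] Q.stieltjes_neg_real[OF \<eta>] unfolding V_def z_def by metis
      then have "inv_length + m * (\<integral>t. \<eta> / (t + \<eta> * (1 - t)) \<partial>Q) = c + \<eta> * (\<integral>u. 1 / (1 + \<eta> * u) \<partial>T)"
        by (simp only: of_real_eq_iff)
      then show ?thesis using lim[OF \<eta>] by (simp only:)
    qed
    show moments_bounded
      unfolding moments_bounded_def
    proof (intro allI exI impI)
      fix n x
      assume "inside x" "0 < x"
      then show "trunc_moment n x \<le> (\<integral>u. u ^ n \<partial>T)"
        by (intro moments_bounded_by_limit[OF L T(1) sets_T T(2,3) lim'])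
    qed
  qed
qed

end

section \<open>Moment bounds from mass estimates\<close>

context interval_mass
begin

text \<open>
  On \<open>]a,b]\<close> one has \<open>e \<ge> 1 - b/l\<close> and \<open>green l t s \<ge> a (1 - b/l)\<close>; all \<open>n + 1\<close> integrations are restricted to this interval.
\<close>
lemma moment_lower_bound:
  assumes ab: "0 \<le> a" "a \<le> b" "b \<le> l"
  shows "(1 - b / l) ^ (n + 2) * a ^ n * measure \<mu> {a<..b} ^ Suc n \<le> moment n"
proof -
  define k where "k = 1 - b / l"
  define m where "m = measure \<mu> {a<..b}"
  have k: "0 \<le> k" using ab l_pos by (simp add: k_def)
  have m: "0 \<le> m" by (simp add: m_def)
  have e_ge: "k \<le> e t" if "t \<in> {a<..b}" for t
    using that l_pos by (auto simp: k_def e_def divide_right_mono)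
  have green_ge: "a * k \<le> green l t s" if "t \<in> {a<..b}" "s \<in> {a<..b}" for t s
  proof -
    have "max t s / l \<le> b / l" using that l_pos by (intro divide_right_mono) auto
    then show ?thesis unfolding green_def k_def using that ab k by (intro mult_mono) (auto simp: k_def)
  qed
  have int: "(\<integral>s. indicator {a<..b} s * c \<partial>\<mu>) = c * m" for c
    by (simp add: m_def mult.commute)
  have ind_bdd: "bdd_fun (\<lambda>s. indicator {a<..b} s * c)" for c
    by (rule bdd_funI[of _ "\<bar>c\<bar>"]) (auto simp: indicator_def)
  have iter_ge: "k * (a * k * m) ^ n \<le> iter n t" if "t \<in> {a<..b}" for t n
    using that
  proof (induction n arbitrary: t)
    case 0
    then show ?case using e_ge by simp
  next
    case (Suc n)
    have t: "t \<in> {0..l}" using Suc.prems ab by auto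
    have "(\<integral>s. indicator {a<..b} s * (a * k * (k * (a * k * m) ^ n)) \<partial>\<mu>) \<le> (\<integral>s. green l t s * iter n s \<partial>\<mu>)"
    proof (rule integral_mono_supp[OF ind_bdd])
      show "bdd_fun (\<lambda>s. green l t s * iter n s)" by (intro bdd_fun_mult bdd_fun_green bdd_fun_iter)
      fix s assume s: "s \<in> {0..l}"
      show "indicator {a<..b} s * (a * k * (k * (a * k * m) ^ n)) \<le> green l t s * iter n s"
      proof (cases "s \<in> {a<..b}")
        case True
        have "a * k * (k * (a * k * m) ^ n) \<le> green l t s * iter n s"
          using green_ge[OF Suc.prems True] Suc.IH[OF True] ab k m green_nonneg[OF l_pos t s] by (intro mult_mono) auto
        then show ?thesis using True by simp
      next
        case False
        then show ?thesis using green_nonneg[OF l_pos t s] iter_nonneg[OF s] by simp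
      qed
    qed
    also have "\<dots> = iter (Suc n) t" by (simp add: K_def)
    finally show ?case unfolding int by (simp add: mult_ac)
  qed
  have "(\<integral>s. indicator {a<..b} s * (k * (a * k * m) ^ n * k) \<partial>\<mu>) \<le> (\<integral>s. iter n s * e s \<partial>\<mu>)"
  proof (rule integral_mono_supp[OF ind_bdd])
    show "bdd_fun (\<lambda>s. iter n s * e s)" by (intro bdd_fun_mult bdd_fun_e bdd_fun_iter)
    fix s assume s: "s \<in> {0..l}"
    show "indicator {a<..b} s * (k * (a * k * m) ^ n * k) \<le> iter n s * e s"
    proof (cases "s \<in> {a<..b}")
      case True
      have "k * (a * k * m) ^ n * k \<le> iter n s * e s"
        using iter_ge[OF True] e_ge[OF True] iter_nonneg[OF s] k by (intro mult_mono) auto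
      then show ?thesis using True by simp
    next
      case False
      then show ?thesis using iter_nonneg[OF s] e_nonneg[OF s] by simp
    qed
  qed
  also have "\<dots> = moment n" by (simp add: moment_def ip_def)
  finally have "k * (a * k * m) ^ n * k * m \<le> moment n" unfolding int .
  moreover have "k * (a * k * m) ^ n * k * m = k ^ (n + 2) * a ^ n * m ^ Suc n"
    by (simp add: power_mult_distrib power_add power2_eq_square mult_ac)
  ultimately show ?thesis unfolding k_def m_def by simp
qed

lemma min_le_powr_mult:
  fixes x y :: real
  assumes "0 \<le> x" "0 \<le> y" "0 \<le> \<beta>" "\<beta> \<le> 1"
  shows "min x y \<le> x powr \<beta> * y powr (1 - \<beta>)"
proof (cases "min x y = 0")
  case False
  define z where "z = min x y"
  have z: "0 < z" "z \<le> x" "z \<le> y" using assms False by (auto simp: z_def)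
  have "z = z powr \<beta> * z powr (1 - \<beta>)" using z by (simp add: powr_add[symmetric])
  also have "\<dots> \<le> x powr \<beta> * y powr (1 - \<beta>)" using z assms by (intro mult_mono powr_mono2) auto
  finally show ?thesis by (simp add: z_def)
next
  case True
  show ?thesis unfolding True by simp
qed

text \<open>
  One step of the estimate of \<open>K\<^sup>n e\<close>: the Green function is split as \<open>min (g t) (g s) \<le> g(t)\<^sup>\<beta> g(s)\<^bsup>1-\<beta>\<^esup>\<close>. The second factor completes
  the bound of \<open>f\<close> to the fixed weight \<open>w\<close>, the first one is passed on to the next step.
\<close>
lemma K_weighted_le:
  assumes f: "bdd_fun f" "\<And>s. s \<in> {0..l} \<Longrightarrow> 0 \<le> f s" and w: "bdd_fun w"
    and g: "\<And>t. t \<in> {0..l} \<Longrightarrow> 0 \<le> g t" "\<And>t s. t \<in> {0..l} \<Longrightarrow> s \<in> {0..l} \<Longrightarrow> green l t s \<le> min (g t) (g s)"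
    and \<beta>: "0 \<le> \<beta>" "\<beta> \<le> 1"
    and le: "\<And>s. s \<in> {0..l} \<Longrightarrow> f s * g s powr (1 - \<beta>) \<le> A * w s"
    and t: "t \<in> {0..l}"
  shows "K f t \<le> A * (\<integral>s. w s \<partial>\<mu>) * g t powr \<beta>"
proof -
  have "K f t \<le> (\<integral>s. g t powr \<beta> * A * w s \<partial>\<mu>)"
    unfolding K_def
  proof (rule integral_mono_supp)
    show "bdd_fun (\<lambda>s. green l t s * f s)" by (intro bdd_fun_mult bdd_fun_green f)
    show "bdd_fun (\<lambda>s. g t powr \<beta> * A * w s)" by (intro bdd_fun_mult bdd_fun_const w)
    fix s assume s: "s \<in> {0..l}"
    have "green l t s * f s \<le> (g t powr \<beta> * g s powr (1 - \<beta>)) * f s"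
      using order_trans[OF g(2)[OF t s] min_le_powr_mult[OF g(1)[OF t] g(1)[OF s] \<beta>]] f(2)[OF s] by (rule mult_right_mono)
    also have "\<dots> = g t powr \<beta> * (f s * g s powr (1 - \<beta>))" by simp
    also have "\<dots> \<le> g t powr \<beta> * (A * w s)" by (intro mult_left_mono le s) simp
    finally show "green l t s * f s \<le> g t powr \<beta> * A * w s" by (simp add: mult.assoc)
  qed
  also have "\<dots> = A * (\<integral>s. w s \<partial>\<mu>) * g t powr \<beta>" by simp
  finally show ?thesis .
qed

lemma bdd_fun_powr: "bdd_fun g \<Longrightarrow> (\<And>t. t \<in> {0..l} \<Longrightarrow> 0 \<le> g t) \<Longrightarrow> 0 \<le> p \<Longrightarrow> bdd_fun (\<lambda>t. g t powr p)"
proof -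
  assume g: "bdd_fun g" "\<And>t. t \<in> {0..l} \<Longrightarrow> 0 \<le> g t" and p: "0 \<le> p"
  have [measurable]: "g \<in> borel_measurable borel" using g by (simp add: bdd_fun_def)
  obtain C where C: "0 \<le> C" "\<And>t. t \<in> {0..l} \<Longrightarrow> \<bar>g t\<bar> \<le> C" using g(1) by (rule bdd_funE) blast
  show ?thesis
  proof (rule bdd_funI)
    fix t assume t: "t \<in> {0..l}"
    have "g t powr p \<le> C powr p" using C(2)[OF t] g(2)[OF t] p by (intro powr_mono2) auto
    then show "\<bar>g t powr p\<bar> \<le> C powr p" by simp
  qed measurable
qed

text \<open>
  With \<open>g(t) = R - t\<close>, \<open>\<delta> = 1/(n + 1)\<close> and \<open>J = \<integral> g\<^bsup>1+\<delta>\<^esup> d\<mu>\<close>, repeated use of \<open>K_weighted_le\<close> gives \<open>K\<^sup>k e \<le> J\<^sup>k g\<^bsup>1-k\<delta>\<^esup> / R\<close>,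
  starting from \<open>e \<le> g / R\<close>. For \<open>k = n\<close> the remaining exponent is \<open>\<delta>\<close>, and pairing with the last \<open>e \<le> g / R\<close> gives one more factor
  \<open>J\<close>. The bound does not depend on \<open>l\<close>.
\<close>
lemma moment_upper_bound_finite_length:
  assumes R: "l \<le> R"
  shows "moment n \<le> (\<integral>t. max 0 (R - t) powr (1 + 1 / real (Suc n)) \<partial>\<mu>) ^ Suc n / R\<^sup>2"
proof -
  define \<delta> where "\<delta> = 1 / real (Suc n)"
  have n\<delta>: "real n * \<delta> = 1 - \<delta>" by (simp add: \<delta>_def field_simps)
  have \<delta>: "0 < \<delta>" "\<delta> \<le> 1" by (auto simp: \<delta>_def)
  have R0: "0 < R" using R l_pos by simp
  define g where "g t = max 0 (R - t)" for t
  have g_bdd: "bdd_fun g" unfolding g_def by (rule bdd_funI[of _ "R"]) (use R0 in auto)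
  have g_eq: "g t = R - t" "0 \<le> g t" if "t \<in> {0..l}" for t using that R by (auto simp: g_def)
  have green_g: "green l t s \<le> min (g t) (g s)" if t: "t \<in> {0..l}" and s: "s \<in> {0..l}" for t s
  proof -
    have "green l t s = (min t s / l) * (l - max t s)" unfolding green_def using l_pos by (simp add: field_simps)
    also have "\<dots> \<le> 1 * (R - max t s)" using t s R l_pos by (intro mult_mono) (auto simp: divide_le_eq_1)
    also have "\<dots> = min (g t) (g s)" using g_eq(1)[OF t] g_eq(1)[OF s] by (simp add: max_def min_def)
    finally show ?thesis .
  qed
  have e_le: "e t \<le> 1 / R * g t" if t: "t \<in> {0..l}" for t
  proof -
    have "t / R \<le> t / l" using t R l_pos by (intro divide_left_mono) auto
    then show ?thesis using g_eq(1)[OF t] R0 by (simp add: e_def diff_divide_distrib)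
  qed
  have gp: "bdd_fun (\<lambda>t. g t powr (1 + \<delta>))" using \<delta> by (intro bdd_fun_powr g_bdd g_eq) auto
  define I where "I = (\<integral>t. g t powr (1 + \<delta>) \<partial>\<mu>)"
  have iter_le: "iter k t \<le> I ^ k / R * g t powr (1 - real k * \<delta>)" if "k \<le> n" "t \<in> {0..l}" for k t
    using that
  proof (induction k arbitrary: t)
    case 0
    have "g t powr 1 = g t" using g_eq(2)[OF 0(2)] by (cases "g t = 0") auto
    then show ?case using e_le[OF 0(2)] by simp
  next
    case (Suc k)
    have k1: "real (Suc k) * \<delta> \<le> real n * \<delta>" using Suc.prems \<delta> by (intro mult_right_mono) auto
    have "K (iter k) t \<le> I ^ k / R * (\<integral>s. g s powr (1 + \<delta>) \<partial>\<mu>) * g t powr (1 - real (Suc k) * \<delta>)"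
    proof (rule K_weighted_le[OF bdd_fun_iter iter_nonneg gp g_eq(2) green_g _ _ _ Suc.prems(2)])
      show "0 \<le> 1 - real (Suc k) * \<delta>" using k1 n\<delta> \<delta> by linarith
      show "1 - real (Suc k) * \<delta> \<le> 1" using \<delta> by simp
      fix s assume s: "s \<in> {0..l}"
      have "iter k s * g s powr (1 - (1 - real (Suc k) * \<delta>)) \<le> I ^ k / R * g s powr (1 - real k * \<delta>) * g s powr (1 - (1 - real (Suc k) * \<delta>))"
        using Suc.IH[of s] Suc.prems s by (intro mult_right_mono) auto
      also have "\<dots> = I ^ k / R * g s powr ((1 - real k * \<delta>) + (1 - (1 - real (Suc k) * \<delta>)))"
        by (simp only: powr_add mult.assoc)
      also have "(1 - real k * \<delta>) + (1 - (1 - real (Suc k) * \<delta>)) = 1 + \<delta>" by (simp add: algebra_simps)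
      finally show "iter k s * g s powr (1 - (1 - real (Suc k) * \<delta>)) \<le> I ^ k / R * g s powr (1 + \<delta>)" .
    qed
    then show ?case by (simp add: I_def mult_ac)
  qed
  have "moment n \<le> (\<integral>t. I ^ n / R\<^sup>2 * g t powr (1 + \<delta>) \<partial>\<mu>)"
    unfolding moment_def ip_def
  proof (rule integral_mono_supp)
    show "bdd_fun (\<lambda>t. iter n t * e t)" by (intro bdd_fun_mult bdd_fun_iter bdd_fun_e)
    show "bdd_fun (\<lambda>t. I ^ n / R\<^sup>2 * g t powr (1 + \<delta>))" by (intro bdd_fun_mult bdd_fun_const gp)
    fix t assume t: "t \<in> {0..l}"
    have I0: "0 \<le> I ^ n / R" using R0 by (intro divide_nonneg_pos zero_le_power) (auto simp: I_def)
    have "iter n t * e t \<le> (I ^ n / R * g t powr (1 - real n * \<delta>)) * (1 / R * g t)"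
      by (rule mult_mono[OF iter_le[OF order_refl t] e_le[OF t] _ e_nonneg[OF t]])
        (intro mult_nonneg_nonneg[OF I0] powr_ge_zero)
    also have "1 - real n * \<delta> = \<delta>" using n\<delta> by simp
    also have "(I ^ n / R * g t powr \<delta>) * (1 / R * g t) = I ^ n / R\<^sup>2 * (g t powr \<delta> * g t)"
      by (simp add: power2_eq_square)
    also have "g t powr \<delta> * g t = g t powr (1 + \<delta>)"
      using g_eq(2)[OF t] by (cases "g t = 0") (auto simp: powr_add)
    finally show "iter n t * e t \<le> I ^ n / R\<^sup>2 * g t powr (1 + \<delta>)" .
  qed
  also have "\<dots> = I ^ Suc n / R\<^sup>2" by (simp add: I_def)
  finally show ?thesis by (simp add: I_def g_def[abs_def] \<delta>_def)
qed

lemma moment_0_le_mass: "moment 0 \<le> mass"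
proof -
  have "moment 0 \<le> (\<integral>t. 1 \<partial>\<mu>)"
    unfolding moment_def ip_def
  proof (rule integral_mono_supp)
    fix t assume t: "t \<in> {0..l}"
    show "iter 0 t * e t \<le> 1" using e_nonneg[OF t] e_le_1[OF t] by (auto intro: mult_le_one)
  qed (auto intro: bdd_fun_mult)
  then show ?thesis by (simp add: mass_def)
qed

text \<open>
  As in the case of finite length, but with \<open>g(t) = t\<close> and \<open>e \<le> 1\<close>: now \<open>K\<^sup>k e \<le> J\<^sup>k g\<^bsup>k\<delta>\<^esup>\<close> for \<open>J = \<integral> g\<^bsup>1-\<delta>\<^esup> d\<mu>\<close>, and \<open>n \<delta> = 1 - \<delta>\<close>.
\<close>
lemma moment_upper_bound_infinite_length:
  assumes n: "0 < n"
  shows "moment n \<le> (\<integral>t. max 0 t powr (1 - 1 / real (Suc n)) \<partial>\<mu>) ^ Suc n"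
proof -
  define \<delta> where "\<delta> = 1 / real (Suc n)"
  have n\<delta>: "real n * \<delta> = 1 - \<delta>" by (simp add: \<delta>_def field_simps)
  have \<delta>: "0 < \<delta>" "\<delta> \<le> 1" by (auto simp: \<delta>_def)
  define g where "g t = max 0 t" for t :: real
  have g_bdd: "bdd_fun g" unfolding g_def by (rule bdd_funI[of _ l]) auto
  have g_nonneg: "0 \<le> g t" for t by (simp add: g_def)
  have green_g: "green l t s \<le> min (g t) (g s)" if t: "t \<in> {0..l}" and s: "s \<in> {0..l}" for t s
    using green_le[OF l_pos t s] t s by (simp add: g_def)
  have gp: "bdd_fun (\<lambda>t. g t powr (1 - \<delta>))" using \<delta> by (intro bdd_fun_powr g_bdd g_nonneg) auto
  define J where "J = (\<integral>t. g t powr (1 - \<delta>) \<partial>\<mu>)"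
  have J: "0 \<le> J" by (simp add: J_def)
  have iter_le: "iter (Suc k) t \<le> J ^ Suc k * g t powr (real (Suc k) * \<delta>)" if "Suc k \<le> n" "t \<in> {0..l}" for k t
    using that
  proof (induction k arbitrary: t)
    case 0
    have "K e t \<le> 1 * (\<integral>s. g s powr (1 - \<delta>) \<partial>\<mu>) * g t powr \<delta>"
    proof (rule K_weighted_le[OF bdd_fun_e e_nonneg gp g_nonneg green_g _ _ _ 0(2)])
      show "e s * g s powr (1 - \<delta>) \<le> 1 * g s powr (1 - \<delta>)" if "s \<in> {0..l}" for s
        using e_le_1[OF that] by (intro mult_right_mono) auto
    qed (use \<delta> in auto)
    then show ?case by (simp add: J_def)
  next
    case (Suc k)
    have k1: "real (Suc (Suc k)) * \<delta> \<le> real n * \<delta>" using Suc.prems \<delta> by (intro mult_right_mono) auto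
    have "K (iter (Suc k)) t \<le> J ^ Suc k * (\<integral>s. g s powr (1 - \<delta>) \<partial>\<mu>) * g t powr (real (Suc (Suc k)) * \<delta>)"
    proof (rule K_weighted_le[OF bdd_fun_iter iter_nonneg gp g_nonneg green_g _ _ _ Suc.prems(2)])
      show "0 \<le> real (Suc (Suc k)) * \<delta>" using \<delta> by simp
      show "real (Suc (Suc k)) * \<delta> \<le> 1" using k1 n\<delta> \<delta> by linarith
      fix s assume s: "s \<in> {0..l}"
      have "iter (Suc k) s * g s powr (1 - real (Suc (Suc k)) * \<delta>)
          \<le> J ^ Suc k * g s powr (real (Suc k) * \<delta>) * g s powr (1 - real (Suc (Suc k)) * \<delta>)"
        using Suc.prems s by (intro mult_right_mono Suc.IH) auto
      also have "\<dots> = J ^ Suc k * g s powr (real (Suc k) * \<delta> + (1 - real (Suc (Suc k)) * \<delta>))"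
        by (simp only: powr_add mult.assoc)
      also have "real (Suc k) * \<delta> + (1 - real (Suc (Suc k)) * \<delta>) = 1 - \<delta>" by (simp add: algebra_simps)
      finally show "iter (Suc k) s * g s powr (1 - real (Suc (Suc k)) * \<delta>) \<le> J ^ Suc k * g s powr (1 - \<delta>)" .
    qed
    then show ?case by (simp only: iter.simps J_def power_Suc2)
  qed
  have "moment n \<le> (\<integral>t. J ^ n * g t powr (1 - \<delta>) \<partial>\<mu>)"
    unfolding moment_def ip_def
  proof (rule integral_mono_supp)
    show "bdd_fun (\<lambda>t. iter n t * e t)" by (intro bdd_fun_mult bdd_fun_iter bdd_fun_e)
    show "bdd_fun (\<lambda>t. J ^ n * g t powr (1 - \<delta>))" by (intro bdd_fun_mult bdd_fun_const gp)
    fix t assume t: "t \<in> {0..l}"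
    obtain k where k: "n = Suc k" using n by (cases n) auto
    have "iter n t * e t \<le> iter n t * 1" using e_le_1[OF t] iter_nonneg[OF t] by (intro mult_left_mono) auto
    also have "\<dots> \<le> J ^ n * g t powr (real n * \<delta>)" using iter_le[of k t] t k by simp
    finally show "iter n t * e t \<le> J ^ n * g t powr (1 - \<delta>)" unfolding n\<delta> .
  qed
  also have "\<dots> = J ^ Suc n" by (simp add: J_def)
  finally show ?thesis by (simp add: J_def g_def[abs_def] \<delta>_def)
qed

text \<open>
  Evaluates an integral over dyadic pieces \<open>A k\<close>, which may overlap.
\<close>
lemma integral_le_cover:
  assumes f: "bdd_fun f" "\<And>t. 0 \<le> f t" and A[measurable]: "\<And>k. A k \<in> sets borel"
    and c: "\<And>k. 0 \<le> c k" and cover: "\<And>t. t \<in> {0..l} \<Longrightarrow> \<exists>k::nat. t \<in> A k \<and> f t \<le> c k"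
    and b: "\<And>k. measure \<mu> (A k) \<le> b k" and sum: "summable (\<lambda>k. c k * b k)"
  shows "(\<integral>t. f t \<partial>\<mu>) \<le> (\<Sum>k. c k * b k)"
proof -
  have b_nonneg: "0 \<le> b k" for k using b[of k] measure_nonneg[of \<mu> "A k"] by linarith
  have "ennreal (\<integral>t. f t \<partial>\<mu>) = (\<integral>\<^sup>+t. ennreal (f t) \<partial>\<mu>)"
    by (rule nn_integral_eq_integral[symmetric]) (use f in \<open>auto intro: bdd_fun_integrable\<close>)
  also have "\<dots> \<le> (\<integral>\<^sup>+t. (\<Sum>k. ennreal (c k) * indicator (A k) t) \<partial>\<mu>)"
  proof (rule nn_integral_mono_AE, rule eventually_mono[OF supp])
    fix t assume "t \<in> {0..l}"
    from cover[OF this] obtain k where k: "t \<in> A k" "f t \<le> c k" by blast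
    define F where "F j = ennreal (c j) * indicator (A j) t" for j
    have "ennreal (f t) \<le> F k" using k by (simp add: F_def ennreal_leI)
    also have "\<dots> = sum F {k}" by simp
    also have "\<dots> \<le> (\<Sum>j. F j)" by (rule sum_le_suminf) auto
    finally show "ennreal (f t) \<le> (\<Sum>k. ennreal (c k) * indicator (A k) t)" by (simp only: F_def)
  qed
  also have "\<dots> = (\<Sum>k. \<integral>\<^sup>+t. ennreal (c k) * indicator (A k) t \<partial>\<mu>)"
    by (rule nn_integral_suminf) measurable
  also have "\<dots> \<le> (\<Sum>k. ennreal (c k * b k))"
  proof (rule suminf_le)
    fix k
    have "(\<integral>\<^sup>+t. ennreal (c k) * indicator (A k) t \<partial>\<mu>) = ennreal (c k * measure \<mu> (A k))"
      using c[of k] by (simp add: nn_integral_cmult emeasure_eq_measure ennreal_mult)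
    also have "\<dots> \<le> ennreal (c k * b k)" by (intro ennreal_leI mult_left_mono b c)
    finally show "(\<integral>\<^sup>+t. ennreal (c k) * indicator (A k) t \<partial>\<mu>) \<le> ennreal (c k * b k)" .
  qed auto
  also have "\<dots> = ennreal (\<Sum>k. c k * b k)"
    by (rule suminf_ennreal2) (use c b_nonneg sum in auto)
  finally show ?thesis
    by (rule ennreal_le_iff[THEN iffD1, rotated]) (intro suminf_nonneg sum mult_nonneg_nonneg c b_nonneg)
qed

end

lemma dyadic_scale:
  fixes r :: real
  assumes "0 < r" "r \<le> 1"
  obtains k :: nat where "1 / 2 ^ Suc k < r" "r \<le> 1 / 2 ^ k"
proof -
  define k where "k = (LEAST j. 1 / 2 ^ Suc j < r)"
  have "(\<lambda>j. 1 / 2 ^ Suc j :: real) \<longlonglongrightarrow> 0"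
    using LIMSEQ_Suc[OF LIMSEQ_power_zero[of "1 / 2 :: real"]] by (simp add: power_one_over)
  from order_tendstoD(2)[OF this assms(1)] have ex: "\<exists>j. 1 / 2 ^ Suc j < r"
    by (auto simp: eventually_sequentially)
  have "1 / 2 ^ Suc k < r" unfolding k_def by (rule LeastI_ex[OF ex])
  moreover have "r \<le> 1 / 2 ^ k"
  proof (cases k)
    case 0
    then show ?thesis using assms by simp
  next
    case (Suc j)
    then have "\<not> 1 / 2 ^ Suc j < r" unfolding k_def by (intro not_less_Least) simp
    then show ?thesis using Suc by simp
  qed
  ultimately show thesis by (rule that)
qed

lemma mult_powr_le_root:
  fixes x d B :: real
  assumes "0 \<le> x" "0 \<le> d" "0 < p" "x ^ p * d ^ Suc p \<le> B"
  shows "x * d powr (1 + 1 / real p) \<le> B powr (1 / real p)"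
proof (cases "x = 0 \<or> d = 0")
  case False
  then have pos: "0 < x" "0 < d" using assms by auto
  have "(x ^ p * d ^ Suc p) powr (1 / real p) = x * d powr (1 + 1 / real p)"
  proof -
    have "x ^ p * d ^ Suc p = x powr real p * d powr real (Suc p)" using pos by (simp only: powr_realpow)
    also have "\<dots> powr (1 / real p) = x powr (real p * (1 / real p)) * d powr (real (Suc p) * (1 / real p))"
      by (simp add: powr_mult powr_powr)
    also have "real p * (1 / real p) = 1" using assms by simp
    also have "real (Suc p) * (1 / real p) = 1 + 1 / real p" using assms by (simp add: field_simps)
    finally show ?thesis using pos by simp
  qed
  moreover have "(x ^ p * d ^ Suc p) powr (1 / real p) \<le> B powr (1 / real p)"
    using assms pos by (intro powr_mono2) auto
  ultimately show ?thesis by simp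
qed auto

section \<open>Bounded moments and the decay conditions\<close>

context krein_string
begin

lemma trunc_moment_lower_bound:
  assumes y: "inside y" "0 < y" and ab: "0 \<le> a" "a \<le> b" "b \<le> y"
  shows "(1 - b / y) ^ (n + 2) * a ^ n * (mass_upto b - mass_upto a) ^ Suc n \<le> trunc_moment n y"
proof -
  interpret Y: interval_mass "dM M y" y by (rule interval_mass_dM[OF y])
  show ?thesis using Y.moment_lower_bound[OF ab, of n] unfolding dM_Ioc[OF y(1) ab] trunc_moment_def .
qed

context
  fixes R :: real
  assumes R: "string_length M = ennreal R" "0 < R"
begin

lemma inside_iff_less: "inside x \<longleftrightarrow> 0 \<le> x \<and> x < R"
  by (auto simp: inside_def R ennreal_less_iff)

lemma gap_eq: assumes "inside x" shows "enn2real (string_length M - ennreal x) = R - x"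
  using assms by (simp add: inside_iff_less R ennreal_minus)

text \<open>
  Letting \<open>y\<close> tend to \<open>R\<close> in \<open>trunc_moment_lower_bound\<close>, for fixed \<open>a\<close>, bounds \<open>(M x - M a)\<^bsup>n+1\<^esup> (R - x)\<^bsup>n+2\<^esup>\<close>, so
  \<open>(M x - M a) (R - x)\<^bsup>1+1/(n+1)\<^esup>\<close> is bounded. If \<open>1/(n + 1) < \<epsilon>\<close>, a positive power of \<open>R - x\<close> is left over.
\<close>
lemma finite_length_decay_necessary:
  assumes B: moments_bounded and \<epsilon>: "0 < \<epsilon>"
  shows "((\<lambda>x. enn2real (M x) * enn2real (string_length M - x) powr (1 + \<epsilon>)) \<longlongrightarrow> 0) (at_left (string_length M))"
proof -
  have L: "0 < string_length M" using R by simp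
  obtain n where n: "1 / real (Suc n) < \<epsilon>" using nat_approx_posE[OF \<epsilon>] by blast
  obtain b where b: "\<And>x. inside x \<Longrightarrow> 0 < x \<Longrightarrow> trunc_moment n x \<le> b" using B by (auto simp: moments_bounded_def)
  define a where "a = R / 2"
  have a: "0 < a" "a < R" using R by (auto simp: a_def)
  define B2 where "B2 = b * R ^ (n + 2) / a ^ n"
  define B3 where "B3 = B2 powr (1 / real (Suc n))"
  have key: "(mass_upto x - mass_upto a) * (R - x) powr (1 + 1 / real (Suc n)) \<le> B3" if x: "a \<le> x" "x < R" for x
  proof -
    have "((\<lambda>y. (1 - x / y) ^ (n + 2) * a ^ n * (mass_upto x - mass_upto a) ^ Suc n) \<longlongrightarrow> (1 - x / R) ^ (n + 2) * a ^ n * (mass_upto x - mass_upto a) ^ Suc n) (at_left R)"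
      using R by (intro tendsto_intros) auto
    then have "(1 - x / R) ^ (n + 2) * a ^ n * (mass_upto x - mass_upto a) ^ Suc n \<le> b"
    proof (rule tendsto_upperbound)
      have "\<forall>\<^sub>F y in at_left R. x < y \<and> y < R"
        using x by (auto simp: eventually_at_left_field)
      then show "\<forall>\<^sub>F y in at_left R. (1 - x / y) ^ (n + 2) * a ^ n * (mass_upto x - mass_upto a) ^ Suc n \<le> b"
      proof eventually_elim
        case (elim y)
        then have y: "inside y" "0 < y" using x a by (auto simp: inside_iff_less)
        show ?case using order_trans[OF trunc_moment_lower_bound[OF y, of a x n] b[OF y]] elim x a by auto
      qed
    qed simp
    moreover have "(1 - x / R) ^ (n + 2) = (R - x) ^ (n + 2) / R ^ (n + 2)"
      using R by (simp only: power_divide[symmetric] diff_divide_distrib) simp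
    ultimately have "(R - x) ^ (n + 2) / R ^ (n + 2) * (a ^ n * (mass_upto x - mass_upto a) ^ Suc n) \<le> b" by (simp only: mult.assoc)
    then have "(R - x) ^ (n + 2) * (a ^ n * (mass_upto x - mass_upto a) ^ Suc n) \<le> b * R ^ (n + 2)"
      using R by (simp add: divide_le_eq)
    then have "(mass_upto x - mass_upto a) ^ Suc n * (R - x) ^ Suc (Suc n) \<le> B2"
      unfolding B2_def using a by (simp add: le_divide_eq mult_ac)
    then show ?thesis unfolding B3_def
      using x a mass_upto_mono[of x a] by (intro mult_powr_le_root) (auto simp: inside_iff_less)
  qed
  define h where "h r = mass_upto a * r powr (1 + \<epsilon>) + B3 * r powr (\<epsilon> - 1 / real (Suc n))" for r
  have bound: "mass_upto x * (R - x) powr (1 + \<epsilon>) \<le> h (R - x)" if x: "a \<le> x" "x < R" for x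
  proof -
    have "(R - x) powr (1 + \<epsilon>) = (R - x) powr (1 + 1 / real (Suc n)) * (R - x) powr (\<epsilon> - 1 / real (Suc n))"
      by (simp add: powr_add[symmetric])
    then have "(mass_upto x - mass_upto a) * (R - x) powr (1 + \<epsilon>)
        = ((mass_upto x - mass_upto a) * (R - x) powr (1 + 1 / real (Suc n))) * (R - x) powr (\<epsilon> - 1 / real (Suc n))" by simp
    also have "\<dots> \<le> B3 * (R - x) powr (\<epsilon> - 1 / real (Suc n))" by (intro mult_right_mono key x) simp
    finally show ?thesis by (simp add: h_def algebra_simps)
  qed
  have gap_lim: "((\<lambda>x. R - enn2real x) \<longlongrightarrow> 0) (at_left (string_length M))"
  proof -
    have "((\<lambda>x. enn2real x) \<longlongrightarrow> R) (at_left (string_length M))"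
      using R by (intro tendsto_enn2real) (auto simp: tendsto_ident_at)
    from tendsto_diff[OF tendsto_const[of R] this] show ?thesis by simp
  qed
  have in_range: "\<forall>\<^sub>F x in at_left (string_length M). \<exists>y. x = ennreal y \<and> inside y \<and> a < y"
    using a by (intro eventually_at_left_length[OF L, of "ennreal a"]) (auto simp: R ennreal_less_iff)
  show ?thesis
  proof (rule tendsto_sandwich)
    show "\<forall>\<^sub>F x in at_left (string_length M). 0 \<le> enn2real (M x) * enn2real (string_length M - x) powr (1 + \<epsilon>)" by simp
    show "\<forall>\<^sub>F x in at_left (string_length M). enn2real (M x) * enn2real (string_length M - x) powr (1 + \<epsilon>) \<le> h (R - enn2real x)"
      using in_range
    proof eventually_elim
      case (elim x)
      then obtain y where y: "x = ennreal y" "inside y" "a < y" by blast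
      then show ?case using bound[of y] by (simp add: gap_eq mass_upto_def[symmetric] inside_iff_less)
    qed
    have "((\<lambda>x. h (R - enn2real x)) \<longlongrightarrow> mass_upto a * 0 + B3 * 0) (at_left (string_length M))"
      unfolding h_def
    proof (intro tendsto_add tendsto_mult tendsto_const)
      have nn: "\<forall>\<^sub>F x in at_left (string_length M). 0 \<le> R - enn2real x"
        using in_range by eventually_elim (auto simp: inside_iff_less)
      show "((\<lambda>x. (R - enn2real x) powr (1 + \<epsilon>)) \<longlongrightarrow> 0) (at_left (string_length M))"
        using \<epsilon> nn by (intro tendsto_zero_powrI[OF gap_lim tendsto_const]) auto
      show "((\<lambda>x. (R - enn2real x) powr (\<epsilon> - 1 / real (Suc n))) \<longlongrightarrow> 0) (at_left (string_length M))"
        using n nn by (intro tendsto_zero_powrI[OF gap_lim tendsto_const]) auto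
    qed
    then show "((\<lambda>x. h (R - enn2real x)) \<longlongrightarrow> 0) (at_left (string_length M))" by simp
  qed simp
qed

text \<open>
  By \<open>moment_upper_bound_finite_length\<close> it suffices to bound \<open>\<integral> (R - t)\<^bsup>1+\<delta>\<^esup> dM\<close> with \<open>\<delta> = 1/(n + 1)\<close>. The decay condition
  for \<open>\<epsilon> = \<delta>/2\<close> gives \<open>M t = O((R - t)\<^bsup>-1-\<epsilon>\<^esup>)\<close>, so the part of the integral where \<open>R - t\<close> is of the order
  \<open>R / 2\<^sup>k\<close> contributes \<open>O(2\<^bsup>-k\<epsilon>\<^esup>)\<close>, a geometric series.
\<close>
lemma finite_length_decay_sufficient:
  assumes decay: "\<And>\<epsilon>. 0 < \<epsilon> \<Longrightarrow> ((\<lambda>x. enn2real (M x) * enn2real (string_length M - x) powr (1 + \<epsilon>)) \<longlongrightarrow> 0) (at_left (string_length M))"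
  shows moments_bounded
  unfolding moments_bounded_def
proof
  fix n
  have L: "0 < string_length M" using R by simp
  define \<delta> where "\<delta> = 1 / real (Suc n)"
  define \<epsilon> where "\<epsilon> = \<delta> / 2"
  have \<delta>: "0 < \<delta>" and \<epsilon>: "0 < \<epsilon>" by (auto simp: \<delta>_def \<epsilon>_def)
  from order_tendstoD(2)[OF decay[OF \<epsilon>], of 1] obtain b0 where b0: "b0 < string_length M"
    "\<And>x. b0 < x \<Longrightarrow> x < string_length M \<Longrightarrow> enn2real (M x) * enn2real (string_length M - x) powr (1 + \<epsilon>) < 1"
    using eventually_at_left[OF L] by auto
  obtain w where "b0 < w" "w < string_length M" using b0(1) dense by blast
  then obtain y1 where y1: "w = ennreal y1" "0 \<le> y1" "y1 < R" by (cases w) (auto simp: R ennreal_less_iff)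
  define C where "C = max 1 (mass_upto y1 * R powr (1 + \<epsilon>))"
  have C: "0 < C" by (simp add: C_def)
  have mass_bound: "mass_upto y * (R - y) powr (1 + \<epsilon>) \<le> C" if y: "0 \<le> y" "y < R" for y
  proof (cases "y \<le> y1")
    case True
    have "mass_upto y * (R - y) powr (1 + \<epsilon>) \<le> mass_upto y1 * R powr (1 + \<epsilon>)"
      using True y y1 \<epsilon> by (intro mult_mono mass_upto_mono powr_mono2) (auto simp: inside_iff_less mass_upto_nonneg)
    then show ?thesis by (simp add: C_def)
  next
    case False
    then have "w < ennreal y" using y1 by (simp add: ennreal_less_iff)
    then have "b0 < ennreal y" using \<open>b0 < w\<close> by simp
    moreover have "ennreal y < string_length M" using y by (simp add: R ennreal_less_iff)
    ultimately have "enn2real (M (ennreal y)) * enn2real (string_length M - ennreal y) powr (1 + \<epsilon>) < 1" by (rule b0(2))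
    then show ?thesis using y by (simp add: gap_eq inside_iff_less mass_upto_def C_def)
  qed
  define c where "c k = (R / 2 ^ k) powr (1 + \<delta>)" for k :: nat
  define b where "b k = C * (R / 2 ^ k / 2) powr (- (1 + \<epsilon>))" for k :: nat
  define A where "A k = {..<R - R / 2 ^ Suc k}" for k :: nat
  have sum: "summable (\<lambda>k. c k * b k)"
  proof -
    have "c k * b k = (C * 2 powr (1 + \<epsilon>) * R powr \<epsilon>) * ((1 / 2) powr \<epsilon>) ^ k" for k
    proof -
      define h where "h = R / 2 ^ k"
      have h: "0 < h" using R by (simp add: h_def)
      have "(h / 2) powr (- (1 + \<epsilon>)) = h powr (- (1 + \<epsilon>)) * 2 powr (1 + \<epsilon>)"
        using h by (simp only: powr_divide powr_minus) (simp add: divide_inverse)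
      moreover have "h powr (1 + \<delta>) * h powr (- (1 + \<epsilon>)) = h powr \<epsilon>"
        by (simp add: powr_add[symmetric] \<epsilon>_def)
      moreover have "h powr \<epsilon> = R powr \<epsilon> * ((1 / 2) powr \<epsilon>) ^ k"
      proof -
        have "h = R * (1 / 2) ^ k" by (simp add: h_def power_one_over)
        then have "h powr \<epsilon> = R powr \<epsilon> * ((1 / 2) ^ k) powr \<epsilon>" using R by (simp only: powr_mult)
        also have "((1 / 2 :: real) ^ k) powr \<epsilon> = ((1 / 2) powr \<epsilon>) ^ k"
          by (simp add: powr_realpow[symmetric] powr_powr mult.commute)
        finally show ?thesis .
      qed
      ultimately show ?thesis unfolding c_def b_def h_def[symmetric] by (simp add: mult_ac)
    qed
    moreover have "(1 / 2 :: real) powr \<epsilon> < 1" using \<epsilon> powr_less_mono2[of \<epsilon> "1 / 2" 1] by simp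
    ultimately show ?thesis by (simp only:) (intro summable_mult summable_geometric, simp)
  qed
  define S where "S = (\<Sum>k. c k * b k)"
  have "trunc_moment n x \<le> S ^ Suc n / R\<^sup>2" if x: "inside x" "0 < x" for x
  proof -
    interpret X: interval_mass "dM M x" x by (rule interval_mass_dM[OF x])
    have xR: "x \<le> R" using x by (simp add: inside_iff_less)
    have I_le: "(\<integral>t. max 0 (R - t) powr (1 + \<delta>) \<partial>dM M x) \<le> S"
      unfolding S_def
    proof (rule X.integral_le_cover[where A=A])
      show "X.bdd_fun (\<lambda>t. max 0 (R - t) powr (1 + \<delta>))"
        using \<delta> R by (intro X.bdd_fun_powr X.bdd_funI[of _ R]) auto
      show "measure (dM M x) (A k) \<le> b k" for k
      proof -
        define z where "z = R - R / 2 ^ Suc k"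
        have "R / 2 ^ Suc k \<le> R / 1" using R one_le_power[of "2::real" "Suc k"] by (intro divide_left_mono) auto
        then have z: "0 \<le> z" "z < R" using R by (auto simp: z_def)
        have "measure (dM M x) (A k) \<le> measure (dM M x) {..z}"
          by (intro X.finite_measure_mono) (auto simp: A_def z_def)
        also have "\<dots> = mass_upto (min z x)" unfolding cdf_dM[OF x(1)] using z by (simp add: trunc_cdf_def)
        also have "\<dots> \<le> mass_upto z" using z x by (intro mass_upto_mono) (auto simp: inside_iff_less)
        also have "mass_upto z \<le> C / (R - z) powr (1 + \<epsilon>)"
          using mass_bound[OF z] z by (subst pos_le_divide_eq) auto
        also have "\<dots> = C * (R - z) powr (- (1 + \<epsilon>))" by (simp only: powr_minus divide_inverse)
        also have "R - z = R / 2 ^ k / 2" by (simp add: z_def)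
        finally show ?thesis by (simp only: b_def)
      qed
      show "\<exists>k. t \<in> A k \<and> max 0 (R - t) powr (1 + \<delta>) \<le> c k" if t: "t \<in> {0..x}" for t
      proof -
        have tR: "0 \<le> t" "t < R" using t x by (auto simp: inside_iff_less)
        obtain k where k: "1 / 2 ^ Suc k < (R - t) / R" "(R - t) / R \<le> 1 / 2 ^ k"
          using tR R by (elim dyadic_scale[of "(R - t) / R", rotated 2]) auto
        have k1: "R / 2 ^ Suc k < R - t"
        proof -
          have "1 / 2 ^ Suc k * R < R - t" using k(1) R(2) by (simp only: pos_less_divide_eq)
          then show ?thesis by simp
        qed
        have k2: "R - t \<le> R / 2 ^ k"
        proof -
          have "R - t \<le> 1 / 2 ^ k * R" using k(2) R(2) by (simp only: pos_divide_le_eq)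
          then show ?thesis by simp
        qed
        have "t \<in> A k" using k1 unfolding A_def lessThan_iff by linarith
        moreover have "max 0 (R - t) powr (1 + \<delta>) \<le> c k"
          unfolding c_def using k2 tR \<delta> by (intro powr_mono2) auto
        ultimately show ?thesis by blast
      qed
      show "A k \<in> sets borel" "0 \<le> c k" for k by (simp_all add: A_def c_def)
    qed (simp_all add: sum)
    have "trunc_moment n x \<le> (\<integral>t. max 0 (R - t) powr (1 + \<delta>) \<partial>dM M x) ^ Suc n / R\<^sup>2"
      unfolding trunc_moment_def \<delta>_def by (rule X.moment_upper_bound_finite_length[OF xR])
    also have "\<dots> \<le> S ^ Suc n / R\<^sup>2" by (intro divide_right_mono power_mono I_le) auto
    finally show ?thesis .
  qed
  then show "\<exists>B. \<forall>x. inside x \<longrightarrow> 0 < x \<longrightarrow> trunc_moment n x \<le> B" by blast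
qed

end

lemma total_mass_tendsto: "(M \<longlongrightarrow> string_total_mass M) (at_left \<infinity>)"
  and M_le_total_mass: "\<And>x. x < \<infinity> \<Longrightarrow> M x \<le> string_total_mass M"
proof -
  define s where "s = (SUP x\<in>{..<\<infinity>}. M x)"
  have M_le: "M x \<le> s" if "x < \<infinity>" for x unfolding s_def using that by (intro SUP_upper) auto
  have top: "(0::ennreal) < \<infinity>" by simp
  have lim: "(M \<longlongrightarrow> s) (at_left \<infinity>)"
  proof (rule order_tendstoI)
    fix a assume "a < s"
    then obtain x where "x < \<infinity>" "a < M x" unfolding s_def less_SUP_iff by auto
    then show "\<forall>\<^sub>F y in at_left \<infinity>. a < M y"
      unfolding eventually_at_left[OF top] using M_mono by (intro exI[of _ x]) (auto intro: less_le_trans)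
  next
    fix a assume "s < a"
    then show "\<forall>\<^sub>F y in at_left \<infinity>. M y < a"
      unfolding eventually_at_left[OF top] using M_le by (intro exI[of _ 0]) (auto intro: le_less_trans)
  qed
  have "at_left (\<infinity>::ennreal) \<noteq> bot"
  proof
    assume "at_left (\<infinity>::ennreal) = bot"
    then have "eventually (\<lambda>_. False) (at_left (\<infinity>::ennreal))" by simp
    then obtain b :: ennreal where "b < \<infinity>" "\<forall>y>b. \<not> y < \<infinity>"
      unfolding eventually_at_left[OF top] by auto
    then show False using dense by blast
  qed
  then have "string_total_mass M = s" unfolding string_total_mass_def using lim by (intro tendsto_Lim) auto
  then show "(M \<longlongrightarrow> string_total_mass M) (at_left \<infinity>)" "\<And>x. x < \<infinity> \<Longrightarrow> M x \<le> string_total_mass M"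
    using lim M_le by auto
qed

text \<open>
  For a string of finite length condition (i) is void.
\<close>
lemma total_mass_infinite_of_finite_length:
  assumes "string_length M < \<infinity>"
  shows "string_total_mass M = \<infinity>"
proof -
  obtain x where x: "string_length M < x" "x < \<infinity>" using assms dense by blast
  have "M x = \<infinity>"
  proof (rule ccontr)
    assume "M x \<noteq> \<infinity>"
    then have "x \<le> string_length M" unfolding string_length_def using x by (intro Sup_upper) (auto simp: less_top)
    then show False using x by simp
  qed
  then show ?thesis using M_le_total_mass[OF x(2)] by (simp add: top_unique)
qed

context
  assumes L: "string_length M = \<infinity>"
begin

lemma inside_iff_nonneg: "inside x \<longleftrightarrow> 0 \<le> x"
  by (auto simp: inside_def L)

text \<open>
  The truncation point tends to infinity, so that the factor \<open>1 - x/y\<close> disappears.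
\<close>
lemma trunc_moment_limit_lower_bound:
  assumes b: "\<And>x. inside x \<Longrightarrow> 0 < x \<Longrightarrow> trunc_moment n x \<le> b" and ax: "0 \<le> a" "a \<le> x"
  shows "a ^ n * (mass_upto x - mass_upto a) ^ Suc n \<le> b"
proof -
  have "((\<lambda>y. (1 - x / y) ^ (n + 2) * a ^ n * (mass_upto x - mass_upto a) ^ Suc n) \<longlongrightarrow> (1 - 0) ^ (n + 2) * a ^ n * (mass_upto x - mass_upto a) ^ Suc n) at_top"
    by (intro tendsto_intros real_tendsto_divide_at_top[OF tendsto_const filterlim_ident])
  then have "(1 - 0) ^ (n + 2) * a ^ n * (mass_upto x - mass_upto a) ^ Suc n \<le> b"
  proof (rule tendsto_upperbound)
    show "\<forall>\<^sub>F y in at_top. (1 - x / y) ^ (n + 2) * a ^ n * (mass_upto x - mass_upto a) ^ Suc n \<le> b"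
      using eventually_gt_at_top[of x]
    proof eventually_elim
      case (elim y)
      then have y: "inside y" "0 < y" using ax by (auto simp: inside_iff_nonneg)
      show ?case using order_trans[OF trunc_moment_lower_bound[OF y, of a x n] b[OF y]] elim ax by auto
    qed
  qed simp
  then show ?thesis by simp
qed

text \<open>
  Already the moment of order \<open>0\<close> bounds the mass.
\<close>
lemma total_mass_finite:
  assumes moments_bounded
  shows "string_total_mass M < \<infinity>"
proof -
  obtain b where b: "\<And>x. inside x \<Longrightarrow> 0 < x \<Longrightarrow> trunc_moment 0 x \<le> b" using assms by (auto simp: moments_bounded_def)
  have le: "M x \<le> ennreal (b + mass_upto 0)" if x: "x < \<infinity>" for x
  proof -
    obtain y where y: "x = ennreal y" "0 \<le> y" using x by (cases x) (auto simp: infinity_ennreal_def)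
    have "mass_upto y \<le> b + mass_upto 0" using trunc_moment_limit_lower_bound[OF b, of 0 y] y by simp
    then show ?thesis using y ennreal_mass_upto[of y] by (simp add: inside_iff_nonneg ennreal_leI flip: ennreal_mass_upto)
  qed
  have "string_total_mass M \<le> ennreal (b + mass_upto 0)"
  proof (rule tendsto_upperbound[OF total_mass_tendsto])
    show "\<forall>\<^sub>F x in at_left \<infinity>. M x \<le> ennreal (b + mass_upto 0)"
      using le by (auto simp: eventually_at_filter)
    show "at_left \<infinity> \<noteq> (bot :: ennreal filter)" using at_left_length_nontrivial L by simp
  qed
  then show ?thesis by (rule le_less_trans) simp
qed

context
  assumes fin: "string_total_mass M < \<infinity>"
begin

definition total :: real where "total = enn2real (string_total_mass M)"

lemma ennreal_total: "ennreal total = string_total_mass M"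
  using fin by (simp add: total_def)

lemma total_nonneg: "0 \<le> total" by (simp add: total_def)

lemma mass_upto_le_total: "0 \<le> x \<Longrightarrow> mass_upto x \<le> total"
  using M_le_total_mass[of "ennreal x"] fin by (auto simp: mass_upto_def total_def intro!: enn2real_mono)

lemma rest_eq: assumes "0 \<le> x" shows "enn2real (string_total_mass M - M (ennreal x)) = total - mass_upto x"
proof -
  have "string_total_mass M - M (ennreal x) = ennreal total - ennreal (mass_upto x)"
    using ennreal_mass_upto[of x] assms by (simp add: ennreal_total inside_iff_nonneg)
  also have "\<dots> = ennreal (total - mass_upto x)" by (rule ennreal_minus[OF mass_upto_nonneg])
  finally show ?thesis using mass_upto_le_total[OF assms] by simp
qed

lemma mass_upto_tendsto_total: "((\<lambda>x. enn2real (M x)) \<longlongrightarrow> total) (at_left \<infinity>)"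
  using total_mass_tendsto by (intro tendsto_enn2real) (simp_all add: ennreal_total total_nonneg)

lemma mass_upto_at_top: "(mass_upto \<longlongrightarrow> total) at_top"
proof (rule order_tendstoI)
  fix a assume "a < total"
  from order_tendstoD(1)[OF mass_upto_tendsto_total this] obtain b where b: "b < \<infinity>" "\<forall>y>b. y < \<infinity> \<longrightarrow> a < enn2real (M y)"
    using eventually_at_left[of 0 "\<infinity>::ennreal"] by auto
  then obtain r where r: "b = ennreal r" "0 \<le> r" by (cases b) auto
  show "\<forall>\<^sub>F x in at_top. a < mass_upto x"
    using eventually_gt_at_top[of r] by eventually_elim (use b r in \<open>auto simp: mass_upto_def ennreal_less_iff\<close>)
next
  fix a assume a: "total < a"
  show "\<forall>\<^sub>F x in at_top. mass_upto x < a"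
    by (rule eventually_mono[OF eventually_ge_at_top[of 0]]) (use a mass_upto_le_total in \<open>blast intro: le_less_trans\<close>)
qed

text \<open>
  For \<open>a = x\<close> and \<open>y\<close> tending to infinity, \<open>trunc_moment_limit_lower_bound\<close> bounds \<open>x\<^sup>n (total - M x)\<^bsup>n+1\<^esup>\<close>. Taking the
  \<open>n\<close>-th root with \<open>1/n < \<epsilon>\<close> leaves over a positive power of \<open>total - M x\<close>, which tends to zero.
\<close>
lemma infinite_length_decay_necessary:
  assumes B: moments_bounded and \<epsilon>: "0 < \<epsilon>"
  shows "((\<lambda>x. enn2real x * enn2real (string_total_mass M - M x) powr (1 + \<epsilon>)) \<longlongrightarrow> 0) (at_left \<infinity>)"
proof -
  obtain k where k: "1 / real (Suc k) < \<epsilon>" using nat_approx_posE[OF \<epsilon>] by blast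
  define n where "n = Suc k"
  obtain b where b: "\<And>x. inside x \<Longrightarrow> 0 < x \<Longrightarrow> trunc_moment n x \<le> b" using B by (auto simp: moments_bounded_def)
  have key: "x * (total - mass_upto x) powr (1 + 1 / real n) \<le> b powr (1 / real n)" if x: "0 \<le> x" for x
  proof (rule mult_powr_le_root[OF x])
    show "0 \<le> total - mass_upto x" using mass_upto_le_total[OF x] by simp
    show "x ^ n * (total - mass_upto x) ^ Suc n \<le> b"
    proof (rule tendsto_upperbound)
      show "((\<lambda>y. x ^ n * (mass_upto y - mass_upto x) ^ Suc n) \<longlongrightarrow> x ^ n * (total - mass_upto x) ^ Suc n) at_top"
        by (intro tendsto_intros mass_upto_at_top)
      show "\<forall>\<^sub>F y in at_top. x ^ n * (mass_upto y - mass_upto x) ^ Suc n \<le> b"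
        using eventually_ge_at_top[of x] by eventually_elim (rule trunc_moment_limit_lower_bound[OF b x])
    qed simp
  qed (simp add: n_def)
  have bound: "x * (total - mass_upto x) powr (1 + \<epsilon>) \<le> b powr (1 / real n) * (total - mass_upto x) powr (\<epsilon> - 1 / real n)" if x: "0 \<le> x" for x
  proof -
    have "(total - mass_upto x) powr (1 + \<epsilon>) = (total - mass_upto x) powr (1 + 1 / real n) * (total - mass_upto x) powr (\<epsilon> - 1 / real n)"
      by (simp add: powr_add[symmetric])
    then have "x * (total - mass_upto x) powr (1 + \<epsilon>) = (x * (total - mass_upto x) powr (1 + 1 / real n)) * (total - mass_upto x) powr (\<epsilon> - 1 / real n)"
      by simp
    also have "\<dots> \<le> b powr (1 / real n) * (total - mass_upto x) powr (\<epsilon> - 1 / real n)" by (intro mult_right_mono key x) simp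
    finally show ?thesis .
  qed
  have in_range: "\<forall>\<^sub>F x in at_left \<infinity>. \<exists>y. x = ennreal y \<and> 0 \<le> y"
    unfolding L[symmetric] by (rule eventually_at_left_length[where a=0]) (auto simp: L inside_iff_nonneg)
  show ?thesis
  proof (rule tendsto_sandwich)
    show "\<forall>\<^sub>F x in at_left \<infinity>. 0 \<le> enn2real x * enn2real (string_total_mass M - M x) powr (1 + \<epsilon>)" by simp
    show "\<forall>\<^sub>F x in at_left \<infinity>. enn2real x * enn2real (string_total_mass M - M x) powr (1 + \<epsilon>)
        \<le> b powr (1 / real n) * (total - enn2real (M x)) powr (\<epsilon> - 1 / real n)"
      using in_range
    proof eventually_elim
      case (elim x)
      then obtain y where y: "x = ennreal y" "0 \<le> y" by blast
      then show ?case using bound[of y] by (simp add: rest_eq mass_upto_def)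
    qed
    have "((\<lambda>x. b powr (1 / real n) * (total - enn2real (M x)) powr (\<epsilon> - 1 / real n)) \<longlongrightarrow> b powr (1 / real n) * 0) (at_left \<infinity>)"
    proof (intro tendsto_mult tendsto_const tendsto_zero_powrI)
      show "((\<lambda>x. total - enn2real (M x)) \<longlongrightarrow> 0) (at_left \<infinity>)"
        using tendsto_diff[OF tendsto_const[of total] mass_upto_tendsto_total] by simp
      show "\<forall>\<^sub>F x in at_left \<infinity>. 0 \<le> total - enn2real (M x)"
        using in_range by eventually_elim (auto dest: mass_upto_le_total simp: mass_upto_def)
      show "0 < \<epsilon> - 1 / real n" using k by (simp add: n_def)
    qed (rule tendsto_const)
    then show "((\<lambda>x. b powr (1 / real n) * (total - enn2real (M x)) powr (\<epsilon> - 1 / real n)) \<longlongrightarrow> 0) (at_left \<infinity>)" by simp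
  qed simp
qed

text \<open>
  By \<open>moment_upper_bound_infinite_length\<close> it suffices to bound \<open>\<integral> t\<^bsup>1-\<delta>\<^esup> dM\<close> with \<open>\<delta> = 1/(n + 1)\<close>. The decay condition for
  the exponent \<open>1 + \<epsilon> = 1/\<gamma>\<close> with \<open>\<gamma> = 1 - \<delta>/2\<close> gives \<open>total - M t = O(t\<^bsup>-\<gamma>\<^esup>)\<close>, so the part of the integral where \<open>t\<close> is of the order \<open>2\<^sup>k\<close>
  contributes \<open>O(2\<^bsup>-k\<delta>/2\<^esup>)\<close>.
\<close>
lemma infinite_length_decay_sufficient:
  assumes decay: "\<And>\<epsilon>. 0 < \<epsilon> \<Longrightarrow> ((\<lambda>x. enn2real x * enn2real (string_total_mass M - M x) powr (1 + \<epsilon>)) \<longlongrightarrow> 0) (at_left \<infinity>)"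
  shows moments_bounded
  unfolding moments_bounded_def
proof
  fix n
  show "\<exists>B. \<forall>x. inside x \<longrightarrow> 0 < x \<longrightarrow> trunc_moment n x \<le> B"
  proof (cases "n = 0")
    case True
    have "trunc_moment 0 x \<le> total" if x: "inside x" "0 < x" for x
    proof -
      interpret X: interval_mass "dM M x" x by (rule interval_mass_dM[OF x])
      have "trunc_moment 0 x \<le> mass_upto x" unfolding trunc_moment_def using X.moment_0_le_mass by (simp add: X.mass_def dM_UNIV[OF x(1)])
      then show ?thesis using mass_upto_le_total[of x] x by simp
    qed
    then show ?thesis using True by blast
  next
    case False
    define \<delta> where "\<delta> = 1 / real (Suc n)"
    have \<delta>: "0 < \<delta>" "\<delta> \<le> 1" by (auto simp: \<delta>_def)
    define \<gamma> where "\<gamma> = 1 - \<delta> / 2"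
    have \<gamma>: "0 < \<gamma>" "\<gamma> < 1" using \<delta> by (auto simp: \<gamma>_def)
    define \<epsilon> where "\<epsilon> = 1 / \<gamma> - 1"
    have \<epsilon>: "0 < \<epsilon>" using \<gamma> by (simp add: \<epsilon>_def)
    have "\<forall>\<^sub>F x in at_left \<infinity>. enn2real x * enn2real (string_total_mass M - M x) powr (1 + \<epsilon>) < 1"
      using order_tendstoD(2)[OF decay[OF \<epsilon>], of 1] by simp
    then obtain b0 where b0: "b0 < \<infinity>"
      "\<And>x. b0 < x \<Longrightarrow> x < \<infinity> \<Longrightarrow> enn2real x * enn2real (string_total_mass M - M x) powr (1 + \<epsilon>) < 1"
      using eventually_at_left[of 0 "\<infinity>::ennreal"] by auto
    then obtain y0 where y0: "b0 = ennreal y0" "0 \<le> y0" by (cases b0) auto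
    define C where "C = max 1 (y0 * total powr (1 + \<epsilon>))"
    have C: "1 \<le> C" by (simp add: C_def)
    have mass_bound: "x * (total - mass_upto x) powr (1 + \<epsilon>) \<le> C" if x: "0 \<le> x" for x
    proof (cases "x \<le> y0")
      case True
      have "x * (total - mass_upto x) powr (1 + \<epsilon>) \<le> y0 * total powr (1 + \<epsilon>)"
        using True x \<epsilon> mass_upto_le_total[OF x] mass_upto_nonneg[of x] by (intro mult_mono powr_mono2) auto
      then show ?thesis by (simp add: C_def)
    next
      case False
      then have "b0 < ennreal x" using y0 by (simp add: ennreal_less_iff)
      from b0(2)[OF this] show ?thesis using x by (simp add: rest_eq C_def)
    qed
    have tail: "total - mass_upto x \<le> C * x powr (- \<gamma>)" if x: "0 < x" for x
    proof -
      have d: "0 \<le> total - mass_upto x" using mass_upto_le_total[of x] x by simp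
      have "(1 + \<epsilon>) * \<gamma> = 1" using \<gamma> by (simp add: \<epsilon>_def)
      then have "total - mass_upto x = ((total - mass_upto x) powr (1 + \<epsilon>)) powr \<gamma>"
        using d by (cases "total - mass_upto x = 0") (auto simp: powr_powr)
      also have "\<dots> \<le> (C / x) powr \<gamma>"
        using mass_bound[of x] x \<gamma> by (intro powr_mono2) (auto simp: pos_le_divide_eq mult.commute)
      also have "\<dots> = C powr \<gamma> * x powr (- \<gamma>)" using x C by (simp add: powr_divide powr_minus_divide)
      also have "C powr \<gamma> \<le> C powr 1" using C \<gamma> by (intro powr_mono) auto
      then have "C powr \<gamma> * x powr (- \<gamma>) \<le> C * x powr (- \<gamma>)" using C by (intro mult_right_mono) auto
      finally show ?thesis .
    qed
    define A where "A k = (if k = 0 then UNIV else {2 ^ k / 2 :: real<..})" for k :: nat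
    define c where "c k = (2 ^ Suc k :: real) powr (1 - \<delta>)" for k :: nat
    \<comment> \<open>The piece \<open>A 0\<close> is the whole line, with \<open>total\<close> as bound for its mass; it serves the points \<open>t < 1\<close>.\<close>
    define B where "B = max total (C * 2 powr \<gamma>)"
    define b where "b k = B * (2 ^ k) powr (- \<gamma>)" for k :: nat
    have sum: "summable (\<lambda>k. c k * b k)"
    proof -
      have "c k * b k = (2 powr (1 - \<delta>) * B) * (2 powr (- (\<delta> / 2))) ^ k" for k
      proof -
        define h :: real where "h = 2 ^ k"
        have h: "0 < h" by (simp add: h_def)
        have "(2 * h) powr (1 - \<delta>) = 2 powr (1 - \<delta>) * h powr (1 - \<delta>)" using h by (simp add: powr_mult)
        moreover have "h powr (1 - \<delta>) * h powr (- \<gamma>) = h powr (- (\<delta> / 2))"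
          by (simp add: powr_add[symmetric] \<gamma>_def)
        moreover have "h powr (- (\<delta> / 2)) = (2 powr (- (\<delta> / 2))) ^ k"
        proof -
          have "h = 2 powr real k" by (simp add: h_def powr_realpow)
          then have "h powr (- (\<delta> / 2)) = (2 powr (- (\<delta> / 2))) powr real k" by (simp only: powr_powr mult.commute)
          then show ?thesis by (simp only: powr_realpow) (simp add: powr_realpow)
        qed
        ultimately show ?thesis unfolding c_def b_def power_Suc h_def[symmetric] by (simp add: mult_ac)
      qed
      moreover have "(2::real) powr (- (\<delta> / 2)) < 1" using \<delta> by (intro powr_less_one) auto
      ultimately show ?thesis by (simp only:) (intro summable_mult summable_geometric, simp)
    qed
    define S where "S = (\<Sum>k. c k * b k)"
    have "trunc_moment n x \<le> S ^ Suc n" if x: "inside x" "0 < x" for x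
    proof -
      interpret X: interval_mass "dM M x" x by (rule interval_mass_dM[OF x])
      have J_le: "(\<integral>t. max 0 t powr (1 - \<delta>) \<partial>dM M x) \<le> S"
        unfolding S_def
      proof (rule X.integral_le_cover[where A=A])
        show "X.bdd_fun (\<lambda>t. max 0 t powr (1 - \<delta>))"
          using \<delta> x by (intro X.bdd_fun_powr X.bdd_funI[of _ x]) auto
        show "measure (dM M x) (A k) \<le> b k" for k
        proof (cases "k = 0")
          case True
          then show ?thesis using mass_upto_le_total[of x] x by (simp add: A_def b_def B_def dM_UNIV)
        next
          case False
          define z :: real where "z = 2 ^ k / 2"
          have z: "0 < z" by (simp add: z_def)
          have "measure (dM M x) (A k) \<le> total - mass_upto z"
          proof (cases "z \<le> x")
            case True
            have "measure (dM M x) (A k) = measure (dM M x) {z<..x}"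
              by (intro X.finite_measure_eq_AE eventually_mono[OF X.supp]) (use False in \<open>auto simp: A_def z_def\<close>)
            also have "\<dots> = mass_upto x - mass_upto z" using True x z by (intro dM_Ioc) auto
            finally show ?thesis using mass_upto_le_total[of x] x by simp
          next
            case z_gt: False
            have "measure (dM M x) (A k) = measure (dM M x) {}"
              by (intro X.finite_measure_eq_AE eventually_mono[OF X.supp]) (use False z_gt in \<open>auto simp: A_def z_def\<close>)
            then show ?thesis using mass_upto_le_total[of z] z by simp
          qed
          also have "\<dots> \<le> C * z powr (- \<gamma>)" by (rule tail[OF z])
          also have "z powr (- \<gamma>) = 2 powr \<gamma> * (2 ^ k) powr (- \<gamma>)"
            unfolding z_def by (simp only: powr_divide powr_minus) (simp add: divide_inverse)
          also have "C * (2 powr \<gamma> * (2 ^ k) powr (- \<gamma>)) \<le> b k"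
            unfolding b_def B_def mult.assoc[symmetric] by (intro mult_right_mono) auto
          finally show ?thesis .
        qed
        show "\<exists>k. t \<in> A k \<and> max 0 t powr (1 - \<delta>) \<le> c k" if t: "t \<in> {0..x}" for t
        proof (cases "t < 1")
          case True
          have "max 0 t powr (1 - \<delta>) \<le> c 0" unfolding c_def using True t \<delta> by (intro powr_mono2) auto
          then show ?thesis by (intro exI[of _ 0]) (simp add: A_def)
        next
          case False
          obtain k where k: "1 / 2 ^ Suc k < 1 / t" "1 / t \<le> 1 / 2 ^ k"
            using False by (elim dyadic_scale[of "1 / t", rotated 2]) auto
          have t1: "2 ^ k \<le> t" "t \<le> 2 ^ Suc k"
            using k False by (auto simp: field_simps)
          have "0 < (2::real) ^ k" by simp
          then have "t \<in> A k" using t1(1) unfolding A_def by (simp, linarith)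
          moreover have "max 0 t powr (1 - \<delta>) \<le> c k" unfolding c_def using t1 t \<delta> by (intro powr_mono2) auto
          ultimately show ?thesis by blast
        qed
        show "A k \<in> sets borel" "0 \<le> c k" for k by (simp_all add: A_def c_def)
      qed (simp_all add: sum)
      have "trunc_moment n x \<le> (\<integral>t. max 0 t powr (1 - \<delta>) \<partial>dM M x) ^ Suc n"
        unfolding trunc_moment_def \<delta>_def using False by (intro X.moment_upper_bound_infinite_length) simp
      also have "\<dots> \<le> S ^ Suc n" by (intro power_mono J_le) auto
      finally show ?thesis .
    qed
    then show ?thesis by blast
  qed
qed

end

end

end

theorem theorem2:
  fixes M :: "ennreal \<Rightarrow> ennreal"
  assumes "M \<in> krein_strings"
  shows "M \<in> M_minus \<longleftrightarrow>
    ((string_total_mass M < \<infinity> \<and>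
      (\<forall>\<epsilon>::real. \<epsilon> > 0 \<longrightarrow>
        ((\<lambda>x. enn2real x * enn2real (string_total_mass M - M x) powr (1 + \<epsilon>)) \<longlongrightarrow> 0)
          (at_left \<infinity>)))
    \<or>
    (string_length M < \<infinity> \<and>
      (\<forall>\<epsilon>::real. \<epsilon> > 0 \<longrightarrow>
        ((\<lambda>x. enn2real (M x) * enn2real (string_length M - x) powr (1 + \<epsilon>)) \<longlongrightarrow> 0)
          (at_left (string_length M)))))"
proof -
  interpret krein_string M by unfold_locales (rule assms)
  consider "string_length M = 0" | "0 < string_length M" "string_length M < \<infinity>" | "string_length M = \<infinity>"
    by (cases "string_length M = 0"; cases "string_length M = \<infinity>") (auto simp: less_top zero_less_iff_neq_zero)
  then show ?thesis
  proof cases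
    case 1
    \<comment> \<open>At length \<open>0\<close> the limit in the second condition is over the trivial filter; the characteristic function is \<open>0\<close>, the transform of \<open>Infinite\<close>.\<close>
    have bot: "at_left (0::ennreal) = bot" 
      by (simp add: at_within_eq_bot_iff lessThan_def not_less_zero)
    have "characteristic_function M = minus_transform Infinite"
    proof -
      have "minus_transform Infinite = Proper (\<lambda>z\<in>slit_plane. 1 / (- z) * (restrict (\<lambda>z. 0) slit_plane) (1 / z))"
        by (simp add: minus_transform_def)
      also have "(\<lambda>z\<in>slit_plane. 1 / (- z) * (restrict (\<lambda>z. 0) slit_plane) (1 / z)) = (\<lambda>z\<in>slit_plane. 0)"
        by (rule restrict_ext) (simp add: slit_plane_inverse)
      finally have mt: "minus_transform Infinite = Proper (\<lambda>z\<in>slit_plane. 0)" .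
      show ?thesis unfolding mt characteristic_function_def Let_def by (simp only: 1 simp_thms if_True)
    qed
    moreover have "Infinite \<in> W_plus" by (simp add: W_plus_def W_class_def)
    ultimately have "M \<in> M_minus" using assms by (auto simp: M_minus_def W_minus_def)
    then show ?thesis using 1 by (simp add: bot)
  next
    case 2
    then obtain R where R: "string_length M = ennreal R" "0 < R"
      by (cases "string_length M") (auto simp: ennreal_less_zero_iff)
    show ?thesis
      unfolding M_minus_iff_moments_bounded[OF 2(1)]
      using total_mass_infinite_of_finite_length[OF 2(2)] 2(2)
        finite_length_decay_necessary[OF R] finite_length_decay_sufficient[OF R] by auto
  next
    case 3
    have "moments_bounded \<longleftrightarrow> string_total_mass M < \<infinity> \<and>
      (\<forall>\<epsilon>::real. \<epsilon> > 0 \<longrightarrow>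
        ((\<lambda>x. enn2real x * enn2real (string_total_mass M - M x) powr (1 + \<epsilon>)) \<longlongrightarrow> 0) (at_left \<infinity>))"
      using total_mass_finite[OF 3] infinite_length_decay_necessary[OF 3] infinite_length_decay_sufficient[OF 3] by blast
    then show ?thesis using M_minus_iff_moments_bounded 3 by simp
  qed
qed

end
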